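(* Suppose that for any $x_0\in\mathcal{G}$ there exist $T_{x_0}^{min},T_{x_0}^{max}\ge0$ with $T_{x_0}^{min}+T_{x_0}^{max}>0$ such that $T_{x_0}^{min}$ and $T_{x_0}^{max}$ are continuous in $x_0\in\mathcal{G}$, and $\{\mathfrak{X}_{x_0}(t):t\in[-T_{x_0}^{min},T_{x_0}^{max}]\}\subset\mathcal{H}$ for all $x_0\in\mathcal{G}$. Further assume that for some $\gamma_{\mathcal{G}}>0$ $$\inf_{x_0\in\mathcal{G}}\ \inf_{-T_{x_0}^{min}\le s<u\le T_{x_0}^{max}}\bigg\|\frac1{u-s}\int_s^uV(\mathfrak{X}_{x_0}(\lambda))\,d\lambda\bigg\|\ge\gamma_{\mathcal{G}}.$$ Assume moreover: (a) $f$ is four times continuously differentiable and all its partial derivatives of orders one to four are bounded on $\mathbb{R}^2$. (b) $\mathcal{H}\subset\mathbb{R}^2$ is compact, $f>0$ on $\mathcal{H}^{\epsilon_0}$ for some $\epsilon_0>0$, and $\nabla^2 f(x)$ has two distinct eigenvalues for every $x\in\mathcal{H}$. (c) The kernel $K$ is a four times differentiable symmetric probability density with support the unit ball in $\mathbb{R}^2$, all its first to fourth order partial derivatives are bounded, $\int_{\mathbb{R}^2}K(x)xx^T\,dx=\mu_2(K)\,\mathrm{I}_{2\times2}$ with $\mu_2(K)<\infty$, and $\int_{\mathbb{R}^2}d^2K(x)\,d^2K(x)^T\,dx$ is finite. (d) As $n\to\infty$: $h=h_n\downarrow0$, $nh_n^8/(\log n)^3\to\infty$, and $nh_n^9\to\beta$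 for some $\beta\ge0$. Then $$\sup_{x_0\in\mathcal{G}}\ \sup_{t\in[-T_{x_0}^{min},T_{x_0}^{max}]}\|\hat{\mathfrak{X}}_{x_0}(t)-\mathfrak{X}_{x_0}(t)\|=O_p\bigg(\sqrt{\frac{\log n}{nh^5}}\bigg).$$
   Context: Derivatives. For $\phi:\mathbb{R}^2\to\mathbb{R}$, $\phi^{(i,j)}=\partial^{i+j}\phi/\partial x_1^i\partial x_2^j$; $\nabla\phi$ and $\nabla^2\phi$ are the gradient (column vector) and Hessian; $d^2\phi=(\phi^{(2,0)},\phi^{(1,1)},\phi^{(0,2)})^T$. $\langle\cdot,\cdot\rangle$ and $\|\cdot\|$ are Euclidean. Eigenvector and eigenvalue. $f:\mathbb{R}^2\to[0,\infty)$ is a probability density. Let $$G(u,v,w)=\begin{pmatrix}2u-2w+2v-2\sqrt{(w-u)^2+4v^2}\\ w-u+4v-\sqrt{(w-u)^2+4v^2}\end{pmatrix},\qquad J(u,v,w)=\tfrac12\big(u+w-\sqrt{(u-w)^2+4v^2}\big).$$ Put $V(x)=G(d^2f(x))$ (an eigenvector of $\nabla^2f(x)$ for its smaller eigenvalue) and $\lambda_2(x)=J(d^2f(x))$ (the smaller eigenvalue). Integral curves. $\mathfrak{X}_{x_0}$ solves $\frac{d}{dt}\mathfrak{X}_{x_0}(t)=V(\mathfrak{X}_{x_0}(t))$, $\mathfrak{X}_{x_0}(0)=x_0$ ($t\in\mathbb{R}$). Starting set. A point $x$ is a filament point if $\langle\nabla f(x),V(x)\rangle=0$ and $\lambda_2(x)<0$;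 $\mathcal{L}\subset\mathcal{H}$ is the target filament (a curve consisting of filament points), and for some $a^*>0$, $\mathcal{G}=\{\mathfrak{X}_{x_0}(t):x_0\in\mathcal{L},-a^*\le t\le a^*\}$, which is assumed to be a subset of $\mathcal{H}$. $\mathcal{H}^{\epsilon}$ denotes the union of all open balls of radius $\epsilon$ centered in $\mathcal{H}$. Estimators. $X_1,X_2,\dots$ are i.i.d. with density $f$; $\hat f(x)=\frac1{nh^2}\sum_{i=1}^nK\big(\frac{x-X_i}{h}\big)$ with kernel $K:\mathbb{R}^2\to[0,\infty)$ and bandwidth $h=h_n>0$. $\hat V(x)=G(d^2\hat f(x))$; $\hat{\mathfrak{X}}_{x_0}$ solves $\frac{d}{dt}\hat{\mathfrak{X}}_{x_0}(t)=\hat V(\hat{\mathfrak{X}}_{x_0}(t))$, $\hat{\mathfrak{X}}_{x_0}(0)=x_0$. *)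

theory Defs
  imports "HOL-Probability.Probability"
begin

section \<open>Derivatives of functions on the plane\<close>

definition partial_deriv :: "2 \<Rightarrow> (real^2 \<Rightarrow> real) \<Rightarrow> real^2 \<Rightarrow> real" where
  "partial_deriv k \<phi> x = deriv (\<lambda>t. \<phi> (x + t *\<^sub>R axis k 1)) 0"

definition mixed_partial :: "nat \<Rightarrow> nat \<Rightarrow> (real^2 \<Rightarrow> real) \<Rightarrow> real^2 \<Rightarrow> real" where
  "mixed_partial i j \<phi> = (partial_deriv 1 ^^ i) ((partial_deriv 2 ^^ j) \<phi>)"

definition gradient :: "(real^2 \<Rightarrow> real) \<Rightarrow> real^2 \<Rightarrow> real^2" where
  "gradient \<phi> x = (\<chi> k. partial_deriv k \<phi> x)"

definition Hessian :: "(real^2 \<Rightarrow> real) \<Rightarrow> real^2 \<Rightarrow> real^2^2" where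
  "Hessian \<phi> x = (\<chi> k l. partial_deriv k (partial_deriv l \<phi>) x)"

definition d2 :: "(real^2 \<Rightarrow> real) \<Rightarrow> real^2 \<Rightarrow> real^3" where
  "d2 \<phi> x = vector [mixed_partial 2 0 \<phi> x, mixed_partial 1 1 \<phi> x, mixed_partial 0 2 \<phi> x]"

text \<open>Differentiability is Frechet differentiability on the whole plane. Since a function is
  \<open>k + 1\<close> times differentiable iff it is differentiable and all its partial derivatives are \<open>k\<close>
  times differentiable, recursion over the partial derivatives avoids iterated operator spaces.\<close>

fun times_differentiable :: "nat \<Rightarrow> (real^2 \<Rightarrow> real) \<Rightarrow> bool" where
  "times_differentiable 0 \<phi> \<longleftrightarrow> True"
| "times_differentiable (Suc m) \<phi> \<longleftrightarrow>
     \<phi> differentiable_on UNIV \<and> (\<forall>k. times_differentiable m (partial_deriv k \<phi>))"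

fun times_continuously_differentiable :: "nat \<Rightarrow> (real^2 \<Rightarrow> real) \<Rightarrow> bool" where
  "times_continuously_differentiable 0 \<phi> \<longleftrightarrow> continuous_on UNIV \<phi>"
| "times_continuously_differentiable (Suc m) \<phi> \<longleftrightarrow>
     \<phi> differentiable_on UNIV \<and> (\<forall>k. times_continuously_differentiable m (partial_deriv k \<phi>))"

definition bounded_pderivs :: "nat \<Rightarrow> nat \<Rightarrow> (real^2 \<Rightarrow> real) \<Rightarrow> bool" where
  "bounded_pderivs m n \<phi> \<longleftrightarrow>
     (\<forall>i j. m \<le> i + j \<and> i + j \<le> n \<longrightarrow> bounded (range (mixed_partial i j \<phi>)))"


section \<open>Matrices\<close>

definition eigenvalue :: "real^'n^'n \<Rightarrow> real \<Rightarrow> bool" where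
  "eigenvalue A l \<longleftrightarrow> (\<exists>v. v \<noteq> 0 \<and> A *v v = l *\<^sub>R v)"

definition outer_prod :: "real^'m \<Rightarrow> real^'n \<Rightarrow> real^'n^'m" where
  "outer_prod x y = (\<chi> i j. x $ i * y $ j)"


section \<open>Eigenvector field, integral curves and filaments\<close>

definition G_fun :: "real^3 \<Rightarrow> real^2" where
  "G_fun z = (let u = z $ 1; v = z $ 2; w = z $ 3 in
     vector [2 * u - 2 * w + 2 * v - 2 * sqrt ((w - u)^2 + 4 * v^2),
             w - u + 4 * v - sqrt ((w - u)^2 + 4 * v^2)])"

definition J_fun :: "real^3 \<Rightarrow> real" where
  "J_fun z = (let u = z $ 1; v = z $ 2; w = z $ 3 in
     (u + w - sqrt ((u - w)^2 + 4 * v^2)) / 2)"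

definition eigvec_field :: "(real^2 \<Rightarrow> real) \<Rightarrow> real^2 \<Rightarrow> real^2" where
  "eigvec_field \<phi> x = G_fun (d2 \<phi> x)"

definition lambda2 :: "(real^2 \<Rightarrow> real) \<Rightarrow> real^2 \<Rightarrow> real" where
  "lambda2 \<phi> x = J_fun (d2 \<phi> x)"

definition integral_curve :: "(real^2 \<Rightarrow> real^2) \<Rightarrow> real^2 \<Rightarrow> (real \<Rightarrow> real^2) \<Rightarrow> bool" where
  "integral_curve V x0 c \<longleftrightarrow>
     c 0 = x0 \<and> (\<forall>t. (c has_vector_derivative V (c t)) (at t))"

definition filament_point :: "(real^2 \<Rightarrow> real) \<Rightarrow> real^2 \<Rightarrow> bool" where
  "filament_point \<phi> x \<longleftrightarrow> gradient \<phi> x \<bullet> eigvec_field \<phi> x = 0 \<and> lambda2 \<phi> x < 0"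

text \<open>A curve in the broadest sense: it may be closed or open, and of any regularity.\<close>

definition is_curve :: "(real^2) set \<Rightarrow> bool" where
  "is_curve C \<longleftrightarrow>
     (\<exists>(I :: real set) c. is_interval I \<and> I \<noteq> {} \<and> continuous_on I c \<and> C = c ` I)"

definition starting_set ::
    "(real^2 \<Rightarrow> real \<Rightarrow> real^2) \<Rightarrow> (real^2) set \<Rightarrow> real \<Rightarrow> (real^2) set" where
  "starting_set \<XX> L a = {\<XX> x0 t | x0 t. x0 \<in> L \<and> - a \<le> t \<and> t \<le> a}"

definition enlargement :: "(real^2) set \<Rightarrow> real \<Rightarrow> (real^2) set" where
  "enlargement H \<epsilon> = (\<Union>x\<in>H. ball x \<epsilon>)"


section \<open>Probability\<close>

definition prob_density :: "(real^2 \<Rightarrow> real) \<Rightarrow> bool" where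
  "prob_density g \<longleftrightarrow> g \<in> borel_measurable borel \<and> (\<forall>x. 0 \<le> g x) \<and>
     (\<integral>\<^sup>+x. ennreal (g x) \<partial>lborel) = 1"

definition support :: "(real^2 \<Rightarrow> real) \<Rightarrow> (real^2) set" where
  "support g = closure {x. g x \<noteq> 0}"

text \<open>The sample \<open>X 1, X 2, \<dots>\<close> is indexed from 1.\<close>

definition kde ::
    "(real^2 \<Rightarrow> real) \<Rightarrow> (nat \<Rightarrow> real) \<Rightarrow> (nat \<Rightarrow> 'a \<Rightarrow> real^2) \<Rightarrow> nat \<Rightarrow> 'a \<Rightarrow> real^2 \<Rightarrow> real" where
  "kde K h X n \<omega> x =
     1 / (real n * (h n)^2) * (\<Sum>i=1..n. K ((1 / h n) *\<^sub>R (x - X i \<omega>)))"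

text \<open>\<open>Z n = O\<^sub>p(r n)\<close> for nonnegative \<open>Z\<close>. Probabilities are outer probabilities, so that no
  measurability of \<open>Z\<close> has to be presupposed; if \<open>Z n\<close> is measurable, the condition reads
  \<open>P(Z n > C r n) < \<epsilon>\<close>.\<close>

definition bigO_in_prob :: "'a measure \<Rightarrow> (nat \<Rightarrow> 'a \<Rightarrow> ennreal) \<Rightarrow> (nat \<Rightarrow> real) \<Rightarrow> bool" where
  "bigO_in_prob M Z r \<longleftrightarrow>
     (\<forall>\<epsilon>>0. \<exists>C>0. \<forall>\<^sub>F n in sequentially.
        \<exists>A\<in>sets M. {\<omega> \<in> space M. Z n \<omega> > ennreal (C * r n)} \<subseteq> A \<and> measure M A < \<epsilon>)"

end

theory Submission
  imports Defs
begin

text \<open>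
  The error \<open>e = \<XX>hat - \<XX>\<close> of an estimated integral curve satisfies an integral equation. If the
  estimated field is Lipschitz with a constant that does not depend on \<open>n\<close>, Gronwall's inequality
  bounds \<open>e\<close>, up to a constant factor, by the supremum over \<open>t\<close> of the drift: the integral up to
  time \<open>t\<close> of the error of the estimated field along the true curve (\<open>ode_comparison\<close>). So the
  error of the field matters only through its integrals along the true curves, and the flow itself
  need not be linearised.

  These integrals are smaller than the error of the field. On \<open>\<H>\<close> the eigenvalues of the Hessian
  are separated, hence the eigenvector formula is differentiable there with a quadratic remainder
  (\<open>G_fun_expansion\<close>), and up to this remainder the drift is an integral of a linear functional of
  the error in the second derivatives. Its stochastic part is a sample mean. At a single point
  an observation contributes up to order \<open>1 / h ^ 4\<close>, with second moment of order \<open>1 / h ^ 6\<close>. The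
  hypothesis on the averages of the field says that \<open>norm (\<XX> x u - \<XX> x s) \<ge> \<gamma> * (u - s)\<close>, so a
  curve stays in a ball of radius \<open>h\<close> for a time of order \<open>h\<close> only. Integrated along the curve, an
  observation therefore contributes at most order \<open>1 / h ^ 3\<close>, with second moment of order
  \<open>1 / h ^ 5\<close> (\<open>whp_curve_integrals\<close>), and Bernstein's inequality together with a union
  bound over polynomially many curves and times gives the rate \<open>sqrt (ln n / (n * h ^ 5))\<close>.

  The other contributions do not exceed this rate. The bias is of order \<open>h\<^sup>2\<close> (\<open>mean_bias\<close>), which
  is covered because \<open>n * h ^ 9\<close> converges. The quadratic remainder is governed by the squared
  uniform error of the second derivatives, of order \<open>ln n / (n * h ^ 6)\<close> up to the bias
  (\<open>whp_dhat_deviation\<close>), and this is covered because \<open>n * h ^ 8\<close> dominates \<open>ln n\<close>.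

  The Lipschitz property of the estimated field comes from Bernstein's inequality for difference
  quotients at pairs of points of a net (\<open>whp_dhat_lipschitz\<close>); their second moments are of
  order \<open>1 / h ^ 8\<close>, so \<open>n * h ^ 8\<close> has to dominate \<open>ln n\<close> once more. It holds on bounded sets only,
  but an estimated curve cannot leave the neighbourhood of radius 1 of the true curve as long as the
  bound that is being proved is smaller than 1.
\<close>

section \<open>Norms and partial derivatives in the plane\<close>

lemma norm_diff_chain:
  fixes a b :: "'b::real_normed_vector"
  shows "norm (a - b) \<le> norm (a - a') + norm (a' - b') + norm (b - b')"
  using dist_triangle[of a b a'] dist_triangle[of a' b b'] by (simp add: dist_norm norm_minus_commute)

lemma norm_le_componentwise:
  fixes v :: "real^'n"
  assumes "\<And>j. \<bar>v $ j\<bar> \<le> b"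
  shows "norm v \<le> real CARD('n) * b"
  using order_trans[OF norm_le_l1_cart sum_mono[of UNIV "\<lambda>j. \<bar>v $ j\<bar>" "\<lambda>_. b"]] assms by simp

text \<open>Constants that are found separately for finitely many components are merged by summation.\<close>

lemma uniform_constant:
  fixes P :: "'j::finite \<Rightarrow> real \<Rightarrow> bool"
  assumes ex: "\<And>j. \<exists>B>0. P j B" and mono: "\<And>j B B'. P j B \<Longrightarrow> B \<le> B' \<Longrightarrow> P j B'"
  shows "\<exists>B>0. \<forall>j. P j B"
proof -
  have "\<forall>j. \<exists>B. B > 0 \<and> P j B" using ex by blast
  then obtain B where B: "\<forall>j. B j > 0 \<and> P j (B j)" by (rule choice[THEN exE])
  have "B j \<le> (\<Sum>j\<in>UNIV. B j)" for j using B by (intro member_le_sum) (auto intro: less_imp_le)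
  then have "P j (\<Sum>j\<in>UNIV. B j)" for j using B mono by blast
  moreover have "(\<Sum>j\<in>UNIV. B j) > 0" using B by (intro sum_pos) auto
  ultimately show ?thesis by blast
qed

lemma has_derivative_partials:
  fixes \<phi> :: "real^2 \<Rightarrow> real"
  assumes "\<phi> differentiable (at x)"
  shows "(\<phi> has_derivative (\<lambda>v. \<Sum>k\<in>UNIV. v $ k * partial_deriv k \<phi> x)) (at x)"
proof -
  obtain \<phi>' where d: "(\<phi> has_derivative \<phi>') (at x)"
    using assms by (auto simp: differentiable_def)
  interpret linear \<phi>' using d by (rule has_derivative_linear)
  have k: "partial_deriv k \<phi> x = \<phi>' (axis k 1)" for k
  proof -
    have "((\<lambda>t. x + t *\<^sub>R axis k 1) has_derivative (\<lambda>t. t *\<^sub>R axis k (1::real))) (at 0)"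
      by (auto intro!: derivative_eq_intros)
    then have "((\<lambda>t. \<phi> (x + t *\<^sub>R axis k 1)) has_derivative (\<lambda>t. \<phi>' (t *\<^sub>R axis k 1))) (at 0)"
      by (rule has_derivative_compose[of "\<lambda>t. x + t *\<^sub>R axis k (1::real)"]) (use d in simp)
    then have "((\<lambda>t. \<phi> (x + t *\<^sub>R axis k 1)) has_real_derivative \<phi>' (axis k 1)) (at 0)"
      unfolding has_field_derivative_def by (rule has_derivative_eq_rhs) (simp add: scale fun_eq_iff)
    then show ?thesis by (simp add: partial_deriv_def DERIV_imp_deriv)
  qed
  have "\<phi>' v = (\<Sum>k\<in>UNIV. v $ k * partial_deriv k \<phi> x)" for v
  proof -
    have "\<phi>' v = \<phi>' (\<Sum>k\<in>UNIV. v $ k *\<^sub>R axis k 1)"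
      using basis_expansion[of v] by (simp add: scalar_mult_eq_scaleR)
    then show ?thesis by (simp add: sum scale k)
  qed
  then have "\<phi>' = (\<lambda>v. \<Sum>k\<in>UNIV. v $ k * partial_deriv k \<phi> x)" by auto
  with d show ?thesis by simp
qed

lemma has_real_derivative_along_line:
  fixes \<phi> :: "real^2 \<Rightarrow> real"
  assumes "\<phi> differentiable (at (x + s *\<^sub>R v))"
  shows "((\<lambda>t. \<phi> (x + t *\<^sub>R v)) has_real_derivative
           (\<Sum>k\<in>UNIV. v $ k * partial_deriv k \<phi> (x + s *\<^sub>R v))) (at s)"
proof -
  have "((\<lambda>t. x + t *\<^sub>R v) has_derivative (\<lambda>t. t *\<^sub>R v)) (at s)"
    by (auto intro!: derivative_eq_intros)
  from has_derivative_compose[OF this has_derivative_partials[OF assms]]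
  show ?thesis unfolding has_field_derivative_def
    by (rule has_derivative_eq_rhs) (simp add: fun_eq_iff sum_distrib_left sum_distrib_right mult_ac)
qed

lemma has_real_derivative_partial:
  fixes \<phi> :: "real^2 \<Rightarrow> real"
  assumes "\<phi> differentiable (at (x + s *\<^sub>R axis k 1))"
  shows "((\<lambda>t. \<phi> (x + t *\<^sub>R axis k 1)) has_real_derivative
           partial_deriv k \<phi> (x + s *\<^sub>R axis k 1)) (at s)"
proof -
  have "(\<Sum>l\<in>UNIV. axis k 1 $ l * partial_deriv l \<phi> y) = partial_deriv k \<phi> y" for y
    by (cases k rule: exhaust_2[THEN disjE]) (simp_all add: sum_2 axis_def)
  then show ?thesis using has_real_derivative_along_line[OF assms] by simp
qed

text \<open>The second difference of \<open>\<phi>\<close> over a square with corner \<open>x\<close> and side \<open>s\<close> equals \<open>s\<^sup>2\<close> times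
  either mixed derivative at some point of the square, by the mean value theorem applied to the
  two variables in either order. Continuity gives equality in the limit \<open>s \<longlonglongrightarrow> 0\<close>.\<close>

lemma partial_deriv_commute:
  assumes d: "\<phi> differentiable_on UNIV" "\<And>k. partial_deriv k \<phi> differentiable_on UNIV"
    and c: "\<And>k l. continuous_on UNIV (partial_deriv k (partial_deriv l \<phi>))"
  shows "partial_deriv k (partial_deriv l \<phi>) x = partial_deriv l (partial_deriv k \<phi>) x"
proof -
  have da: "\<phi> differentiable (at y)" "partial_deriv k \<phi> differentiable (at y)" for y k
    using d by (auto simp: differentiable_on_def)
  have mv: "\<exists>p. norm (p - x) \<le> 2 * s \<and>
      \<phi> (x + s *\<^sub>R axis k 1 + s *\<^sub>R axis l 1) - \<phi> (x + s *\<^sub>R axis k 1) - \<phi> (x + s *\<^sub>R axis l 1) + \<phi> x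
       = s * s * partial_deriv l (partial_deriv k \<phi>) p" if s: "s > 0" for s k l
  proof -
    define g where "g t = \<phi> (x + s *\<^sub>R axis l 1 + t *\<^sub>R axis k 1) - \<phi> (x + t *\<^sub>R axis k 1)" for t
    have "(g has_real_derivative (partial_deriv k \<phi> (x + s *\<^sub>R axis l 1 + t *\<^sub>R axis k 1)
            - partial_deriv k \<phi> (x + t *\<^sub>R axis k 1))) (at t)" for t
      unfolding g_def by (intro DERIV_diff has_real_derivative_partial da)
    then obtain \<sigma> where \<sigma>: "0 < \<sigma>" "\<sigma> < s" "g s - g 0 = (s - 0) *
        (partial_deriv k \<phi> (x + s *\<^sub>R axis l 1 + \<sigma> *\<^sub>R axis k 1)
            - partial_deriv k \<phi> (x + \<sigma> *\<^sub>R axis k 1))"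
      using MVT2[of 0 s g "\<lambda>t. partial_deriv k \<phi> (x + s *\<^sub>R axis l 1 + t *\<^sub>R axis k 1)
            - partial_deriv k \<phi> (x + t *\<^sub>R axis k 1)"] s by blast
    have "((\<lambda>t. partial_deriv k \<phi> (x + \<sigma> *\<^sub>R axis k 1 + t *\<^sub>R axis l 1)) has_real_derivative
        partial_deriv l (partial_deriv k \<phi>) (x + \<sigma> *\<^sub>R axis k 1 + t *\<^sub>R axis l 1)) (at t)" for t
      by (intro has_real_derivative_partial da)
    then obtain \<tau> where \<tau>: "0 < \<tau>" "\<tau> < s" "partial_deriv k \<phi> (x + \<sigma> *\<^sub>R axis k 1 + s *\<^sub>R axis l 1)
         - partial_deriv k \<phi> (x + \<sigma> *\<^sub>R axis k 1 + 0 *\<^sub>R axis l 1) = (s - 0) *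
        partial_deriv l (partial_deriv k \<phi>) (x + \<sigma> *\<^sub>R axis k 1 + \<tau> *\<^sub>R axis l 1)"
      using MVT2[of 0 s "\<lambda>t. partial_deriv k \<phi> (x + \<sigma> *\<^sub>R axis k 1 + t *\<^sub>R axis l 1)"
        "\<lambda>t. partial_deriv l (partial_deriv k \<phi>) (x + \<sigma> *\<^sub>R axis k 1 + t *\<^sub>R axis l 1)"] s by blast
    have "norm (\<sigma> *\<^sub>R axis k 1 + \<tau> *\<^sub>R axis l 1 :: real^2) \<le> \<sigma> + \<tau>"
      using \<sigma> \<tau> by (intro order_trans[OF norm_triangle_ineq]) simp
    then show ?thesis using \<sigma> \<tau>
      by (intro exI[of _ "x + \<sigma> *\<^sub>R axis k 1 + \<tau> *\<^sub>R axis l 1"])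
         (auto simp: g_def add_ac)
  qed
  let ?A = "partial_deriv k (partial_deriv l \<phi>)" and ?B = "partial_deriv l (partial_deriv k \<phi>)"
  have "\<exists>p q. norm (p - x) \<le> 2 * inverse (real (Suc n)) \<and> norm (q - x) \<le> 2 * inverse (real (Suc n)) \<and> ?A p = ?B q" for n
  proof -
    have s: "inverse (real (Suc n)) > 0" by simp
    from mv[OF s, of k l] obtain p where p: "norm (p - x) \<le> 2 * inverse (real (Suc n))"
      "\<phi> (x + inverse (real (Suc n)) *\<^sub>R axis k 1 + inverse (real (Suc n)) *\<^sub>R axis l 1)
        - \<phi> (x + inverse (real (Suc n)) *\<^sub>R axis k 1) - \<phi> (x + inverse (real (Suc n)) *\<^sub>R axis l 1) + \<phi> x
       = inverse (real (Suc n)) * inverse (real (Suc n)) * ?B p" by blast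
    from mv[OF s, of l k] obtain q where q: "norm (q - x) \<le> 2 * inverse (real (Suc n))"
      "\<phi> (x + inverse (real (Suc n)) *\<^sub>R axis l 1 + inverse (real (Suc n)) *\<^sub>R axis k 1)
        - \<phi> (x + inverse (real (Suc n)) *\<^sub>R axis l 1) - \<phi> (x + inverse (real (Suc n)) *\<^sub>R axis k 1) + \<phi> x
       = inverse (real (Suc n)) * inverse (real (Suc n)) * ?A q" by blast
    have "inverse (real (Suc n)) * inverse (real (Suc n)) * ?B p
        = inverse (real (Suc n)) * inverse (real (Suc n)) * ?A q"
    proof -
      have "x + inverse (real (Suc n)) *\<^sub>R axis l 1 + inverse (real (Suc n)) *\<^sub>R axis k 1
          = x + inverse (real (Suc n)) *\<^sub>R axis k 1 + inverse (real (Suc n)) *\<^sub>R axis l 1"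
        unfolding add.assoc by (subst (2) add.commute) (rule refl)
      from q(2)[unfolded this] p(2) show ?thesis by linarith
    qed
    then have "?A q = ?B p" using s by simp
    then show ?thesis using p(1) q(1) by blast
  qed
  then obtain p q where pq: "\<And>n. norm (p n - x) \<le> 2 * inverse (real (Suc n))"
    "\<And>n. norm (q n - x) \<le> 2 * inverse (real (Suc n))" "\<And>n. ?A (p n) = ?B (q n)" by metis
  have z: "(\<lambda>n. 2 * inverse (real (Suc n))) \<longlonglongrightarrow> 0"
    using tendsto_mult_left[OF LIMSEQ_inverse_real_of_nat, of 2] by simp
  have "p \<longlonglongrightarrow> x" "q \<longlonglongrightarrow> x"
    by (rule LIM_zero_cancel, rule Lim_null_comparison[OF _ z], use pq in auto)+
  then have "(\<lambda>n. ?A (p n)) \<longlonglongrightarrow> ?A x" "(\<lambda>n. ?B (q n)) \<longlonglongrightarrow> ?B x"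
    using continuous_on_tendsto_compose[OF c] by auto
  then show ?thesis using pq(3) by (simp add: LIMSEQ_unique)
qed

lemma lipschitz_of_bounded_partials:
  assumes d: "\<phi> differentiable_on UNIV" and "convex S"
    and b: "\<And>k x. x \<in> S \<Longrightarrow> \<bar>partial_deriv k \<phi> x\<bar> \<le> B"
    and xy: "x \<in> S" "y \<in> S"
  shows "\<bar>\<phi> x - \<phi> y\<bar> \<le> 2 * B * norm (x - y)"
proof -
  have B: "onorm (\<lambda>v. \<Sum>k\<in>UNIV. v $ k * partial_deriv k \<phi> z) \<le> 2 * B" if "z \<in> S" for z
  proof (rule onorm_le)
    fix v :: "real^2"
    have "0 \<le> B" using b[OF that, of 1] by linarith
    have "norm (v $ k * partial_deriv k \<phi> z) \<le> norm v * B" for k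
      unfolding norm_mult using b[OF that, of k] \<open>0 \<le> B\<close> component_le_norm_cart[of v k]
      by (intro mult_mono) auto
    then have "norm (\<Sum>k\<in>UNIV. v $ k * partial_deriv k \<phi> z) \<le> (\<Sum>k\<in>(UNIV :: 2 set). norm v * B)"
      (is "?l \<le> _") by (rule sum_norm_le)
    also have "\<dots> = 2 * B * norm v" by simp
    finally show "?l \<le> 2 * B * norm v" .
  qed
  have "norm (\<phi> x - \<phi> y) \<le> 2 * B * norm (x - y)"
  proof (rule differentiable_bound[OF \<open>convex S\<close> _ B xy])
    fix z show "(\<phi> has_derivative (\<lambda>v. \<Sum>k\<in>UNIV. v $ k * partial_deriv k \<phi> z)) (at z within S)"
      using d by (auto simp: differentiable_on_def
          intro!: has_derivative_at_withinI[OF has_derivative_partials])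
  qed
  then show ?thesis by simp
qed

lemma bounded_partials_on_compact:
  assumes "compact (S :: (real^2) set)" "\<And>k::2. continuous_on S (g k)"
  shows "\<exists>B>0. \<forall>k. \<forall>x\<in>S. \<bar>g k x :: real\<bar> \<le> B"
proof -
  have "\<exists>B. \<forall>x\<in>S. \<bar>g k x\<bar> \<le> B" for k
    using compact_imp_bounded[OF compact_continuous_image[OF assms(2) assms(1), of k]]
    by (auto simp: bounded_iff)
  then obtain B where B: "\<And>k x. x \<in> S \<Longrightarrow> \<bar>g k x\<bar> \<le> B k" by metis
  have "\<bar>g k x\<bar> \<le> 1 + (\<Sum>k\<in>UNIV. \<bar>B k\<bar>)" if "x \<in> S" for k x
  proof -
    have "\<bar>B k\<bar> \<le> (\<Sum>k\<in>UNIV. \<bar>B k\<bar>)" by (rule member_le_sum) auto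
    then show ?thesis using B[OF that, of k] by linarith
  qed
  moreover have "1 + (\<Sum>k\<in>UNIV. \<bar>B k\<bar>) > 0" by (simp add: add_pos_nonneg sum_nonneg)
  ultimately show ?thesis by blast
qed

lemma lipschitz_on_compact:
  assumes "\<phi> differentiable_on UNIV" "\<And>k. continuous_on UNIV (partial_deriv k \<phi>)"
    "compact S" "convex S"
  shows "\<exists>L>0. \<forall>x\<in>S. \<forall>y\<in>S. \<bar>\<phi> x - \<phi> y\<bar> \<le> L * norm (x - y)"
proof -
  have "continuous_on S (partial_deriv k \<phi>)" for k
    using continuous_on_subset[OF assms(2)] by simp
  from bounded_partials_on_compact[OF \<open>compact S\<close>, of "\<lambda>k. partial_deriv k \<phi>", OF this]
  obtain B where "B > 0" "\<And>k x. x \<in> S \<Longrightarrow> \<bar>partial_deriv k \<phi> x\<bar> \<le> B" by metis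
  note B = this
  show ?thesis
  proof (intro exI conjI ballI)
    show "2 * B > 0" using B by simp
    show "\<bar>\<phi> x - \<phi> y\<bar> \<le> 2 * B * norm (x - y)" if "x \<in> S" "y \<in> S" for x y
      by (rule lipschitz_of_bounded_partials[OF assms(1,4) B(2) that])
  qed
qed

section \<open>Integration by parts and kernel sums\<close>

text \<open>Component \<open>j\<close> of \<open>d2 \<phi>\<close> is the derivative in direction \<open>idx1 j\<close> of the derivative in direction
  \<open>idx2 j\<close>, which lets one argument serve all three components.\<close>

definition idx1 :: "3 \<Rightarrow> 2" where "idx1 j = (if j = 3 then 2 else 1)"
definition idx2 :: "3 \<Rightarrow> 2" where "idx2 j = (if j = 1 then 1 else 2)"

lemma d2_nth: "d2 \<phi> x $ j = partial_deriv (idx1 j) (partial_deriv (idx2 j) \<phi>) x"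
proof -
  consider "j = 1" | "j = 2" | "j = 3" using exhaust_3[of j] by auto
  then show ?thesis
    by cases (auto simp: d2_def idx1_def idx2_def mixed_partial_def numeral_2_eq_2)
qed

lemma integral_affine_plane:
  fixes F :: "real^2 \<Rightarrow> real"
  assumes [measurable]: "F \<in> borel_measurable borel" and c: "c \<noteq> 0"
  shows "(\<integral>y. F y \<partial>lborel) = c\<^sup>2 * (\<integral>z. F (t + c *\<^sub>R z) \<partial>lborel)"
proof -
  have "(\<integral>y. F y \<partial>lborel) = (\<integral>y. F y \<partial>(density (distr lborel borel (\<lambda>x. t + c *\<^sub>R x)) (\<lambda>_. ennreal (c\<^sup>2))))"
    using lborel_affine[OF c, of t] by (simp add: ennreal_power)
  also have "\<dots> = (\<integral>z. c\<^sup>2 * F (t + c *\<^sub>R z) \<partial>lborel)"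
    by (subst integral_density) (auto simp: integral_distr)
  finally show ?thesis by simp
qed

lemma integrable_compact_support:
  fixes w :: "real^2 \<Rightarrow> real"
  assumes "continuous_on UNIV w" "\<And>z. norm z > r \<Longrightarrow> w z = 0"
  shows "integrable lborel w"
proof -
  have "integrable lborel (\<lambda>z. indicator (cball 0 r) z *\<^sub>R w z)"
    by (rule borel_integrable_compact) (auto intro: continuous_on_subset[OF assms(1)])
  also have "(\<lambda>z. indicator (cball 0 r) z *\<^sub>R w z) = w"
    using assms(2) by (auto simp: indicator_def fun_eq_iff not_le)
  finally show ?thesis .
qed

lemma bounded_compact_support:
  fixes w :: "real^2 \<Rightarrow> real"
  assumes "continuous_on UNIV w" "\<And>z. norm z > r \<Longrightarrow> w z = 0"
  shows "\<exists>B>0. \<forall>z. \<bar>w z\<bar> \<le> B"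
proof -
  have "bounded (w ` cball 0 r)"
    by (intro compact_imp_bounded compact_continuous_image continuous_on_subset[OF assms(1)]) auto
  then obtain B where B: "B > 0" "\<And>z. norm z \<le> r \<Longrightarrow> \<bar>w z\<bar> \<le> B"
    unfolding bounded_pos by auto
  have "\<bar>w z\<bar> \<le> B" for z using B assms(2)[of z] by (cases "norm z \<le> r") auto
  with B show ?thesis by blast
qed

lemma partial_deriv_outside:
  assumes "\<And>z. norm z > r \<Longrightarrow> \<phi> z = 0" "norm z > r"
  shows "partial_deriv k \<phi> z = 0"
proof -
  have "((\<lambda>t. norm (z + t *\<^sub>R axis k 1)) \<longlongrightarrow> norm (z + 0 *\<^sub>R axis k 1)) (nhds (0::real))"
    by (intro tendsto_intros filterlim_ident)
  then have "\<forall>\<^sub>F t in nhds (0::real). r < norm (z + t *\<^sub>R axis k 1)"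
    by (rule order_tendstoD) (use assms in simp)
  then have "\<forall>\<^sub>F t in nhds 0. \<phi> (z + t *\<^sub>R axis k 1) = 0"
    by eventually_elim (use assms in simp)
  then have "deriv (\<lambda>t. \<phi> (z + t *\<^sub>R axis k 1)) 0 = deriv (\<lambda>_. 0) 0"
    by (intro deriv_cong_ev) auto
  then show ?thesis by (simp add: partial_deriv_def)
qed

text \<open>By translation invariance all difference quotients of \<open>w\<close> have integral 0. They converge to the
  partial derivative and, as \<open>w\<close> vanishes outside the unit ball, steps of length at most 1 keep
  them below a multiple of the indicator of the ball of radius 2.\<close>

lemma integral_partial_zero:
  assumes d: "w differentiable_on UNIV" and c: "continuous_on UNIV (partial_deriv k w)"
    and s: "\<And>z. norm z > 1 \<Longrightarrow> w z = 0"
  shows "(\<integral>z. partial_deriv k w z \<partial>lborel) = 0"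
proof -
  have da: "w differentiable (at y)" for y using d by (auto simp: differentiable_on_def)
  have cw: "continuous_on UNIV w" using d by (rule differentiable_imp_continuous_on)
  note [measurable] = borel_measurable_continuous_onI[OF cw] borel_measurable_continuous_onI[OF c]
  obtain B where B: "B > 0" "\<And>z. \<bar>partial_deriv k w z\<bar> \<le> B"
    using bounded_compact_support[OF c, of 1] partial_deriv_outside[of 1 w _ k] s by metis
  define t where "t n = inverse (real (Suc n))" for n
  have t: "0 < t n" "t n \<le> 1" for n by (auto simp: t_def inverse_le_1_iff)
  define q where "q n z = (w (z + t n *\<^sub>R axis k 1) - w z) / t n" for n z
  have int: "integrable lborel w" by (rule integrable_compact_support[OF cw s])
  have sh: "integrable lborel (\<lambda>z. w (z + a))" for a
  proof (rule integrable_compact_support)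
    show "continuous_on UNIV (\<lambda>z. w (z + a))"
      by (intro continuous_on_compose2[OF cw] continuous_intros) auto
    show "w (z + a) = 0" if "norm z > 1 + norm a" for z
      using norm_diff_ineq[of z a] that by (intro s) linarith
  qed
  have q0: "(\<integral>z. q n z \<partial>lborel) = 0" for n
  proof -
    have "(\<integral>z. w (z + t n *\<^sub>R axis k 1) \<partial>lborel) = (\<integral>z. w z \<partial>lborel)"
      using integral_affine_plane[of w 1 "t n *\<^sub>R axis k 1"] by (simp add: add.commute)
    then show ?thesis unfolding q_def using int sh by simp
  qed
  have "(\<lambda>n. \<integral>z. q n z \<partial>lborel) \<longlonglongrightarrow> (\<integral>z. partial_deriv k w z \<partial>lborel)"
  proof (rule integral_dominated_convergence[where w = "\<lambda>z. B * indicator (cball 0 2) z"])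
    show "AE z in lborel. (\<lambda>n. q n z) \<longlonglongrightarrow> partial_deriv k w z"
    proof (intro AE_I2)
      fix z
      have "((\<lambda>s. w (z + s *\<^sub>R axis k 1)) has_real_derivative partial_deriv k w (z + 0 *\<^sub>R axis k 1)) (at 0)"
        by (intro has_real_derivative_partial da)
      then have l: "((\<lambda>s. (w (z + s *\<^sub>R axis k 1) - w z) / s) \<longlongrightarrow> partial_deriv k w z) (at 0)"
        by (simp add: has_field_derivative_iff)
      have "filterlim t (at 0) sequentially"
        unfolding filterlim_at t_def using LIMSEQ_inverse_real_of_nat by auto
      from filterlim_compose[OF l this] show "(\<lambda>n. q n z) \<longlonglongrightarrow> partial_deriv k w z"
        by (simp add: q_def)
    qed
    show "AE z in lborel. norm (q n z) \<le> B * indicator (cball 0 2) z" for n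
    proof (intro AE_I2)
      fix z
      show "norm (q n z) \<le> B * indicator (cball 0 2) z"
      proof (cases "norm z \<le> 2")
        case True
        have "((\<lambda>s. w (z + s *\<^sub>R axis k 1)) has_real_derivative partial_deriv k w (z + s *\<^sub>R axis k 1)) (at s)" for s
          by (intro has_real_derivative_partial da)
        then obtain s where "w (z + t n *\<^sub>R axis k 1) - w (z + 0 *\<^sub>R axis k 1)
            = (t n - 0) * partial_deriv k w (z + s *\<^sub>R axis k 1)"
          using MVT2[OF t(1)[of n], of "\<lambda>s. w (z + s *\<^sub>R axis k 1)" "\<lambda>s. partial_deriv k w (z + s *\<^sub>R axis k 1)"]
          by blast
        then have "q n z = partial_deriv k w (z + s *\<^sub>R axis k 1)"
          using t(1)[of n] by (simp add: q_def field_simps)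
        then show ?thesis using B True by simp
      next
        case False
        have "norm (t n *\<^sub>R axis k (1::real)) \<le> 1" using t[of n] by simp
        then have "norm (z + t n *\<^sub>R axis k 1) > 1"
          using norm_diff_ineq[of z "t n *\<^sub>R axis k 1"] False by linarith
        then show ?thesis using False s by (simp add: q_def)
      qed
    qed
    show "integrable lborel (\<lambda>z::real^2. B * indicator (cball 0 2) z)"
      by (auto intro!: integrable_real_indicator emeasure_bounded_finite simp: less_top[symmetric])
  qed (auto simp: q_def)
  then have "(\<lambda>n. 0) \<longlonglongrightarrow> (\<integral>z. partial_deriv k w z \<partial>lborel)" by (simp add: q0)
  then show ?thesis by (simp add: LIMSEQ_const_iff)
qed

lemma partial_deriv_eqI:
  assumes "((\<lambda>t. \<phi> (x + t *\<^sub>R axis k 1)) has_real_derivative D) (at 0)"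
  shows "partial_deriv k \<phi> x = D"
  using assms by (simp add: partial_deriv_def DERIV_imp_deriv)

lemma partial_deriv_affine:
  assumes "u differentiable_on UNIV"
  shows "((\<lambda>t. u (a + c *\<^sub>R (x + t *\<^sub>R axis k 1))) has_real_derivative c * partial_deriv k u (a + c *\<^sub>R x)) (at 0)"
proof -
  have "((\<lambda>t. u ((a + c *\<^sub>R x) + t *\<^sub>R axis k 1)) has_real_derivative
      partial_deriv k u ((a + c *\<^sub>R x) + (c * 0) *\<^sub>R axis k 1)) (at (c * 0))"
    using assms by (intro has_real_derivative_partial) (auto simp: differentiable_on_def)
  from DERIV_chain2[where f = "\<lambda>r. u ((a + c *\<^sub>R x) + r *\<^sub>R axis k 1)" and g = "\<lambda>t. c * t", OF this, of c UNIV]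
  have "((\<lambda>t. u ((a + c *\<^sub>R x) + (c * t) *\<^sub>R axis k 1)) has_real_derivative
      partial_deriv k u ((a + c *\<^sub>R x) + (c * 0) *\<^sub>R axis k 1) * c) (at 0)"
    by (auto intro!: derivative_eq_intros)
  then show ?thesis by (simp add: scaleR_add_right add.assoc mult.commute)
qed

text \<open>The product \<open>\<psi> z * u (x - h *\<^sub>R z)\<close> has compact support whatever \<open>u\<close> does at infinity, so its
  partial derivative integrates to 0.\<close>

lemma integral_by_parts:
  assumes \<psi>: "\<psi> differentiable_on UNIV" "continuous_on UNIV (partial_deriv k \<psi>)"
    and s: "\<And>z. norm z > 1 \<Longrightarrow> \<psi> z = 0"
    and u: "u differentiable_on UNIV" "continuous_on UNIV (partial_deriv k u)"
  shows "(\<integral>z. partial_deriv k \<psi> z * u (x - h *\<^sub>R z) \<partial>lborel)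
     = h * (\<integral>z. \<psi> z * partial_deriv k u (x - h *\<^sub>R z) \<partial>lborel)"
proof -
  define w where "w z = \<psi> z * u (x - h *\<^sub>R z)" for z
  have cont\<psi>: "continuous_on UNIV \<psi>" and contu: "continuous_on UNIV u"
    using \<psi> u by (auto intro: differentiable_imp_continuous_on)
  have cu: "continuous_on UNIV (\<lambda>z. v (x - h *\<^sub>R z))" if "continuous_on UNIV v" for v :: "real^2 \<Rightarrow> real"
    by (intro continuous_on_compose2[OF that] continuous_intros) auto
  have pd: "partial_deriv k w z = partial_deriv k \<psi> z * u (x - h *\<^sub>R z)
      - h * (\<psi> z * partial_deriv k u (x - h *\<^sub>R z))" for z
  proof (rule partial_deriv_eqI)
    have d1: "((\<lambda>t. u (x - h *\<^sub>R (z + t *\<^sub>R axis k 1))) has_real_derivative - h * partial_deriv k u (x - h *\<^sub>R z)) (at 0)"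
      using partial_deriv_affine[OF u(1), of x "- h" z k] by simp
    have d2: "((\<lambda>t. \<psi> (z + t *\<^sub>R axis k 1)) has_real_derivative partial_deriv k \<psi> z) (at 0)"
      using partial_deriv_affine[OF \<psi>(1), of 0 1 z k] by simp
    show "((\<lambda>t. w (z + t *\<^sub>R axis k 1)) has_real_derivative partial_deriv k \<psi> z * u (x - h *\<^sub>R z)
      - h * (\<psi> z * partial_deriv k u (x - h *\<^sub>R z))) (at 0)"
      using DERIV_mult[OF d2 d1] by (simp add: w_def algebra_simps)
  qed
  have "(\<lambda>z. u (x - h *\<^sub>R z)) differentiable_on UNIV"
    using u(1) by (intro differentiable_on_compose[of "\<lambda>z. x - h *\<^sub>R z" _ u, unfolded comp_def])
      (auto intro!: derivative_intros differentiable_on_subset[OF u(1)])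
  then have "w differentiable_on UNIV" unfolding w_def using \<psi>(1) by (intro differentiable_on_mult)
  moreover have "continuous_on UNIV (partial_deriv k w)"
    unfolding pd by (intro continuous_intros \<psi> cont\<psi> cu contu u)
  ultimately have "(\<integral>z. partial_deriv k w z \<partial>lborel) = 0"
    by (rule integral_partial_zero) (simp add: w_def s)
  moreover have "integrable lborel (\<lambda>z. partial_deriv k \<psi> z * u (x - h *\<^sub>R z))"
    by (rule integrable_compact_support[of _ 1])
      (auto intro!: continuous_intros \<psi> cu contu simp: partial_deriv_outside[OF s])
  moreover have "integrable lborel (\<lambda>z. \<psi> z * partial_deriv k u (x - h *\<^sub>R z))"
    by (rule integrable_compact_support[of _ 1]) (auto intro!: continuous_intros cont\<psi> cu u simp: s)
  ultimately show ?thesis unfolding pd by simp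
qed

lemma partial_deriv_kernel_sum:
  assumes "\<phi> differentiable_on UNIV"
  shows "partial_deriv k (\<lambda>x. c * (\<Sum>i\<in>I. \<phi> (s *\<^sub>R (x - a i))))
    = (\<lambda>x. (c * s) * (\<Sum>i\<in>I. partial_deriv k \<phi> (s *\<^sub>R (x - a i))))"
proof
  fix x
  have "((\<lambda>t. \<phi> (s *\<^sub>R (x + t *\<^sub>R axis k 1 - a i))) has_real_derivative
      s * partial_deriv k \<phi> (s *\<^sub>R (x - a i))) (at 0)" for i
    using partial_deriv_affine[OF assms, of "- s *\<^sub>R a i" s x k] by (simp add: algebra_simps)
  then have "((\<lambda>t. c * (\<Sum>i\<in>I. \<phi> (s *\<^sub>R (x + t *\<^sub>R axis k 1 - a i)))) has_real_derivative
      c * (\<Sum>i\<in>I. s * partial_deriv k \<phi> (s *\<^sub>R (x - a i)))) (at 0)"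
    by (intro DERIV_cmult DERIV_sum)
  from partial_deriv_eqI[OF this]
  show "partial_deriv k (\<lambda>x. c * (\<Sum>i\<in>I. \<phi> (s *\<^sub>R (x - a i)))) x
    = (c * s) * (\<Sum>i\<in>I. partial_deriv k \<phi> (s *\<^sub>R (x - a i)))"
    by (simp add: sum_distrib_left mult.assoc)
qed

lemma d2_kde:
  assumes "K differentiable_on UNIV" "\<And>k. partial_deriv k K differentiable_on UNIV"
  shows "d2 (kde K h X n \<omega>) x
    = (\<Sum>i=1..n. (1 / h n ^ 4) *\<^sub>R d2 K ((1 / h n) *\<^sub>R (x - X i \<omega>))) /\<^sub>R real n"
unfolding vec_eq_iff
proof
  fix j
  show "d2 (kde K h X n \<omega>) x $ j
    = ((\<Sum>i=1..n. (1 / h n ^ 4) *\<^sub>R d2 K ((1 / h n) *\<^sub>R (x - X i \<omega>))) /\<^sub>R real n) $ j"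
    unfolding d2_nth kde_def[abs_def] partial_deriv_kernel_sum[OF assms(1)] partial_deriv_kernel_sum[OF assms(2)]
    by (simp add: d2_nth sum_distrib_left sum_distrib_right power4_eq_xxxx power2_eq_square field_simps)
qed

section \<open>Comparison of integral curves\<close>

text \<open>The majorant \<open>U t = a + L * integral {0..t} u\<close> has derivative \<open>L * u t \<le> L * U t\<close>, so
  \<open>U t * exp (- L * t)\<close> is nonincreasing.\<close>

lemma gronwall:
  fixes u :: "real \<Rightarrow> real"
  assumes "L \<ge> 0" and u: "continuous_on {0..T} u"
    and le: "\<And>t. t \<in> {0..T} \<Longrightarrow> u t \<le> a + L * integral {0..t} u" and t: "t \<in> {0..T}"
  shows "u t \<le> a * exp (L * t)"
proof -
  define U where "U s = a + L * integral {0..s} u" for s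
  define g where "g s = U s * exp (- L * s)" for s
  define g' where "g' s = L * (u s - U s) * exp (- L * s)" for s
  have ut: "continuous_on {0..t} u" using u t by (auto elim: continuous_on_subset)
  have d: "(g has_derivative (\<lambda>r. g' s * r)) (at s within {0..t})" if s: "0 \<le> s" "s \<le> t" for s
  proof -
    have "((\<lambda>s. integral {0..s} u) has_real_derivative u s) (at s within {0..t})"
      using integral_has_real_derivative[OF ut, of s] s by auto
    then have "(g has_real_derivative g' s) (at s within {0..t})"
      unfolding g_def U_def g'_def
      by (auto intro!: derivative_eq_intros simp: algebra_simps)
    then show ?thesis by (simp add: has_field_derivative_def)
  qed
  have "u s \<le> U s" if "s \<in> {0..t}" for s using le[of s] that t by (auto simp: U_def)
  then have neg: "g' s \<le> 0" if "s \<in> {0..t}" for s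
    using that \<open>L \<ge> 0\<close> by (auto simp: g'_def mult_nonneg_nonpos mult_nonpos_nonneg)
  have "g t \<le> g 0"
  proof (cases "t = 0")
    case False
    then have "0 < t" using t by auto
    then obtain s where s: "s \<in> {0<..<t}" "g t - g 0 = g' s * (t - 0)"
      using mvt_simple[of 0 t g "\<lambda>s r. g' s * r"] d by auto
    then have "g' s * (t - 0) \<le> 0" using neg[of s] by (auto simp: mult_nonpos_nonneg)
    then show ?thesis using s by simp
  qed simp
  then have "U t * exp (- L * t) * exp (L * t) \<le> a * exp (L * t)"
    by (intro mult_right_mono) (auto simp: g_def U_def)
  also have "U t * exp (- L * t) * exp (L * t) = U t" by (simp add: mult.assoc flip: exp_add)
  finally show ?thesis using le[OF t] by (simp add: U_def)
qed

text \<open>Splitting \<open>W (y s) - V (x s)\<close> into \<open>W (y s) - W (x s)\<close> and \<open>W (x s) - V (x s)\<close> leaves the drift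
  along \<open>x\<close> as the only inhomogeneous term of Gronwall's inequality. The additive \<open>\<eta>\<close> accommodates
  fields whose Lipschitz bound is known only down to the mesh of a net.\<close>

lemma ode_comparison_near:
  fixes x y :: "real \<Rightarrow> 'b::euclidean_space"
  assumes "L \<ge> 0" "\<eta> \<ge> 0"
    and x: "\<And>t. t \<in> {0..T} \<Longrightarrow> (x has_vector_derivative V (x t)) (at t)"
    and y: "\<And>t. t \<in> {0..T} \<Longrightarrow> (y has_vector_derivative W (y t)) (at t)"
    and cont: "continuous_on {0..T} (\<lambda>t. W (x t))" "continuous_on {0..T} (\<lambda>t. V (x t))"
      "continuous_on {0..T} (\<lambda>t. W (y t))"
    and lip: "\<And>t. t \<in> {0..T} \<Longrightarrow> norm (W (y t) - W (x t)) \<le> L * norm (y t - x t) + \<eta>"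
    and drift: "\<And>t. t \<in> {0..T} \<Longrightarrow> norm (integral {0..t} (\<lambda>s. W (x s) - V (x s))) \<le> w"
    and t: "t \<in> {0..T}"
  shows "norm (y t - x t) \<le> (norm (y 0 - x 0) + w + \<eta> * T) * exp (L * T)"
proof -
  let ?e = "\<lambda>t. norm (y t - x t)" and ?a = "norm (y 0 - x 0) + w + \<eta> * T"
  have cx: "continuous_on {0..T} x" and cy: "continuous_on {0..T} y"
    using has_vector_derivative_continuous[OF x] has_vector_derivative_continuous[OF y]
    by (auto intro!: continuous_at_imp_continuous_on)
  have ce: "continuous_on {0..T} ?e" by (intro continuous_intros cx cy)
  have main: "?e t \<le> ?a + L * integral {0..t} ?e" if t: "t \<in> {0..T}" for t
  proof -
    have sub: "{0..t} \<subseteq> {0..T}" using t by auto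
    note c = cont[THEN continuous_on_subset, OF sub] ce[THEN continuous_on_subset, OF sub]
    have iy: "((\<lambda>s. W (y s)) has_integral y t - y 0) {0..t}"
      using t by (intro fundamental_theorem_of_calculus has_vector_derivative_at_within[OF y]) auto
    have ix: "((\<lambda>s. V (x s)) has_integral x t - x 0) {0..t}"
      using t by (intro fundamental_theorem_of_calculus has_vector_derivative_at_within[OF x]) auto
    have "y t - x t = (y 0 - x 0) + integral {0..t} (\<lambda>s. W (y s) - V (x s))"
      using has_integral_diff[OF iy ix] by (simp add: integral_unique)
    also have "integral {0..t} (\<lambda>s. W (y s) - V (x s))
        = integral {0..t} (\<lambda>s. (W (y s) - W (x s)) + (W (x s) - V (x s)))" by simp
    also have "\<dots> = integral {0..t} (\<lambda>s. W (y s) - W (x s)) + integral {0..t} (\<lambda>s. W (x s) - V (x s))"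
      by (intro Henstock_Kurzweil_Integration.integral_add integrable_continuous_interval
          continuous_intros c)
    finally have "?e t \<le> norm (y 0 - x 0) + (norm (integral {0..t} (\<lambda>s. W (y s) - W (x s)))
        + norm (integral {0..t} (\<lambda>s. W (x s) - V (x s))))"
      by (simp only:) (intro norm_triangle_le add_left_mono norm_triangle_ineq order_refl)
    moreover have "norm (integral {0..t} (\<lambda>s. W (y s) - W (x s)))
        \<le> integral {0..t} (\<lambda>s. L * ?e s + \<eta>)"
      using sub lip
      by (intro integral_norm_bound_integral integrable_continuous_interval continuous_intros c) auto
    moreover have "integral {0..t} (\<lambda>s. L * ?e s + \<eta>) = L * integral {0..t} ?e + \<eta> * t"
      using t by (subst Henstock_Kurzweil_Integration.integral_add)
        (auto intro!: integrable_continuous_interval continuous_intros c(4))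
    moreover have "\<eta> * t \<le> \<eta> * T" using t \<open>\<eta> \<ge> 0\<close> by (auto intro: mult_left_mono)
    ultimately show ?thesis using drift[OF t] by linarith
  qed
  have "norm (integral {0..0} (\<lambda>s. W (x s) - V (x s))) \<le> w" using t by (intro drift) auto
  then have "0 \<le> w" by simp
  then have "0 \<le> ?a" using t \<open>\<eta> \<ge> 0\<close> by auto
  have "?e t \<le> ?a * exp (L * t)" by (rule gronwall[OF \<open>L \<ge> 0\<close> ce main t])
  also have "\<dots> \<le> ?a * exp (L * T)"
    using t \<open>0 \<le> ?a\<close> \<open>L \<ge> 0\<close> by (intro mult_left_mono) (auto intro: mult_left_mono)
  finally show ?thesis .
qed

text \<open>Here the Lipschitz bound is available only while the curves are within distance 1. If the
  conclusion failed, the distance would reach a level \<open>c \<le> 1\<close> above the claimed bound; up to the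
  first time at which this happens \<open>ode_comparison_near\<close> applies, and it keeps the distance
  below \<open>c\<close>.\<close>

lemma ode_comparison:
  fixes x y :: "real \<Rightarrow> 'b::euclidean_space"
  assumes "L \<ge> 0" "\<eta> \<ge> 0"
    and x: "\<And>t. t \<in> {0..T} \<Longrightarrow> (x has_vector_derivative V (x t)) (at t)"
    and y: "\<And>t. t \<in> {0..T} \<Longrightarrow> (y has_vector_derivative W (y t)) (at t)"
    and cont: "continuous_on {0..T} (\<lambda>t. W (x t))" "continuous_on {0..T} (\<lambda>t. V (x t))"
      "continuous_on {0..T} (\<lambda>t. W (y t))"
    and lip: "\<And>t. t \<in> {0..T} \<Longrightarrow> norm (y t - x t) \<le> 1 \<Longrightarrow>
       norm (W (y t) - W (x t)) \<le> L * norm (y t - x t) + \<eta>"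
    and drift: "\<And>t. t \<in> {0..T} \<Longrightarrow> norm (integral {0..t} (\<lambda>s. W (x s) - V (x s))) \<le> w"
    and small: "(norm (y 0 - x 0) + w + \<eta> * T) * exp (L * T) < 1"
    and t: "t \<in> {0..T}"
  shows "norm (y t - x t) \<le> (norm (y 0 - x 0) + w + \<eta> * T) * exp (L * T)"
proof (rule ccontr)
  let ?e = "\<lambda>t. norm (y t - x t)" and ?b = "(norm (y 0 - x 0) + w + \<eta> * T) * exp (L * T)"
  assume "\<not> ?e t \<le> ?b"
  then have c: "?b < min (?e t) 1" "min (?e t) 1 \<le> ?e t" "min (?e t) 1 \<le> 1" using small by auto
  \<comment> \<open>A level above the claimed bound that is reached no later than \<open>t\<close>.\<close>
  define c where "c = min (?e t) 1"
  note c = c[folded c_def]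
  have cx: "continuous_on {0..T} x" and cy: "continuous_on {0..T} y"
    using has_vector_derivative_continuous[OF x] has_vector_derivative_continuous[OF y]
    by (auto intro!: continuous_at_imp_continuous_on)
  have ce: "continuous_on {0..T} ?e" by (intro continuous_intros cx cy)
  have w: "0 \<le> w" using drift[of 0] t by simp
  have b: "norm (y 0 - x 0) \<le> ?b"
  proof -
    have "norm (y 0 - x 0) * 1 \<le> ?b"
      using w t assms(1,2) by (intro mult_mono) auto
    then show ?thesis by simp
  qed
  define S where "S = {s \<in> {0..T}. c \<le> ?e s}"
  have "closed S"
    unfolding S_def by (intro continuous_on_closed_Collect_le continuous_on_const ce closed_atLeastAtMost)
  moreover have ne: "S \<noteq> {}" using t c by (auto simp: S_def)
  moreover have bd: "bdd_below S" by (auto simp: S_def)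
  ultimately have "Inf S \<in> S" by (intro closed_contains_Inf)
  define \<tau> where "\<tau> = Inf S"
  have \<tau>: "\<tau> \<in> {0..T}" "c \<le> ?e \<tau>" using \<open>Inf S \<in> S\<close> by (auto simp: S_def \<tau>_def)
  have lt: "?e s < c" if "0 \<le> s" "s < \<tau>" for s
  proof (rule ccontr)
    assume "\<not> ?e s < c"
    then have "s \<in> S" using that \<tau> by (auto simp: S_def)
    then show False using cInf_lower[OF _ bd] that by (force simp: \<tau>_def)
  qed
  have "?e \<tau> = c"
  proof (cases "\<tau> = 0")
    case True then show ?thesis using \<tau> b c by auto
  next
    case False
    show ?thesis
    proof (rule antisym)
      have "\<exists>s. 0 \<le> s \<and> s \<le> \<tau> \<and> ?e s = c"
        using \<tau> b c by (intro IVT' continuous_on_subset[OF ce]) auto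
      then obtain s where "0 \<le> s" "s \<le> \<tau>" "?e s = c" by blast
      then show "?e \<tau> \<le> c" using lt[of s] by (cases "s = \<tau>") auto
    qed (rule \<tau>)
  qed
  have le1: "?e s \<le> 1" if "s \<in> {0..\<tau>}" for s
    using lt[of s] c \<open>?e \<tau> = c\<close> that by (cases "s = \<tau>") auto
  have sub: "{0..\<tau>} \<subseteq> {0..T}" using \<tau> by auto
  have "?e \<tau> \<le> (norm (y 0 - x 0) + w + \<eta> * \<tau>) * exp (L * \<tau>)"
    by (rule ode_comparison_near[OF assms(1,2), where V = V and W = W])
      (use sub \<tau> x y le1 in \<open>auto intro!: lip drift cont[THEN continuous_on_subset]\<close>)
  also have "\<dots> \<le> ?b"
    using \<tau> w assms(1,2) by (intro mult_mono add_left_mono) (auto intro: mult_left_mono)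
  finally show False using \<open>?e \<tau> = c\<close> c by simp
qed

section \<open>Deviation of sample means and polynomial nets\<close>

lemma exp_le_quadratic:
  fixes x :: real assumes "\<bar>x\<bar> \<le> 1" shows "exp x \<le> 1 + x + x\<^sup>2"
proof (cases "0 \<le> x")
  case True then show ?thesis using assms by (intro exp_bound) auto
next
  case False
  define y where "y = - x"
  have y: "0 \<le> y" using False by (simp add: y_def)
  have "exp x * exp y = 1" by (simp add: y_def flip: exp_add)
  moreover have "exp y \<ge> 1 + y + y\<^sup>2 / 2" using y by (rule exp_lower_Taylor_quadratic)
  then have "exp x * (1 + y + y\<^sup>2 / 2) \<le> exp x * exp y" by (intro mult_left_mono) auto
  moreover have "(1 - y + y\<^sup>2) * (1 + y + y\<^sup>2 / 2) = 1 + y\<^sup>2 / 2 + y ^ 3 / 2 + y ^ 4 / 2"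
    by (simp add: power2_eq_square power3_eq_cube power4_eq_xxxx field_simps)
  moreover have "0 \<le> y\<^sup>2 / 2 + y ^ 3 / 2 + y ^ 4 / 2" using y by simp
  ultimately have "exp x * (1 + y + y\<^sup>2 / 2) \<le> (1 - y + y\<^sup>2) * (1 + y + y\<^sup>2 / 2)" by linarith
  moreover have "0 < 1 + y + y\<^sup>2 / 2" using y by (simp add: add_pos_nonneg)
  ultimately have "exp x \<le> 1 - y + y\<^sup>2" by (simp add: mult_le_cancel_right)
  then show ?thesis by (simp add: y_def)
qed

lemma (in prob_space) exponential_moment_bound:
  fixes Z :: "'a \<Rightarrow> real"
  assumes Z: "Z \<in> borel_measurable M" and b: "\<And>\<omega>. \<omega> \<in> space M \<Longrightarrow> \<bar>Z \<omega>\<bar> \<le> c"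
    and mean: "expectation Z = 0" and var: "expectation (\<lambda>\<omega>. (Z \<omega>)\<^sup>2) \<le> v"
    and l: "0 \<le> l" "l * c \<le> 1"
  shows "expectation (\<lambda>\<omega>. exp (l * Z \<omega>)) \<le> exp (l\<^sup>2 * v)"
proof -
  have lz: "\<bar>l * Z \<omega>\<bar> \<le> 1" if "\<omega> \<in> space M" for \<omega>
  proof -
    have "\<bar>l * Z \<omega>\<bar> \<le> l * c" using mult_left_mono[OF b[OF that] l(1)] l by (simp add: abs_mult)
    then show ?thesis using l by simp
  qed
  have i1: "integrable M Z"
    using Z b by (intro integrable_const_bound[of _ c]) auto
  have i2: "integrable M (\<lambda>\<omega>. (Z \<omega>)\<^sup>2)"
  proof (intro integrable_const_bound[of _ "c\<^sup>2"] AE_I2)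
    fix \<omega> assume "\<omega> \<in> space M"
    from b[OF this] show "norm ((Z \<omega>)\<^sup>2) \<le> c\<^sup>2"
      using power_mono[of "\<bar>Z \<omega>\<bar>" c 2] by simp
  qed (use Z in measurable)
  have i3: "integrable M (\<lambda>\<omega>. exp (l * Z \<omega>))"
  proof (intro integrable_const_bound[of _ "exp 1"] AE_I2)
    fix \<omega> assume "\<omega> \<in> space M"
    from lz[OF this] show "norm (exp (l * Z \<omega>)) \<le> exp 1" by simp
  qed (use Z in measurable)
  have "expectation (\<lambda>\<omega>. exp (l * Z \<omega>)) \<le> expectation (\<lambda>\<omega>. 1 + l * Z \<omega> + l\<^sup>2 * (Z \<omega>)\<^sup>2)"
    using exp_le_quadratic[OF lz] i1 i2 i3
    by (intro integral_mono) (auto simp: power_mult_distrib)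
  also have "\<dots> = 1 + l\<^sup>2 * expectation (\<lambda>\<omega>. (Z \<omega>)\<^sup>2)"
    using i1 i2 mean by (simp add: prob_space)
  also have "\<dots> \<le> 1 + l\<^sup>2 * v" using var by (intro add_left_mono mult_left_mono) auto
  also have "\<dots> \<le> exp (l\<^sup>2 * v)" by (rule exp_ge_add_one_self)
  finally show ?thesis .
qed

text \<open>Markov's inequality for the exponential of \<open>l\<close> times the sum. The condition \<open>l * c \<le> 1\<close> keeps the
  exponents in the range where the exponential is at most \<open>1 + x + x\<^sup>2\<close>, so that the variance
  rather than the squared range enters the bound.\<close>

lemma (in prob_space) bernstein_upper:
  assumes fin: "finite I" and ind: "indep_vars (\<lambda>_. borel) Z I"
    and b: "\<And>i \<omega>. i \<in> I \<Longrightarrow> \<omega> \<in> space M \<Longrightarrow> \<bar>Z i \<omega>\<bar> \<le> c"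
    and mean: "\<And>i. i \<in> I \<Longrightarrow> expectation (Z i) = 0"
    and var: "\<And>i. i \<in> I \<Longrightarrow> expectation (\<lambda>\<omega>. (Z i \<omega>)\<^sup>2) \<le> v"
    and l: "0 \<le> l" "l * c \<le> 1"
  shows "prob {\<omega> \<in> space M. a \<le> (\<Sum>i\<in>I. Z i \<omega>)} \<le> exp (real (card I) * (l\<^sup>2 * v) - l * a)"
proof -
  have Z[measurable]: "Z i \<in> borel_measurable M" if "i \<in> I" for i
    using ind that by (auto simp: indep_vars_def)
  define E where "E \<omega> = (\<Prod>i\<in>I. exp (l * Z i \<omega>))" for \<omega>
  have E: "E \<omega> = exp (l * (\<Sum>i\<in>I. Z i \<omega>))" for \<omega>
    by (simp add: E_def exp_sum fin sum_distrib_left)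
  have ib: "integrable M (\<lambda>\<omega>. exp (l * Z i \<omega>))" if i: "i \<in> I" for i
  proof (intro integrable_const_bound[of _ "exp 1"] AE_I2)
    fix \<omega> assume w: "\<omega> \<in> space M"
    have "\<bar>l * Z i \<omega>\<bar> \<le> l * c" using mult_left_mono[OF b[OF i w] l(1)] l by (simp add: abs_mult)
    then show "norm (exp (l * Z i \<omega>)) \<le> exp 1" using l by simp
  qed (use Z[OF i] in measurable)
  have ind': "indep_vars (\<lambda>_. borel) (\<lambda>i \<omega>. exp (l * Z i \<omega>)) I"
    by (rule indep_vars_compose2[OF ind]) auto
  have iE: "integrable M E"
    unfolding E_def by (rule indep_vars_integrable[OF fin ind' ib])
  have "expectation E = (\<Prod>i\<in>I. expectation (\<lambda>\<omega>. exp (l * Z i \<omega>)))"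
    unfolding E_def by (rule indep_vars_lebesgue_integral[OF fin ind' ib])
  also have "\<dots> \<le> (\<Prod>i\<in>I. exp (l\<^sup>2 * v))"
    using b mean var l Z by (intro prod_mono conjI exponential_moment_bound) auto
  also have "\<dots> = exp (real (card I) * (l\<^sup>2 * v))" by (simp add: exp_of_nat_mult)
  finally have le: "expectation E \<le> exp (real (card I) * (l\<^sup>2 * v))" .
  have "prob {\<omega> \<in> space M. a \<le> (\<Sum>i\<in>I. Z i \<omega>)} \<le> prob {\<omega> \<in> space M. exp (l * a) \<le> E \<omega>}"
    using l borel_measurable_integrable[OF iE]
    by (intro finite_measure_mono) (auto simp: E[abs_def] intro: mult_left_mono)
  also have "\<dots> \<le> expectation E / exp (l * a)"
  proof (rule integral_Markov_inequality_measure[where A = "{}"])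
    show "AE \<omega> in M. 0 \<le> E \<omega>" by (simp add: E)
  qed (use iE in auto)
  also have "\<dots> \<le> exp (real (card I) * (l\<^sup>2 * v)) / exp (l * a)"
    using le by (intro divide_right_mono) auto
  finally show ?thesis by (simp add: exp_diff)
qed

locale iid_sample = prob_space M for M :: "'a measure" +
  fixes X :: "nat \<Rightarrow> 'a \<Rightarrow> real^2" and f :: "real^2 \<Rightarrow> real"
  assumes density: "prob_density f"
    and indep: "indep_vars (\<lambda>_. borel) X {1..}"
    and distr: "\<And>i. i \<ge> 1 \<Longrightarrow> distributed M lborel (X i) (\<lambda>x. ennreal (f x))"
begin

lemma f_measurable [measurable]: "f \<in> borel_measurable borel"
  and f_nonneg: "0 \<le> f x"
  and f_integrable: "integrable lborel f"
  and f_integral: "(\<integral>x. f x \<partial>lborel) = 1"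
  using density by (auto simp: prob_density_def intro!: integrableI_nonneg integral_eq_nn_integral[THEN trans])

lemma X_measurable: "i \<ge> 1 \<Longrightarrow> X i \<in> borel_measurable M"
  using distributed_measurable[OF distr[of i]] by simp

lemma expectation_sample:
  assumes "\<phi> \<in> borel_measurable borel" "i \<ge> 1"
  shows "expectation (\<lambda>\<omega>. \<phi> (X i \<omega>)) = (\<integral>y. f y * \<phi> y \<partial>lborel)"
  using assms f_nonneg by (intro distributed_integral[OF distr, symmetric]) auto

lemma integrable_density_mult:
  assumes "\<phi> \<in> borel_measurable borel" "\<And>y. \<bar>\<phi> y :: real\<bar> \<le> b"
  shows "integrable lborel (\<lambda>y. f y * \<phi> y)"
proof (rule Bochner_Integration.integrable_bound)
  show "integrable lborel (\<lambda>y. b * f y)" using f_integrable by simp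
  show "AE y in lborel. norm (f y * \<phi> y) \<le> norm (b * f y)"
  proof (intro AE_I2)
    fix y
    have "f y * \<bar>\<phi> y\<bar> \<le> f y * b" "0 \<le> b"
      using mult_left_mono[OF assms(2) f_nonneg, of y y] order_trans[OF abs_ge_zero assms(2)] by auto
    then show "norm (f y * \<phi> y) \<le> norm (b * f y)"
      using f_nonneg[of y] by (simp add: abs_mult mult.commute)
  qed
qed (use assms in measurable)

lemma integral_density_mult_le:
  assumes "\<phi> \<in> borel_measurable borel" "\<And>y. \<bar>\<phi> y :: real\<bar> \<le> b"
  shows "\<bar>\<integral>y. f y * \<phi> y \<partial>lborel\<bar> \<le> b"
proof -
  have "norm (\<integral>y. f y * \<phi> y \<partial>lborel) \<le> (\<integral>y. norm (f y * \<phi> y) \<partial>lborel)"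
    by (rule integral_norm_bound)
  also have "\<dots> \<le> (\<integral>y. f y * b \<partial>lborel)"
  proof (rule integral_mono)
    show "norm (f y * \<phi> y) \<le> f y * b" for y
      using mult_left_mono[OF assms(2) f_nonneg, of y y] f_nonneg[of y] by (simp add: abs_mult)
  qed (use integrable_density_mult[OF assms] f_integrable in \<open>auto intro!: integrable_norm\<close>)
  also have "\<dots> = b" using f_integral by simp
  finally show ?thesis by simp
qed

text \<open>Under \<open>\<epsilon> * b \<le> v\<close> the Gaussian term of Bernstein's inequality is the dominant one: the multiplier
  \<open>\<epsilon> / (2 * v)\<close>, which is optimal for that term, satisfies the range condition of
  \<open>bernstein_upper\<close> for the centred variables, whose range is \<open>2 * b\<close>.\<close>

lemma sample_mean_upper:
  assumes \<phi>[measurable]: "\<phi> \<in> borel_measurable borel" and b: "\<And>y. \<bar>\<phi> y\<bar> \<le> b"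
    and v: "(\<integral>y. f y * (\<phi> y)\<^sup>2 \<partial>lborel) \<le> v" "0 < v"
    and e: "0 \<le> \<epsilon>" "\<epsilon> * b \<le> v" and n: "n \<ge> 1"
  shows "prob {\<omega> \<in> space M. \<epsilon> \<le> (\<Sum>i=1..n. \<phi> (X i \<omega>)) / real n - (\<integral>y. f y * \<phi> y \<partial>lborel)}
    \<le> exp (- (real n * \<epsilon>\<^sup>2 / (4 * v)))"
proof -
  define m where "m = (\<integral>y. f y * \<phi> y \<partial>lborel)"
  define Z where "Z i \<omega> = \<phi> (X i \<omega>) - m" for i \<omega>
  have X[measurable]: "X i \<in> borel_measurable M" if "i \<in> {1..n}" for i
    using X_measurable[of i] that by simp
  have int\<phi>: "integrable M (\<lambda>\<omega>. \<phi> (X i \<omega>))" if "i \<in> {1..n}" for i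
    using that b by (intro integrable_const_bound[of _ b]) auto
  have int\<phi>2: "integrable M (\<lambda>\<omega>. (\<phi> (X i \<omega>))\<^sup>2)" if "i \<in> {1..n}" for i
    using that power_mono[OF b abs_ge_zero, of _ 2]
    by (intro integrable_const_bound[of _ "b\<^sup>2"]) auto
  have m: "\<bar>m\<bar> \<le> b" unfolding m_def by (rule integral_density_mult_le[OF \<phi> b])
  have Em: "expectation (\<lambda>\<omega>. \<phi> (X i \<omega>)) = m" if "i \<in> {1..n}" for i
    using expectation_sample[OF \<phi>, of i] that by (simp add: m_def)
  have "indep_vars (\<lambda>_. borel) Z {1..n}"
    unfolding Z_def by (rule indep_vars_compose2[OF indep_vars_subset[OF indep]]) auto
  moreover have "\<bar>Z i \<omega>\<bar> \<le> 2 * b" for i \<omega> using b[of "X i \<omega>"] m by (auto simp: Z_def)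
  moreover have "expectation (Z i) = 0" if i: "i \<in> {1..n}" for i
    using int\<phi>[OF i] Em[OF i] by (simp add: Z_def[abs_def] prob_space)
  moreover have "expectation (\<lambda>\<omega>. (Z i \<omega>)\<^sup>2) \<le> v" if i: "i \<in> {1..n}" for i
  proof -
    have "expectation (\<lambda>\<omega>. (Z i \<omega>)\<^sup>2) = expectation (\<lambda>\<omega>. (\<phi> (X i \<omega>))\<^sup>2) - m\<^sup>2"
      using variance_eq[OF int\<phi>[OF i] int\<phi>2[OF i]] Em[OF i] by (simp add: Z_def)
    also have "\<dots> \<le> expectation (\<lambda>\<omega>. (\<phi> (X i \<omega>))\<^sup>2)" by simp
    also have "\<dots> \<le> v" using expectation_sample[of "\<lambda>y. (\<phi> y)\<^sup>2" i] i v by simp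
    finally show ?thesis .
  qed
  ultimately have "prob {\<omega> \<in> space M. n * \<epsilon> \<le> (\<Sum>i\<in>{1..n}. Z i \<omega>)}
     \<le> exp (real (card {1..n}) * ((\<epsilon> / (2 * v))\<^sup>2 * v) - (\<epsilon> / (2 * v)) * (n * \<epsilon>))"
    using e v(2) by (intro bernstein_upper[where c = "2 * b"]) (auto simp: field_simps)
  also have "real (card {1..n}) * ((\<epsilon> / (2 * v))\<^sup>2 * v) - (\<epsilon> / (2 * v)) * (n * \<epsilon>)
      = - (real n * \<epsilon>\<^sup>2 / (4 * v))"
    using v(2) by (simp add: power2_eq_square field_simps)
  also have "{\<omega> \<in> space M. n * \<epsilon> \<le> (\<Sum>i\<in>{1..n}. Z i \<omega>)}
      = {\<omega> \<in> space M. \<epsilon> \<le> (\<Sum>i=1..n. \<phi> (X i \<omega>)) / real n - m}"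
    using n by (auto simp: Z_def sum_subtractf field_simps)
  finally show ?thesis by (simp add: m_def)
qed

lemma sample_mean_deviation:
  assumes \<phi>[measurable]: "\<phi> \<in> borel_measurable borel" and b: "\<And>y. \<bar>\<phi> y\<bar> \<le> b"
    and v: "(\<integral>y. f y * (\<phi> y)\<^sup>2 \<partial>lborel) \<le> v" "0 < v"
    and e: "0 \<le> \<epsilon>" "\<epsilon> * b \<le> v" and n: "n \<ge> 1"
  shows "prob {\<omega> \<in> space M. \<epsilon> \<le> \<bar>(\<Sum>i=1..n. \<phi> (X i \<omega>)) / real n - (\<integral>y. f y * \<phi> y \<partial>lborel)\<bar>}
    \<le> 2 * exp (- (real n * \<epsilon>\<^sup>2 / (4 * v)))" (is "prob ?A \<le> _")
    and "{\<omega> \<in> space M. \<epsilon> \<le> \<bar>(\<Sum>i=1..n. \<phi> (X i \<omega>)) / real n - (\<integral>y. f y * \<phi> y \<partial>lborel)\<bar>} \<in> events"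
proof -
  have X[measurable]: "X i \<in> borel_measurable M" if "i \<in> {1..n}" for i
    using X_measurable[of i] that by simp
  let ?P = "{\<omega> \<in> space M. \<epsilon> \<le> (\<Sum>i=1..n. \<phi> (X i \<omega>)) / real n - (\<integral>y. f y * \<phi> y \<partial>lborel)}"
  let ?N = "{\<omega> \<in> space M. \<epsilon> \<le> (\<Sum>i=1..n. - \<phi> (X i \<omega>)) / real n - (\<integral>y. f y * - \<phi> y \<partial>lborel)}"
  have m: "?P \<in> events" "?N \<in> events" by measurable
  have eq: "?A = ?P \<union> ?N" by (auto simp: sum_negf)
  show "?A \<in> events" unfolding eq using m by auto
  have "prob ?A \<le> prob ?P + prob ?N" unfolding eq by (rule measure_Un_le[OF m])
  also have "prob ?P \<le> exp (- (real n * \<epsilon>\<^sup>2 / (4 * v)))"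
    by (rule sample_mean_upper[OF assms])
  also have "prob ?N \<le> exp (- (real n * \<epsilon>\<^sup>2 / (4 * v)))"
    using assms by (intro sample_mean_upper) auto
  finally show "prob ?A \<le> 2 * exp (- (real n * \<epsilon>\<^sup>2 / (4 * v)))" by simp
qed

end

text \<open>Eventually \<open>P\<close> fails only inside events of arbitrarily small probability. As in
  \<open>bigO_in_prob\<close>, the set where \<open>P\<close> fails need not be measurable itself, which matters because
  suprema over curves and times occur in \<open>P\<close>.\<close>

definition whp :: "'a measure \<Rightarrow> (nat \<Rightarrow> 'a \<Rightarrow> bool) \<Rightarrow> bool" where
  "whp M P \<longleftrightarrow> (\<forall>\<epsilon>>0. \<forall>\<^sub>F n in sequentially.
     \<exists>A\<in>sets M. measure M A < \<epsilon> \<and> (\<forall>\<omega>\<in>space M - A. P n \<omega>))"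

lemma whp_mono:
  assumes "whp M P" "\<forall>\<^sub>F n in sequentially. \<forall>\<omega>\<in>space M. P n \<omega> \<longrightarrow> Q n \<omega>"
  shows "whp M Q"
  unfolding whp_def
proof (intro allI impI)
  fix \<epsilon> :: real assume "\<epsilon> > 0"
  with assms(1) have "\<forall>\<^sub>F n in sequentially.
     \<exists>A\<in>sets M. measure M A < \<epsilon> \<and> (\<forall>\<omega>\<in>space M - A. P n \<omega>)" by (auto simp: whp_def)
  then show "\<forall>\<^sub>F n in sequentially. \<exists>A\<in>sets M. measure M A < \<epsilon> \<and> (\<forall>\<omega>\<in>space M - A. Q n \<omega>)"
    using assms(2) by eventually_elim (meson DiffD1)
qed

lemma whp_conj:
  assumes "whp M P" "whp M Q"
  shows "whp M (\<lambda>n \<omega>. P n \<omega> \<and> Q n \<omega>)"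
  unfolding whp_def
proof (intro allI impI)
  fix \<epsilon> :: real assume "\<epsilon> > 0"
  then have e: "\<epsilon> / 2 > 0" by simp
  have "\<forall>\<^sub>F n in sequentially. \<exists>A\<in>sets M. measure M A < \<epsilon> / 2 \<and> (\<forall>\<omega>\<in>space M - A. P n \<omega>)"
    "\<forall>\<^sub>F n in sequentially. \<exists>A\<in>sets M. measure M A < \<epsilon> / 2 \<and> (\<forall>\<omega>\<in>space M - A. Q n \<omega>)"
    using assms e unfolding whp_def by blast+
  then show "\<forall>\<^sub>F n in sequentially.
      \<exists>A\<in>sets M. measure M A < \<epsilon> \<and> (\<forall>\<omega>\<in>space M - A. P n \<omega> \<and> Q n \<omega>)"
  proof eventually_elim
    case (elim n)
    then obtain A B where AB: "A \<in> sets M" "B \<in> sets M" "measure M A < \<epsilon> / 2" "measure M B < \<epsilon> / 2"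
      "\<forall>\<omega>\<in>space M - A. P n \<omega>" "\<forall>\<omega>\<in>space M - B. Q n \<omega>" by blast
    have "measure M (A \<union> B) < \<epsilon>" using measure_Un_le[OF AB(1,2)] AB(3,4) by linarith
    then show ?case using AB by (intro bexI[of _ "A \<union> B"]) auto
  qed
qed

text \<open>Union bound. Each of the at most \<open>C * n ^ k\<close> deviations has probability at most
  \<open>2 / n ^ (k + 1)\<close>, so the probability that one of them occurs is at most \<open>2 * C / n\<close>.\<close>

lemma (in iid_sample) whp_sample_means:
  fixes \<phi> :: "nat \<Rightarrow> 'j \<Rightarrow> real^2 \<Rightarrow> real"
  assumes card: "\<forall>\<^sub>F n in sequentially. finite (J n) \<and> real (card (J n)) \<le> C * real n ^ k"
    and meas: "\<forall>\<^sub>F n in sequentially. \<forall>j\<in>J n. \<phi> n j \<in> borel_measurable borel"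
    and b: "\<forall>\<^sub>F n in sequentially. \<forall>j\<in>J n. \<forall>y. \<bar>\<phi> n j y\<bar> \<le> b n"
    and v: "\<forall>\<^sub>F n in sequentially. \<forall>j\<in>J n. (\<integral>y. f y * (\<phi> n j y)\<^sup>2 \<partial>lborel) \<le> v n"
    and e: "\<forall>\<^sub>F n in sequentially. 0 < v n \<and> 0 \<le> \<epsilon> n \<and> \<epsilon> n * b n \<le> v n \<and>
       real (k + 1) * ln (real n) \<le> real n * (\<epsilon> n)\<^sup>2 / (4 * v n)"
  shows "whp M (\<lambda>n \<omega>. \<forall>j\<in>J n.
    \<bar>(\<Sum>i=1..n. \<phi> n j (X i \<omega>)) / real n - (\<integral>y. f y * \<phi> n j y \<partial>lborel)\<bar> \<le> \<epsilon> n)"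
  unfolding whp_def
proof (intro allI impI)
  fix \<delta> :: real assume "\<delta> > 0"
  have "(\<lambda>n. 2 * C * inverse (real n)) \<longlonglongrightarrow> 0"
    using tendsto_mult_left[OF lim_inverse_n, of "2 * C"] by simp
  then have "\<forall>\<^sub>F n in sequentially. 2 * C * inverse (real n) < \<delta>"
    using \<open>\<delta> > 0\<close> by (rule order_tendstoD)
  then show "\<forall>\<^sub>F n in sequentially. \<exists>A\<in>events. prob A < \<delta> \<and> (\<forall>\<omega>\<in>space M - A. \<forall>j\<in>J n.
    \<bar>(\<Sum>i=1..n. \<phi> n j (X i \<omega>)) / real n - (\<integral>y. f y * \<phi> n j y \<partial>lborel)\<bar> \<le> \<epsilon> n)"
    using card meas b v e eventually_gt_at_top[of 0]
  proof eventually_elim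
    case (elim n)
    define B where "B j = {\<omega> \<in> space M. \<epsilon> n \<le>
      \<bar>(\<Sum>i=1..n. \<phi> n j (X i \<omega>)) / real n - (\<integral>y. f y * \<phi> n j y \<partial>lborel)\<bar>}" for j
    have n: "n \<ge> 1" using elim by auto
    have B: "B j \<in> events" "prob (B j) \<le> 2 * exp (- (real n * (\<epsilon> n)\<^sup>2 / (4 * v n)))" if "j \<in> J n" for j
      unfolding B_def using elim that n
      by (intro sample_mean_deviation[where b = "b n" and v = "v n"]; simp)+
    have "prob (\<Union>j\<in>J n. B j) \<le> (\<Sum>j\<in>J n. prob (B j))"
      using elim B by (intro finite_measure_subadditive_finite) auto
    also have "\<dots> \<le> (\<Sum>j\<in>J n. 2 * exp (- (real (k + 1) * ln (real n))))"
    proof (rule sum_mono)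
      fix j assume "j \<in> J n"
      have "exp (- (real n * (\<epsilon> n)\<^sup>2 / (4 * v n))) \<le> exp (- (real (k + 1) * ln (real n)))"
        using elim by simp
      then show "prob (B j) \<le> 2 * exp (- (real (k + 1) * ln (real n)))"
        using B(2)[OF \<open>j \<in> J n\<close>] by linarith
    qed
    also have "\<dots> = real (card (J n)) * (2 * inverse (real n ^ (k + 1)))"
    proof -
      have "exp (real (k + 1) * ln (real n)) = real n ^ (k + 1)"
        using n by (simp only: exp_of_nat_mult) simp
      then show ?thesis by (simp only: exp_minus sum_constant)
    qed
    also have "\<dots> \<le> (C * real n ^ k) * (2 * inverse (real n ^ (k + 1)))"
      using elim by (intro mult_right_mono) auto
    also have "\<dots> = 2 * C * inverse (real n)" using n by (simp add: field_simps)
    also have "\<dots> < \<delta>" using elim by simp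
    finally have "prob (\<Union>j\<in>J n. B j) < \<delta>" .
    moreover have "(\<Union>j\<in>J n. B j) \<in> events" using elim B(1) by (intro sets.finite_UN) auto
    moreover have "\<bar>(\<Sum>i=1..n. \<phi> n j (X i \<omega>)) / real n - (\<integral>y. f y * \<phi> n j y \<partial>lborel)\<bar> \<le> \<epsilon> n"
      if "\<omega> \<in> space M - (\<Union>j\<in>J n. B j)" "j \<in> J n" for \<omega> j
      using that less_imp_le by (fastforce simp: B_def not_le)
    ultimately show ?case by blast
  qed
qed

text \<open>Coordinates are rounded down to multiples of \<open>\<delta> / DIM('b)\<close>, and one point of \<open>S\<close> is chosen for
  every value that occurs. Choosing inside \<open>S\<close> matters for sets of starting points and times, since
  estimates are available only there.\<close>

lemma net_exists:
  fixes S :: "'b::euclidean_space set"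
  assumes "bounded S"
  shows "\<exists>C>0. \<forall>\<delta>. 0 < \<delta> \<and> \<delta> \<le> 1 \<longrightarrow> (\<exists>N\<subseteq>S. finite N \<and>
     real (card N) \<le> C * (1 / \<delta>) ^ DIM('b) \<and> (\<forall>x\<in>S. \<exists>y\<in>N. norm (x - y) \<le> \<delta>))"
proof -
  obtain R where R: "R > 0" "\<And>x. x \<in> S \<Longrightarrow> norm x \<le> R"
    using assms bounded_pos by blast
  let ?d = "real DIM('b)"
  have d: "?d > 0" by simp
  let ?C = "(2 * R * ?d + 5) ^ DIM('b)"
  show ?thesis
  proof (intro exI[of _ ?C] conjI allI impI)
    show "?C > 0" using R d by (intro zero_less_power) (simp add: add_nonneg_pos)
    fix \<delta> :: real assume \<delta>: "0 < \<delta> \<and> \<delta> \<le> 1"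
    define \<delta>' where "\<delta>' = \<delta> / ?d"
    have \<delta>': "\<delta>' > 0" using \<delta> by (simp add: \<delta>'_def)
    define m where "m = \<lceil>R / \<delta>'\<rceil>"
    define key where "key x = (\<lambda>b\<in>Basis. \<lfloor>(x \<bullet> b) / \<delta>'\<rfloor>)" for x :: 'b
    have m: "m \<ge> 0" using R \<delta>' by (simp add: m_def) (smt (verit) divide_nonneg_pos)
    have key: "key ` S \<subseteq> PiE Basis (\<lambda>_. {- m - 1..m})"
    proof (intro image_subsetI PiE_I)
      fix x b assume x: "x \<in> S" "b \<in> (Basis :: 'b set)"
      have "\<bar>x \<bullet> b\<bar> \<le> R" using Basis_le_norm[OF x(2), of x] R(2)[OF x(1)] by simp
      then have "\<bar>(x \<bullet> b) / \<delta>'\<bar> \<le> R / \<delta>'" using \<delta>' by (simp add: abs_divide divide_right_mono)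
      then have "(x \<bullet> b) / \<delta>' \<le> real_of_int m" "- real_of_int m \<le> (x \<bullet> b) / \<delta>'"
        unfolding m_def by linarith+
      then have "\<lfloor>(x \<bullet> b) / \<delta>'\<rfloor> \<le> m" "- m - 1 \<le> \<lfloor>(x \<bullet> b) / \<delta>'\<rfloor>" by linarith+
      then show "key x b \<in> {- m - 1..m}" using x by (simp add: key_def)
    qed (auto simp: key_def)
    define N where "N = inv_into S key ` (key ` S)"
    have finP: "finite (PiE (Basis :: 'b set) (\<lambda>_. {- m - 1..m}))" by (intro finite_PiE) auto
    have fin: "finite (key ` S)" using key finP by (rule finite_subset)
    have "card N \<le> card (key ` S)" unfolding N_def by (rule card_image_le[OF fin])
    also have "\<dots> \<le> card (PiE (Basis :: 'b set) (\<lambda>_. {- m - 1..m}))" by (rule card_mono[OF finP key])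
    also have "\<dots> = nat (2 * m + 2) ^ DIM('b)" by (simp add: card_PiE add.commute)
    finally have "real (card N) \<le> real (nat (2 * m + 2)) ^ DIM('b)" by (metis of_nat_le_iff of_nat_power)
    also have "\<dots> \<le> ((2 * R * ?d + 5) * (1 / \<delta>)) ^ DIM('b)"
    proof (rule power_mono)
      have "real (nat (2 * m + 2)) = 2 * real_of_int m + 2" using m by simp
      also have "\<dots> \<le> 2 * (R / \<delta>') + 4" unfolding m_def by linarith
      also have "\<dots> \<le> (2 * R * ?d + 5) * (1 / \<delta>)"
        using \<delta> d by (simp add: \<delta>'_def field_simps)
      finally show "real (nat (2 * m + 2)) \<le> (2 * R * ?d + 5) * (1 / \<delta>)" .
    qed simp
    also have "\<dots> = ?C * (1 / \<delta>) ^ DIM('b)" by (rule power_mult_distrib)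
    finally have cN: "real (card N) \<le> ?C * (1 / \<delta>) ^ DIM('b)" .
    have near: "\<exists>y\<in>N. norm (x - y) \<le> \<delta>" if x: "x \<in> S" for x
    proof (rule bexI)
      let ?y = "inv_into S key (key x)"
      show "?y \<in> N" using x by (auto simp: N_def)
      have "key ?y = key x" using x by (intro f_inv_into_f) auto
      then have eq: "\<lfloor>(?y \<bullet> b) / \<delta>'\<rfloor> = \<lfloor>(x \<bullet> b) / \<delta>'\<rfloor>" if "b \<in> Basis" for b
        using that by (metis key_def restrict_apply')
      have "\<bar>(x - ?y) \<bullet> b\<bar> \<le> \<delta>'" if "b \<in> Basis" for b
      proof -
        have "\<bar>(x \<bullet> b) / \<delta>' - (?y \<bullet> b) / \<delta>'\<bar> \<le> 1" using eq[OF that] by linarith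
        then show ?thesis using \<delta>' by (simp add: inner_diff_left field_simps flip: diff_divide_distrib)
      qed
      then have "(\<Sum>b\<in>Basis. \<bar>(x - ?y) \<bullet> b\<bar>) \<le> (\<Sum>b\<in>(Basis::'b set). \<delta>')" by (rule sum_mono)
      then show "norm (x - ?y) \<le> \<delta>"
        using norm_le_l1[of "x - ?y"] d by (simp add: \<delta>'_def)
    qed
    have "N \<subseteq> S" unfolding N_def by (auto intro: inv_into_into)
    then show "\<exists>N\<subseteq>S. finite N \<and> real (card N) \<le> ?C * (1 / \<delta>) ^ DIM('b) \<and>
        (\<forall>x\<in>S. \<exists>y\<in>N. norm (x - y) \<le> \<delta>)"
      using fin cN near by (intro exI[of _ N]) (auto simp: N_def)
  qed
qed

text \<open>The mesh \<open>1 / n\<^sup>2\<close> is fine enough to absorb Lipschitz constants of order \<open>n\<close> with a remaining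
  error of order \<open>1 / n\<close>.\<close>

lemma net_sequence:
  fixes S :: "'b::euclidean_space set"
  assumes "bounded S"
  shows "\<exists>C>0. \<exists>N. \<forall>n\<ge>1. N n \<subseteq> S \<and> finite (N n) \<and> real (card (N n)) \<le> C * real n ^ (2 * DIM('b)) \<and>
     (\<forall>x\<in>S. \<exists>y\<in>N n. norm (x - y) \<le> 1 / (real n)\<^sup>2)"
proof -
  obtain C where "C > 0" and C: "\<And>\<delta>. 0 < \<delta> \<and> \<delta> \<le> 1 \<Longrightarrow> \<exists>N\<subseteq>S. finite N \<and>
     real (card N) \<le> C * (1 / \<delta>) ^ DIM('b) \<and> (\<forall>x\<in>S. \<exists>y\<in>N. norm (x - y) \<le> \<delta>)"
    using net_exists[OF assms] by blast
  have "\<exists>N. n \<ge> 1 \<longrightarrow> N \<subseteq> S \<and> finite N \<and> real (card N) \<le> C * real n ^ (2 * DIM('b)) \<and>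
     (\<forall>x\<in>S. \<exists>y\<in>N. norm (x - y) \<le> 1 / (real n)\<^sup>2)" for n
  proof (cases "n \<ge> 1")
    case True
    then have "0 < 1 / (real n)\<^sup>2 \<and> 1 / (real n)\<^sup>2 \<le> 1" by (simp add: field_simps)
    from C[OF this] show ?thesis by (simp add: power_mult)
  qed simp
  then have "\<forall>n. \<exists>N. n \<ge> 1 \<longrightarrow> N \<subseteq> S \<and> finite N \<and> real (card N) \<le> C * real n ^ (2 * DIM('b)) \<and>
     (\<forall>x\<in>S. \<exists>y\<in>N. norm (x - y) \<le> 1 / (real n)\<^sup>2)" by blast
  from choice[OF this] show ?thesis using \<open>C > 0\<close> by blast
qed

section \<open>Linearisation of the eigenvector formula\<close>

text \<open>For \<open>z = d2 \<phi> x\<close> the norm of this vector is the difference of the two eigenvalues of the Hessian.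
  It is the only term through which \<open>G_fun\<close> fails to be linear.\<close>

definition gap :: "real^3 \<Rightarrow> real^2" where
  "gap z = vector [z $ 3 - z $ 1, 2 * z $ 2]"

lemma gap_nth [simp]: "gap z $ 1 = z $ 3 - z $ 1" "gap z $ 2 = 2 * z $ 2"
  by (simp_all add: gap_def)

lemma norm_gap: "norm (gap z) = sqrt ((z $ 3 - z $ 1)\<^sup>2 + 4 * (z $ 2)\<^sup>2)"
  by (simp add: norm_vec_def L2_set_def sum_2 power_mult_distrib)

lemma gap_diff: "gap y - gap z = gap (y - z)"
  by (simp add: vec_eq_iff forall_2 algebra_simps)

lemma norm_gap_le: "norm (gap z) \<le> 4 * norm z"
proof -
  have "norm (gap z) \<le> \<bar>gap z $ 1\<bar> + \<bar>gap z $ 2\<bar>"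
    using norm_le_l1_cart[of "gap z"] by (simp add: sum_2 del: gap_nth)
  then show ?thesis
    using component_le_norm_cart[of z 1] component_le_norm_cart[of z 2] component_le_norm_cart[of z 3]
    by (simp add: abs_mult)
qed

lemma G_fun_nth: "G_fun z $ 1 = 2 * z $ 1 - 2 * z $ 3 + 2 * z $ 2 - 2 * norm (gap z)"
  "G_fun z $ 2 = z $ 3 - z $ 1 + 4 * z $ 2 - norm (gap z)"
  by (simp_all add: G_fun_def Let_def norm_gap)

lemma G_fun_lipschitz: "norm (G_fun y - G_fun z) \<le> 30 * norm (y - z)"
proof -
  have g: "\<bar>norm (gap y) - norm (gap z)\<bar> \<le> 4 * norm (y - z)"
    using norm_triangle_ineq3[of "gap y" "gap z"] norm_gap_le[of "y - z"] by (simp add: gap_diff)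
  have c: "\<bar>y $ j - z $ j\<bar> \<le> norm (y - z)" for j
    using component_le_norm_cart[of "y - z" j] by simp
  have "norm (G_fun y - G_fun z) \<le> \<bar>(G_fun y - G_fun z) $ 1\<bar> + \<bar>(G_fun y - G_fun z) $ 2\<bar>"
    using norm_le_l1_cart[of "G_fun y - G_fun z"] by (simp add: sum_2)
  then show ?thesis using g c[of 1] c[of 2] c[of 3] by (simp add: G_fun_nth)
qed

text \<open>The norm lies above its tangent by the Cauchy-Schwarz inequality. The upper bound follows from
  \<open>2 * norm p * norm (p + d) \<le> (norm p)\<^sup>2 + (norm (p + d))\<^sup>2\<close>. Both hold for
  every \<open>d\<close>, so the expansion of \<open>G_fun\<close> derived from them holds whatever the size of the error of
  the second derivatives.\<close>

lemma norm_expansion: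
  fixes p d :: "'b::real_inner"
  assumes "p \<noteq> 0"
  shows "\<bar>norm (p + d) - norm p - (p \<bullet> d) / norm p\<bar> \<le> (norm d)\<^sup>2 / (2 * norm p)"
proof -
  have p: "norm p > 0" using assms by simp
  let ?l = "norm p + (p \<bullet> d) / norm p"
  have sq: "(norm (p + d))\<^sup>2 = (norm p)\<^sup>2 + 2 * (p \<bullet> d) + (norm d)\<^sup>2"
    by (simp add: power2_norm_eq_inner inner_add_left inner_add_right inner_commute)
  have cs: "(p \<bullet> (p + d)) \<le> norm p * norm (p + d)" by (rule norm_cauchy_schwarz)
  have "p \<bullet> (p + d) = norm p * ?l"
    using p by (simp add: inner_add_right distrib_left power2_norm_eq_inner[symmetric] power2_eq_square[symmetric])
  then have lower: "?l \<le> norm (p + d)" using cs p by simp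
  have "2 * norm p * norm (p + d) \<le> (norm p)\<^sup>2 + (norm (p + d))\<^sup>2"
    using zero_le_power2[of "norm p - norm (p + d)"] by (simp add: power2_diff)
  then have "2 * norm p * norm (p + d) \<le> 2 * norm p * ?l + (norm d)\<^sup>2"
    using sq p by (simp add: distrib_left power2_eq_square)
  moreover have "0 < 2 * norm p" using p by simp
  ultimately have "norm (p + d) \<le> (2 * norm p * ?l + (norm d)\<^sup>2) / (2 * norm p)"
    by (simp only: pos_le_divide_eq mult.commute[of "norm (p + d)"])
  also have "\<dots> = ?l + (norm d)\<^sup>2 / (2 * norm p)"
    unfolding add_divide_distrib using \<open>0 < 2 * norm p\<close> by (subst nonzero_mult_div_cancel_left) simp_all
  finally have "norm (p + d) \<le> ?l + (norm d)\<^sup>2 / (2 * norm p)" .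
  then show ?thesis using lower by (simp add: abs_if)
qed

text \<open>The gradient of \<open>\<lambda>z. norm (gap z)\<close>.\<close>

definition gap_slope :: "real^3 \<Rightarrow> real^3" where
  "gap_slope z = (1 / norm (gap z)) *\<^sub>R vector [z $ 1 - z $ 3, 4 * z $ 2, z $ 3 - z $ 1]"

text \<open>The gradient of component \<open>c\<close> of \<open>G_fun\<close>.\<close>

definition G_slope :: "2 \<Rightarrow> real^3 \<Rightarrow> real^3" where
  "G_slope c z = (if c = 1 then vector [2, 2, - 2] - 2 *\<^sub>R gap_slope z else vector [- 1, 4, 1] - gap_slope z)"

lemma inner_3: "(x :: real^3) \<bullet> y = x $ 1 * y $ 1 + x $ 2 * y $ 2 + x $ 3 * y $ 3"
  by (simp add: inner_vec_def sum_3)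

lemma gap_slope_inner: "gap_slope z \<bullet> d = (gap z \<bullet> gap d) / norm (gap z)"
proof -
  have "gap z \<bullet> gap d = (vector [z $ 1 - z $ 3, 4 * z $ 2, z $ 3 - z $ 1] :: real^3) \<bullet> d"
    by (simp add: inner_3) (simp add: inner_vec_def sum_2 algebra_simps)
  then show ?thesis by (simp add: gap_slope_def)
qed

lemma G_fun_expansion:
  assumes "gap z \<noteq> 0"
  shows "\<bar>G_fun y $ c - G_fun z $ c - G_slope c z \<bullet> (y - z)\<bar> \<le> 16 * (norm (y - z))\<^sup>2 / norm (gap z)"
proof -
  let ?d = "y - z"
  have g: "norm (gap z) > 0" using assms by simp
  have gd: "gap z + gap ?d = gap y" by (simp flip: gap_diff)
  have "\<bar>norm (gap y) - norm (gap z) - gap_slope z \<bullet> ?d\<bar> \<le> (norm (gap ?d))\<^sup>2 / (2 * norm (gap z))"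
    using norm_expansion[OF assms, of "gap ?d"] by (simp only: gd gap_slope_inner)
  also have "\<dots> \<le> (4 * norm ?d)\<^sup>2 / (2 * norm (gap z))"
    using g by (intro divide_right_mono power_mono norm_gap_le) auto
  also have "\<dots> = 8 * (norm ?d)\<^sup>2 / norm (gap z)" using g by (simp add: power_mult_distrib field_simps)
  finally have e: "\<bar>norm (gap y) - norm (gap z) - gap_slope z \<bullet> ?d\<bar> \<le> 8 * (norm ?d)\<^sup>2 / norm (gap z)" .
  have c: "c = 1 \<or> c = 2" by (rule exhaust_2)
  show ?thesis
  proof (cases "c = 1")
    case True
    have "G_fun y $ 1 - G_fun z $ 1 - G_slope 1 z \<bullet> ?d
        = - 2 * (norm (gap y) - norm (gap z) - gap_slope z \<bullet> ?d)"
      by (simp add: G_fun_nth G_slope_def inner_diff_left) (simp add: inner_3 algebra_simps)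
    then have "\<bar>G_fun y $ 1 - G_fun z $ 1 - G_slope 1 z \<bullet> ?d\<bar>
        = 2 * \<bar>norm (gap y) - norm (gap z) - gap_slope z \<bullet> ?d\<bar>" by (simp only: abs_mult, simp?)
    then show ?thesis using e True by simp
  next
    case False
    then have c2: "c = 2" using c by simp
    have "G_fun y $ 2 - G_fun z $ 2 - G_slope 2 z \<bullet> ?d
        = - 1 * (norm (gap y) - norm (gap z) - gap_slope z \<bullet> ?d)"
      by (simp add: G_fun_nth G_slope_def inner_diff_left) (simp add: inner_3 algebra_simps)
    then have "\<bar>G_fun y $ 2 - G_fun z $ 2 - G_slope 2 z \<bullet> ?d\<bar>
        = \<bar>norm (gap y) - norm (gap z) - gap_slope z \<bullet> ?d\<bar>" by (simp only: abs_mult, simp?)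
    moreover have "8 * (norm ?d)\<^sup>2 / norm (gap z) \<le> 16 * (norm ?d)\<^sup>2 / norm (gap z)"
      using g by (intro divide_right_mono) auto
    ultimately show ?thesis using e c2 by simp
  qed
qed

lemma norm_le_l1_3: "norm (v :: real^3) \<le> \<bar>v $ 1\<bar> + \<bar>v $ 2\<bar> + \<bar>v $ 3\<bar>"
  using norm_le_l1_cart[of v] by (simp add: sum_3)

lemma G_slope_bound: "norm (G_slope c z) \<le> 14"
proof -
  have "\<bar>gap z $ 1\<bar> \<le> norm (gap z)" "\<bar>gap z $ 2\<bar> \<le> norm (gap z)" by (rule component_le_norm_cart)+
  then have b: "\<bar>gap_slope z $ 1\<bar> \<le> 1" "\<bar>gap_slope z $ 2\<bar> \<le> 2" "\<bar>gap_slope z $ 3\<bar> \<le> 1"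
    by (cases "norm (gap z) = 0"; simp add: gap_slope_def abs_mult divide_le_eq)+
  have "norm (gap_slope z) \<le> 4" using norm_le_l1_3[of "gap_slope z"] b by linarith
  moreover have "norm (vector [2, 2, - 2] :: real^3) \<le> 6" "norm (vector [- 1, 4, 1] :: real^3) \<le> 6"
    using norm_le_l1_3[of "vector [2, 2, - 2]"] norm_le_l1_3[of "vector [- 1, 4, 1]"] by simp_all
  ultimately show ?thesis
    using norm_triangle_ineq4[of "vector [2, 2, - 2] :: real^3" "2 *\<^sub>R gap_slope z"]
      norm_triangle_ineq4[of "vector [- 1, 4, 1] :: real^3" "gap_slope z"]
    by (simp add: G_slope_def)
qed

lemma continuous_on_gap: "continuous_on S gap"
proof -
  have "gap = (\<lambda>z. \<chi> j. gap z $ j)" by simp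
  moreover have "continuous_on S (\<lambda>z. gap z $ j)" for j
    using exhaust_2[of j] by (elim disjE; simp) (intro continuous_intros)+
  then have "continuous_on S (\<lambda>z. \<chi> j. gap z $ j)" by (rule continuous_on_vec_lambda)
  ultimately show ?thesis by simp
qed

lemma continuous_on_G_slope:
  assumes "\<And>z. z \<in> S \<Longrightarrow> gap z \<noteq> 0"
  shows "continuous_on S (G_slope c)"
proof -
  have v: "continuous_on S (\<lambda>z. vector [z $ 1 - z $ 3, 4 * z $ 2, z $ 3 - z $ 1] :: real^3)" (is "continuous_on S ?v")
  proof -
    have "?v = (\<lambda>z. \<chi> j. ?v z $ j)" by simp
    moreover have "continuous_on S (\<lambda>z. ?v z $ j)" for j
      using exhaust_3[of j] by (elim disjE; simp) (intro continuous_intros)+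
    then have "continuous_on S (\<lambda>z. \<chi> j. ?v z $ j)" by (rule continuous_on_vec_lambda)
    ultimately show ?thesis by simp
  qed
  have "continuous_on S gap_slope"
    unfolding gap_slope_def[abs_def] using assms
    by (intro continuous_intros v continuous_on_gap) auto
  then have "continuous_on S (\<lambda>z. vector [2, 2, - 2] - 2 *\<^sub>R gap_slope z)" "continuous_on S (\<lambda>z. vector [- 1, 4, 1] - gap_slope z)"
    by (intro continuous_intros; simp)+
  then show ?thesis unfolding G_slope_def[abs_def] by (cases "c = 1") auto
qed

text \<open>A symmetric matrix of size two with vanishing gap is a multiple of the identity and has only one
  eigenvalue.\<close>

lemma gap_nonzero:
  fixes A :: "real^2^2"
  assumes "eigenvalue A l1" "eigenvalue A l2" "l1 \<noteq> l2"
    and A: "A $ 1 $ 1 = z $ 1" "A $ 1 $ 2 = z $ 2" "A $ 2 $ 1 = z $ 2" "A $ 2 $ 2 = z $ 3"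
  shows "gap z \<noteq> 0"
proof
  assume "gap z = 0"
  then have "gap z $ 1 = 0" "gap z $ 2 = 0" by (simp_all del: gap_nth)
  then have z: "z $ 3 = z $ 1" "z $ 2 = 0" by simp_all
  have "l = z $ 1" if "eigenvalue A l" for l
  proof -
    obtain v where v: "v \<noteq> 0" "A *v v = l *\<^sub>R v" using \<open>eigenvalue A l\<close> by (auto simp: eigenvalue_def)
    have "(A *v v) $ 1 = z $ 1 * v $ 1" "(A *v v) $ 2 = z $ 1 * v $ 2"
      using A z by (simp_all add: matrix_vector_mult_def sum_2)
    then have "l * v $ 1 = z $ 1 * v $ 1" "l * v $ 2 = z $ 1 * v $ 2" using v(2) by simp_all
    moreover have "v $ 1 \<noteq> 0 \<or> v $ 2 \<noteq> 0" using v(1) by (auto simp: vec_eq_iff forall_2)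
    ultimately show ?thesis by auto
  qed
  then show False using assms by metis
qed

section \<open>Kernel estimators of second derivatives and their means\<close>

text \<open>The terms of first order cancel, so the Lipschitz constant of the gradient suffices. The mean value
  theorem is applied to \<open>\<lambda>t. u (x + t *\<^sub>R v) + u (x - t *\<^sub>R v)\<close>, whose derivative at \<open>t\<close> is a difference of
  gradients at two points at distance \<open>2 * t * norm v\<close>.\<close>

lemma second_difference_bound:
  assumes u: "u differentiable_on UNIV"
    and L: "\<And>k y z. y \<in> cball 0 r \<Longrightarrow> z \<in> cball 0 r \<Longrightarrow>
       \<bar>partial_deriv k u y - partial_deriv k u z\<bar> \<le> L * norm (y - z)"
    and x: "norm x + norm v \<le> r" and "L \<ge> 0"
  shows "\<bar>u (x + v) + u (x - v) - 2 * u x\<bar> \<le> 4 * L * (norm v)\<^sup>2"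
proof -
  have da: "u differentiable (at y)" for y using u by (auto simp: differentiable_on_def)
  define D where "D t = (\<Sum>k\<in>UNIV. v $ k * (partial_deriv k u (x + t *\<^sub>R v) - partial_deriv k u (x + t *\<^sub>R (- v))))" for t
  have "((\<lambda>t. u (x + t *\<^sub>R v) + u (x + t *\<^sub>R (- v))) has_real_derivative D t) (at t)" for t
    using DERIV_add[OF has_real_derivative_along_line[OF da, where x = x and s = t and v = v]
        has_real_derivative_along_line[OF da, where x = x and s = t and v = "- v"]]
    by (simp add: D_def sum.distrib[symmetric] sum_subtractf[symmetric] sum_negf[symmetric] algebra_simps)
  then obtain t where t: "0 < t" "t < 1"
    "u (x + 1 *\<^sub>R v) + u (x + 1 *\<^sub>R (- v)) - (u (x + 0 *\<^sub>R v) + u (x + 0 *\<^sub>R (- v))) = (1 - 0) * D t"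
    using MVT2[of 0 1 "\<lambda>t. u (x + t *\<^sub>R v) + u (x + t *\<^sub>R (- v))" D] by auto
  have "norm (t *\<^sub>R v) \<le> norm v" using t by (simp add: mult_left_le_one_le)
  then have "norm (x + t *\<^sub>R v) \<le> r" "norm (x + t *\<^sub>R (- v)) \<le> r"
    using x norm_triangle_ineq[of x "t *\<^sub>R v"] norm_triangle_ineq[of x "t *\<^sub>R (- v)"] by auto
  then have "\<bar>partial_deriv k u (x + t *\<^sub>R v) - partial_deriv k u (x + t *\<^sub>R (- v))\<bar>
     \<le> L * norm ((x + t *\<^sub>R v) - (x + t *\<^sub>R (- v)))" for k
    by (intro L) auto
  moreover have "norm ((x + t *\<^sub>R v) - (x + t *\<^sub>R (- v))) \<le> 2 * norm v"
  proof -
    have "(x + t *\<^sub>R v) - (x + t *\<^sub>R (- v)) = (2 * t) *\<^sub>R v" by (simp add: scaleR_2 algebra_simps flip: scaleR_scaleR)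
    then show ?thesis using t by (simp add: mult_right_mono)
  qed
  ultimately have le: "\<bar>partial_deriv k u (x + t *\<^sub>R v) - partial_deriv k u (x + t *\<^sub>R (- v))\<bar> \<le> L * (2 * norm v)" for k
    using \<open>L \<ge> 0\<close> by (meson mult_left_mono order_trans)
  have "\<bar>v $ k * (partial_deriv k u (x + t *\<^sub>R v) - partial_deriv k u (x + t *\<^sub>R (- v)))\<bar> \<le> norm v * (L * (2 * norm v))" for k
    unfolding abs_mult by (intro mult_mono le component_le_norm_cart) auto
  then have "\<bar>D t\<bar> \<le> (\<Sum>k\<in>(UNIV :: 2 set). norm v * (L * (2 * norm v)))"
    unfolding D_def by (intro order_trans[OF sum_abs] sum_mono)
  also have "\<dots> = 4 * L * (norm v)\<^sup>2" by (simp add: power2_eq_square)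
  finally show ?thesis using t by simp
qed

locale kde_sample = iid_sample M X f for M :: "'a measure" and X f +
  fixes K :: "real^2 \<Rightarrow> real"
  assumes f_smooth: "times_continuously_differentiable 4 f"
    and K_density: "prob_density K" and K_smooth: "times_differentiable 4 K"
    and K_sym: "\<And>x. K (- x) = K x" and K_supp: "support K = cball 0 1"
begin

lemma f_diff: "f differentiable_on UNIV" "partial_deriv k f differentiable_on UNIV"
    "partial_deriv k (partial_deriv l f) differentiable_on UNIV"
    "partial_deriv m (partial_deriv k (partial_deriv l f)) differentiable_on UNIV"
  and f_cont4: "continuous_on UNIV (partial_deriv r (partial_deriv m (partial_deriv k (partial_deriv l f))))"
  using f_smooth by (simp_all add: eval_nat_numeral)

lemma f_cont: "continuous_on UNIV f" "continuous_on UNIV (partial_deriv k f)"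
    "continuous_on UNIV (partial_deriv k (partial_deriv l f))"
    "continuous_on UNIV (partial_deriv m (partial_deriv k (partial_deriv l f)))"
  using f_diff by (auto intro: differentiable_imp_continuous_on)

lemma K_diff: "K differentiable_on UNIV" "partial_deriv k K differentiable_on UNIV"
    "partial_deriv k (partial_deriv l K) differentiable_on UNIV"
    "partial_deriv m (partial_deriv k (partial_deriv l K)) differentiable_on UNIV"
  using K_smooth by (simp_all add: eval_nat_numeral)

lemma K_cont: "continuous_on UNIV K" "continuous_on UNIV (partial_deriv k K)"
    "continuous_on UNIV (partial_deriv k (partial_deriv l K))"
    "continuous_on UNIV (partial_deriv m (partial_deriv k (partial_deriv l K)))"
  using K_diff by (auto intro: differentiable_imp_continuous_on)

lemma K_nonneg: "0 \<le> K z" and K_integrable: "integrable lborel K" and K_integral: "(\<integral>z. K z \<partial>lborel) = 1"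
  using K_density by (auto simp: prob_density_def intro!: integrableI_nonneg integral_eq_nn_integral[THEN trans])

lemma K_outside: "norm z > 1 \<Longrightarrow> K z = 0"
  using closure_subset[of "{x. K x \<noteq> 0}"] K_supp by (auto simp: support_def)

lemma K_partial_outside:
  "norm z > 1 \<Longrightarrow> partial_deriv k K z = 0"
  "norm z > 1 \<Longrightarrow> partial_deriv k (partial_deriv l K) z = 0"
  "norm z > 1 \<Longrightarrow> partial_deriv m (partial_deriv k (partial_deriv l K)) z = 0"
  by (intro partial_deriv_outside[of 1] K_outside; assumption)+

lemma d2f_lipschitz: "\<exists>L>0. \<forall>x\<in>cball 0 r. \<forall>y\<in>cball 0 r. norm (d2 f x - d2 f y) \<le> L * norm (x - y)"
proof -
  have "\<exists>L>0. \<forall>j. \<forall>x\<in>cball 0 r. \<forall>y\<in>cball 0 r. \<bar>d2 f x $ j - d2 f y $ j\<bar> \<le> L * norm (x - y)"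
  proof (rule uniform_constant)
    show "\<exists>L>0. \<forall>x\<in>cball 0 r. \<forall>y\<in>cball 0 r. \<bar>d2 f x $ j - d2 f y $ j\<bar> \<le> L * norm (x - y)" for j
      unfolding d2_nth by (rule lipschitz_on_compact[OF f_diff(3) f_cont(4)]) auto
  qed (meson mult_right_mono norm_ge_zero order_trans)
  then obtain L where L: "L > 0"
    "\<And>j x y. x \<in> cball 0 r \<Longrightarrow> y \<in> cball 0 r \<Longrightarrow> \<bar>d2 f x $ j - d2 f y $ j\<bar> \<le> L * norm (x - y)"
    by blast
  have "norm (d2 f x - d2 f y) \<le> 3 * L * norm (x - y)" if "x \<in> cball 0 r" "y \<in> cball 0 r" for x y
    using norm_le_componentwise[of "d2 f x - d2 f y" "L * norm (x - y)"] L(2)[OF that] by simp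
  then show ?thesis using L(1) by (intro exI[of _ "3 * L"]) auto
qed

lemma d2f_continuous: "continuous_on UNIV (d2 f)"
proof -
  have "d2 f = (\<lambda>x. \<chi> j. d2 f x $ j)" by simp
  moreover have "continuous_on UNIV (\<lambda>x. \<chi> j. d2 f x $ j)"
    by (intro continuous_on_vec_lambda) (simp add: d2_nth f_cont)
  ultimately show ?thesis by simp
qed

text \<open>The contribution of an observation at \<open>y\<close> to the second derivatives at \<open>x\<close> of the estimator with
  bandwidth \<open>s\<close>.\<close>

definition kern :: "real \<Rightarrow> real^2 \<Rightarrow> real^2 \<Rightarrow> real^3" where
  "kern s x y = (1 / s ^ 4) *\<^sub>R d2 K ((1 / s) *\<^sub>R (x - y))"

definition mean :: "real \<Rightarrow> real^2 \<Rightarrow> real^3" where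
  "mean s x = (\<chi> j. \<integral>y. f y * kern s x y $ j \<partial>lborel)"

lemma d2_kde_eq: "d2 (kde K h X n \<omega>) x = (\<Sum>i=1..n. kern (h n) x (X i \<omega>)) /\<^sub>R real n"
  unfolding kern_def by (rule d2_kde[OF K_diff(1,2)])

text \<open>The third derivatives of \<open>K\<close>, taken in any order, are differentiable, hence continuous, and they
  vanish outside the unit ball. They are therefore bounded, which makes the second derivatives
  Lipschitz.\<close>

lemma d2K_bounds:
  "\<exists>G>0. (\<forall>z. norm (d2 K z) \<le> G) \<and> (\<forall>y z. norm (d2 K y - d2 K z) \<le> G * norm (y - z))"
proof -
  have "\<exists>B>0. \<forall>j. \<forall>z. \<bar>d2 K z $ j\<bar> \<le> B"
  proof (rule uniform_constant)
    show "\<exists>B>0. \<forall>z. \<bar>d2 K z $ j\<bar> \<le> B" for j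
      unfolding d2_nth by (rule bounded_compact_support[OF K_cont(3), of 1]) (rule K_partial_outside(2))
  qed (meson order_trans)
  then obtain B where B: "B > 0" "\<And>j z. \<bar>d2 K z $ j\<bar> \<le> B" by blast
  have "\<exists>C>0. \<forall>p. case p of (j, k) \<Rightarrow> \<forall>z. \<bar>partial_deriv k (\<lambda>z. d2 K z $ j) z\<bar> \<le> C"
  proof (rule uniform_constant)
    show "\<exists>C>0. case p of (j, k) \<Rightarrow> \<forall>z. \<bar>partial_deriv k (\<lambda>z. d2 K z $ j) z\<bar> \<le> C" for p
    proof (cases p)
      case (Pair j k)
      have "\<exists>C>0. \<forall>z. \<bar>partial_deriv k (\<lambda>z. d2 K z $ j) z\<bar> \<le> C"
        unfolding d2_nth by (rule bounded_compact_support[OF K_cont(4), of 1]) (rule K_partial_outside(3))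
      then show ?thesis by (simp add: Pair)
    qed
  qed (auto intro: order_trans)
  then obtain C where C: "C > 0" "\<And>j k z. \<bar>partial_deriv k (\<lambda>z. d2 K z $ j) z\<bar> \<le> C" by auto
  have "\<bar>d2 K y $ j - d2 K z $ j\<bar> \<le> 2 * C * norm (y - z)" for y z j
    by (rule lipschitz_of_bounded_partials[where S = UNIV]) (use C(2) in \<open>auto simp: d2_nth K_diff\<close>)
  then have lip: "norm (d2 K y - d2 K z) \<le> 6 * C * norm (y - z)" for y z
    using norm_le_componentwise[of "d2 K y - d2 K z" "2 * C * norm (y - z)"] by simp
  have bd: "norm (d2 K z) \<le> 3 * B" for z using norm_le_componentwise[of "d2 K z" B] B by simp
  let ?G = "max (3 * B) (6 * C)"
  have "norm (d2 K z) \<le> ?G" for z using bd[of z] by simp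
  moreover have "norm (d2 K y - d2 K z) \<le> ?G * norm (y - z)" for y z
    using order_trans[OF lip mult_right_mono[of "6 * C" ?G "norm (y - z)"]] by simp
  moreover have "?G > 0" using B by simp
  ultimately show ?thesis by blast
qed

text \<open>One constant that serves both as a bound and as a Lipschitz constant of the second derivatives of
  \<open>K\<close>.\<close>

definition G where "G = (SOME G. G > 0 \<and> (\<forall>z. norm (d2 K z) \<le> G) \<and> (\<forall>y z. norm (d2 K y - d2 K z) \<le> G * norm (y - z)))"

lemma G: "G > 0" "norm (d2 K z) \<le> G" "norm (d2 K y - d2 K z) \<le> G * norm (y - z)"
  using someI_ex[OF d2K_bounds] unfolding G_def by auto

lemma d2K_outside: "norm z > 1 \<Longrightarrow> d2 K z = 0"
  by (simp add: vec_eq_iff d2_nth K_partial_outside)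

lemma kern_bound: "s > 0 \<Longrightarrow> norm (kern s x y) \<le> G / s ^ 4"
  using G(2) by (simp add: kern_def divide_right_mono)

lemma kern_outside: "s > 0 \<Longrightarrow> norm (x - y) > s \<Longrightarrow> kern s x y = 0"
  by (auto simp: kern_def intro!: d2K_outside)

lemma kern_lipschitz:
  assumes "s > 0"
  shows "norm (kern s x y - kern s x' y') \<le> G / s ^ 5 * norm ((x - y) - (x' - y'))"
proof -
  have "norm (kern s x y - kern s x' y')
      = 1 / s ^ 4 * norm (d2 K ((1 / s) *\<^sub>R (x - y)) - d2 K ((1 / s) *\<^sub>R (x' - y')))"
    using assms by (simp add: kern_def flip: scaleR_diff_right)
  also have "\<dots> \<le> 1 / s ^ 4 * (G * norm ((1 / s) *\<^sub>R (x - y) - (1 / s) *\<^sub>R (x' - y')))"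
    using assms G by (intro mult_left_mono) auto
  also have "\<dots> = G / s ^ 5 * norm ((x - y) - (x' - y'))"
    using assms by (simp add: power_Suc2[of s 4, simplified] flip: scaleR_diff_right)
  finally show ?thesis .
qed

lemma kern_continuous [continuous_intros]:
  fixes a b :: "'z::topological_space \<Rightarrow> real^2"
  assumes "continuous_on S a" "continuous_on S b"
  shows "continuous_on S (\<lambda>p. kern s (a p) (b p))"
proof -
  have c: "continuous_on UNIV (d2 K)"
    using G by (intro lipschitz_on_continuous_on[of G] lipschitz_onI) (auto simp: dist_norm intro: less_imp_le)
  show ?thesis
    unfolding kern_def by (intro continuous_intros continuous_on_compose2[OF c] assms) simp
qed

lemma kern_measurable [measurable]: "kern s x \<in> borel_measurable borel"
  by (intro borel_measurable_continuous_onI kern_continuous continuous_intros)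

lemma kern_nth_measurable [measurable]: "(\<lambda>y. kern s x y $ j) \<in> borel_measurable borel"
  by (intro borel_measurable_continuous_onI continuous_intros)

lemma mean_inner:
  assumes "s > 0" shows "(\<integral>y. f y * (kern s x y \<bullet> b) \<partial>lborel) = mean s x \<bullet> b"
proof -
  have int: "integrable lborel (\<lambda>y. f y * kern s x y $ j)" for j
    using order_trans[OF component_le_norm_cart kern_bound[OF assms]]
    by (intro integrable_density_mult[of _ "G / s ^ 4"]) auto
  have "(\<integral>y. f y * (kern s x y \<bullet> b) \<partial>lborel) = (\<integral>y. (\<Sum>j\<in>UNIV. (f y * kern s x y $ j) * b $ j) \<partial>lborel)"
    by (simp add: inner_vec_def sum_distrib_left mult.assoc)
  also have "\<dots> = (\<Sum>j\<in>UNIV. mean s x $ j * b $ j)"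
    using int by (subst Bochner_Integration.integral_sum) (auto simp: mean_def)
  finally show ?thesis by (simp add: inner_vec_def)
qed

text \<open>After the substitution \<open>y = x - s *\<^sub>R z\<close> two integrations by parts move the derivatives from \<open>K\<close> to
  \<open>f\<close>, each producing a factor \<open>s\<close>. They arrive in reversed order, whence \<open>partial_deriv_commute\<close>.\<close>

lemma mean_nth:
  assumes s: "s > 0"
  shows "mean s x $ j = (\<integral>z. K z * d2 f (x - s *\<^sub>R z) $ j \<partial>lborel)"
proof -
  let ?p = "idx1 j" and ?q = "idx2 j"
  have "mean s x $ j = (\<integral>y. f y * kern s x y $ j \<partial>lborel)" by (simp add: mean_def)
  also have "\<dots> = s\<^sup>2 * (\<integral>z. f (x + (- s) *\<^sub>R z) * kern s x (x + (- s) *\<^sub>R z) $ j \<partial>lborel)"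
    using s by (subst integral_affine_plane[of _ "- s" x]) auto
  also have "\<dots> = s\<^sup>2 * (\<integral>z. (1 / s ^ 4) * (partial_deriv ?p (partial_deriv ?q K) z * f (x - s *\<^sub>R z)) \<partial>lborel)"
    using s by (simp add: kern_def d2_nth mult_ac)
  also have "\<dots> = (s\<^sup>2 / s ^ 4) * (\<integral>z. partial_deriv ?p (partial_deriv ?q K) z * f (x - s *\<^sub>R z) \<partial>lborel)"
    by simp
  also have "(\<integral>z. partial_deriv ?p (partial_deriv ?q K) z * f (x - s *\<^sub>R z) \<partial>lborel)
      = s * (\<integral>z. partial_deriv ?q K z * partial_deriv ?p f (x - s *\<^sub>R z) \<partial>lborel)"
    by (intro integral_by_parts K_diff K_cont f_diff f_cont K_partial_outside)
  also have "(\<integral>z. partial_deriv ?q K z * partial_deriv ?p f (x - s *\<^sub>R z) \<partial>lborel)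
      = s * (\<integral>z. K z * partial_deriv ?q (partial_deriv ?p f) (x - s *\<^sub>R z) \<partial>lborel)"
    by (intro integral_by_parts K_diff K_cont f_diff f_cont K_outside)
  also have "partial_deriv ?q (partial_deriv ?p f) = partial_deriv ?p (partial_deriv ?q f)"
    by (intro ext partial_deriv_commute f_diff f_cont)
  finally show ?thesis using s by (simp add: d2_nth power4_eq_xxxx power2_eq_square)
qed

lemma smooth_integrable:
  "integrable lborel (\<lambda>z. K z * d2 f (x + s *\<^sub>R z) $ j)" "integrable lborel (\<lambda>z. K z * d2 f (x - s *\<^sub>R z) $ j)"
proof -
  have "continuous_on UNIV (\<lambda>z. K z * d2 f (x + s *\<^sub>R z) $ j)" for s
    unfolding d2_nth by (intro continuous_intros K_cont continuous_on_compose2[OF f_cont(3)]) auto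
  then have "integrable lborel (\<lambda>z. K z * d2 f (x + s *\<^sub>R z) $ j)" for s
    by (rule integrable_compact_support[of _ 1]) (simp add: K_outside)
  from this[of s] this[of "- s"]
  show "integrable lborel (\<lambda>z. K z * d2 f (x + s *\<^sub>R z) $ j)" "integrable lborel (\<lambda>z. K z * d2 f (x - s *\<^sub>R z) $ j)"
    by simp_all
qed

lemma kernel_average_le:
  assumes "integrable lborel (\<lambda>z. K z * u z)" "\<And>z. norm z \<le> 1 \<Longrightarrow> \<bar>u z\<bar> \<le> b"
  shows "\<bar>\<integral>z. K z * u z \<partial>lborel\<bar> \<le> b"
proof -
  have "norm (\<integral>z. K z * u z \<partial>lborel) \<le> (\<integral>z. norm (K z * u z) \<partial>lborel)" by (rule integral_norm_bound)
  also have "\<dots> \<le> (\<integral>z. K z * b \<partial>lborel)"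
  proof (rule integral_mono)
    show "norm (K z * u z) \<le> K z * b" for z
      using assms(2)[of z] K_nonneg[of z] K_outside[of z]
      by (cases "norm z \<le> 1") (auto simp: abs_mult intro: mult_left_mono)
  qed (use assms K_integrable in \<open>auto intro!: integrable_norm\<close>)
  finally show ?thesis using K_integral by simp
qed

lemma mean_lipschitz: "\<exists>L>0. \<forall>s x y. 0 < s \<longrightarrow> s \<le> 1 \<longrightarrow> x \<in> cball 0 r \<longrightarrow> y \<in> cball 0 r \<longrightarrow>
    norm (mean s x - mean s y) \<le> L * norm (x - y)"
proof -
  obtain L where L: "L > 0" "\<And>x y. x \<in> cball 0 (r + 1) \<Longrightarrow> y \<in> cball 0 (r + 1) \<Longrightarrow>
     norm (d2 f x - d2 f y) \<le> L * norm (x - y)" using d2f_lipschitz[of "r + 1"] by blast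
  have "norm (mean s x - mean s y) \<le> 3 * L * norm (x - y)"
    if s: "0 < s" "s \<le> 1" and xy: "x \<in> cball 0 r" "y \<in> cball 0 r" for s x y
  proof -
    have "\<bar>(mean s x - mean s y) $ j\<bar> \<le> L * norm (x - y)" for j
    proof -
      have "(mean s x - mean s y) $ j = (\<integral>z. K z * (d2 f (x - s *\<^sub>R z) $ j - d2 f (y - s *\<^sub>R z) $ j) \<partial>lborel)"
        using s smooth_integrable by (simp add: mean_nth right_diff_distrib)
      also have "\<bar>\<dots>\<bar> \<le> L * norm (x - y)"
      proof (rule kernel_average_le)
        show "integrable lborel (\<lambda>z. K z * (d2 f (x - s *\<^sub>R z) $ j - d2 f (y - s *\<^sub>R z) $ j))"
          using smooth_integrable by (simp add: right_diff_distrib)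
        fix z :: "real^2" assume z: "norm z \<le> 1"
        then have "norm (s *\<^sub>R z) \<le> 1" using s by (simp add: mult_le_one)
        then have "x - s *\<^sub>R z \<in> cball 0 (r + 1)" "y - s *\<^sub>R z \<in> cball 0 (r + 1)"
          using xy norm_triangle_ineq4[of x "s *\<^sub>R z"] norm_triangle_ineq4[of y "s *\<^sub>R z"] by auto
        from L(2)[OF this] show "\<bar>d2 f (x - s *\<^sub>R z) $ j - d2 f (y - s *\<^sub>R z) $ j\<bar> \<le> L * norm (x - y)"
          using component_le_norm_cart[of "d2 f (x - s *\<^sub>R z) - d2 f (y - s *\<^sub>R z)" j] by simp
      qed
      finally show ?thesis .
    qed
    from norm_le_componentwise[OF this] show ?thesis by simp
  qed
  then show ?thesis using L by (intro exI[of _ "3 * L"]) auto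
qed

text \<open>As \<open>K\<close> is even, averaging \<open>d2 f (x - s *\<^sub>R z)\<close> and averaging \<open>d2 f (x + s *\<^sub>R z)\<close> against \<open>K\<close> give the
  same result. So twice the bias is an average of symmetric second differences.\<close>

lemma mean_bias: "\<exists>C>0. \<forall>s x. 0 < s \<longrightarrow> s \<le> 1 \<longrightarrow> x \<in> cball 0 r \<longrightarrow> norm (mean s x - d2 f x) \<le> C * s\<^sup>2"
proof -
  define lip where "lip p L \<longleftrightarrow> (\<forall>x\<in>cball 0 (r + 1). \<forall>y\<in>cball 0 (r + 1).
     \<bar>partial_deriv (fst p) (\<lambda>x. d2 f x $ snd p) x - partial_deriv (fst p) (\<lambda>x. d2 f x $ snd p) y\<bar>
       \<le> L * norm (x - y))" for p :: "2 \<times> 3" and L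
  have "\<exists>L>0. \<forall>p. lip p L"
  proof (rule uniform_constant)
    show "\<exists>L>0. lip p L" for p
      unfolding lip_def d2_nth by (rule lipschitz_on_compact[OF f_diff(4) f_cont4]) auto
    show "lip p L'" if "lip p L" "L \<le> L'" for p L L'
      unfolding lip_def
    proof (intro ballI)
      fix x y :: "real^2" assume xy: "x \<in> cball 0 (r + 1)" "y \<in> cball 0 (r + 1)"
      from that(1) xy have "\<bar>partial_deriv (fst p) (\<lambda>x. d2 f x $ snd p) x - partial_deriv (fst p) (\<lambda>x. d2 f x $ snd p) y\<bar>
          \<le> L * norm (x - y)" unfolding lip_def by blast
      also have "\<dots> \<le> L' * norm (x - y)" using that(2) by (rule mult_right_mono) simp
      finally show "\<bar>partial_deriv (fst p) (\<lambda>x. d2 f x $ snd p) x - partial_deriv (fst p) (\<lambda>x. d2 f x $ snd p) y\<bar>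
          \<le> L' * norm (x - y)" .
    qed
  qed
  then obtain L where pos: "L > 0" and "\<And>p. lip p L" by blast
  then have L': "\<bar>partial_deriv k (\<lambda>x. d2 f x $ j) x - partial_deriv k (\<lambda>x. d2 f x $ j) y\<bar> \<le> L * norm (x - y)"
    if "x \<in> cball 0 (r + 1)" "y \<in> cball 0 (r + 1)" for k j x y
    using that unfolding lip_def by (metis fst_conv snd_conv)
  have "norm (mean s x - d2 f x) \<le> 6 * L * s\<^sup>2"
    if s: "0 < s" "s \<le> 1" and x: "x \<in> cball 0 r" for s x
  proof -
    have "\<bar>(mean s x - d2 f x) $ j\<bar> \<le> 2 * L * s\<^sup>2" for j
    proof -
      let ?u = "\<lambda>z. d2 f (x + s *\<^sub>R z) $ j + d2 f (x - s *\<^sub>R z) $ j - 2 * d2 f x $ j"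
      have int: "integrable lborel (\<lambda>z. K z * ?u z)"
        using smooth_integrable K_integrable by (simp add: distrib_left right_diff_distrib)
      have "mean s x $ j = (\<integral>z. K (- z) * d2 f (x - s *\<^sub>R (- z)) $ j \<partial>lborel)"
        unfolding mean_nth[OF s(1)]
        using smooth_integrable(2)[THEN borel_measurable_integrable]
        by (subst integral_affine_plane[of _ "- 1" 0]) auto
      then have "mean s x $ j = (\<integral>z. K z * d2 f (x + s *\<^sub>R z) $ j \<partial>lborel)" by (simp add: K_sym)
      then have "2 * (mean s x - d2 f x) $ j = (\<integral>z. K z * ?u z \<partial>lborel)"
        using s smooth_integrable K_integrable mean_nth[OF s(1), of x j]
        by (simp add: distrib_left right_diff_distrib K_integral)
      also have "\<bar>\<dots>\<bar> \<le> 4 * L * s\<^sup>2"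
      proof (rule kernel_average_le[OF int])
        fix z :: "real^2" assume z: "norm z \<le> 1"
        then have n: "norm (s *\<^sub>R z) \<le> 1" "norm (s *\<^sub>R z) \<le> s" using s by (auto simp: mult_le_one mult_left_le)
        have "\<bar>?u z\<bar> \<le> 4 * L * (norm (s *\<^sub>R z))\<^sup>2"
          using n x pos L' by (intro second_difference_bound[where r = "r + 1"]) (auto simp: d2_nth f_diff)
        also have "\<dots> \<le> 4 * L * s\<^sup>2" using n pos by (intro mult_left_mono power_mono) auto
        finally show "\<bar>?u z\<bar> \<le> 4 * L * s\<^sup>2" .
      qed
      finally show ?thesis by simp
    qed
    from norm_le_componentwise[OF this] show ?thesis by simp
  qed
  then show ?thesis using pos by (intro exI[of _ "6 * L"]) auto
qed

text \<open>A ball of radius \<open>s\<close> carries probability of order \<open>s\<^sup>2\<close> only. All second moments gain their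
  factor \<open>h\<^sup>2\<close> from this.\<close>

lemma local_moment: "\<exists>F>0. \<forall>s x b \<phi>. 0 < s \<longrightarrow> s \<le> 1 \<longrightarrow> x \<in> cball 0 r \<longrightarrow> \<phi> \<in> borel_measurable borel \<longrightarrow>
    (\<forall>y. 0 \<le> \<phi> y \<and> \<phi> y \<le> b * indicator (cball x s) y) \<longrightarrow> (\<integral>y. f y * \<phi> y \<partial>lborel) \<le> F * b * s\<^sup>2"
proof -
  have "bounded (f ` cball 0 (r + 1))"
    by (intro compact_imp_bounded compact_continuous_image continuous_on_subset[OF f_cont(1)]) auto
  then obtain F where F: "F > 0" "\<And>y. norm y \<le> r + 1 \<Longrightarrow> \<bar>f y\<bar> \<le> F"
    unfolding bounded_pos by auto
  define \<kappa> where "\<kappa> = measure lborel (cball (0::real^2) 1)"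
  have \<kappa>: "\<kappa> > 0" by (simp add: \<kappa>_def content_cball)
  have "(\<integral>y. f y * \<phi> y \<partial>lborel) \<le> F * \<kappa> * b * s\<^sup>2"
    if s: "0 < s" "s \<le> 1" and x: "x \<in> cball 0 r" and [measurable]: "\<phi> \<in> borel_measurable borel"
      and \<phi>: "\<And>y. 0 \<le> \<phi> y" "\<And>y. \<phi> y \<le> b * indicator (cball x s) y" for s x b \<phi>
  proof -
    have b: "0 \<le> b" using order_trans[OF \<phi>, of x] s by simp
    have "\<bar>\<phi> y\<bar> \<le> b" for y using \<phi>[of y] b by (cases "y \<in> cball x s") auto
    then have int: "integrable lborel (\<lambda>y. f y * \<phi> y)" by (intro integrable_density_mult) auto
    have ii: "integrable lborel (indicator (cball x s) :: real^2 \<Rightarrow> real)"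
      by (auto intro!: integrable_real_indicator emeasure_bounded_finite simp: less_top[symmetric])
    have "(\<integral>y. f y * \<phi> y \<partial>lborel) \<le> (\<integral>y. (F * b) * indicator (cball x s) y \<partial>lborel)"
    proof (rule integral_mono[OF int])
      fix y
      show "f y * \<phi> y \<le> (F * b) * indicator (cball x s) y"
      proof (cases "y \<in> cball x s")
        case True
        then have "norm y \<le> r + 1"
          using x s norm_triangle_ineq2[of y x] by (auto simp: dist_norm norm_minus_commute)
        then show ?thesis using F(2)[of y] \<phi>[of y] f_nonneg[of y] True b F(1) by (auto intro!: mult_mono)
      qed (use \<phi>[of y] in auto)
    qed (use ii in simp)
    also have "\<dots> = F * b * measure lborel (cball x s)" by simp
    also have "measure lborel (cball x s) = \<kappa> * s\<^sup>2"
      using s by (simp add: \<kappa>_def content_cball)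
    finally show ?thesis by (simp add: mult_ac)
  qed
  then show ?thesis using F \<kappa> by (intro exI[of _ "F * \<kappa>"]) auto
qed

end

section \<open>Uniform bounds with high probability\<close>

locale kde_rate = kde_sample M X f K for M :: "'a measure" and X f K +
  fixes h :: "nat \<Rightarrow> real" and \<beta> :: real
  assumes h_pos: "\<And>n. h n > 0" and h_lim: "h \<longlonglongrightarrow> 0"
    and nh8: "filterlim (\<lambda>n. real n * h n ^ 8 / (ln (real n)) ^ 3) at_top sequentially"
    and nh9: "(\<lambda>n. real n * h n ^ 9) \<longlonglongrightarrow> \<beta>"
begin

abbreviation dhat :: "nat \<Rightarrow> 'a \<Rightarrow> real^2 \<Rightarrow> real^3" where
  "dhat n \<omega> \<equiv> d2 (kde K h X n \<omega>)"

definition rate :: "nat \<Rightarrow> real" where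
  "rate n = sqrt (ln (real n) / (real n * h n ^ 5))"

text \<open>The order of the uniform stochastic error of the second derivatives. It exceeds \<open>rate\<close> by a factor
  \<open>1 / sqrt h\<close>, the gain from integration along a curve.\<close>

definition sup_rate :: "nat \<Rightarrow> real" where
  "sup_rate n = sqrt (ln (real n) / (real n * h n ^ 6))"

lemma eventually_ln_ge: "\<forall>\<^sub>F n in sequentially. c \<le> ln (real n)"
  using filterlim_compose[OF ln_at_top filterlim_real_sequentially] by (simp add: filterlim_at_top)

lemma eventually_h_le_1: "\<forall>\<^sub>F n in sequentially. h n \<le> 1"
  using order_tendstoD(2)[OF h_lim, of 1] by (auto elim: eventually_mono)

lemma eventually_nh8: "\<forall>\<^sub>F n in sequentially. c * ln (real n) \<le> real n * h n ^ 8"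
proof -
  have "\<forall>\<^sub>F n in sequentially. \<bar>c\<bar> \<le> real n * h n ^ 8 / (ln (real n)) ^ 3"
    using nh8 by (simp add: filterlim_at_top)
  then show ?thesis using eventually_ln_ge[of 1]
  proof eventually_elim
    case (elim n)
    have "c * ln (real n) \<le> \<bar>c\<bar> * ln (real n) ^ 3"
      using elim self_le_power[of "ln (real n)" 3] by (intro mult_mono) auto
    also have "\<dots> \<le> real n * h n ^ 8" using elim by (simp add: pos_le_divide_eq)
    finally show ?case .
  qed
qed

lemma h_power_le: "h n \<le> 1 \<Longrightarrow> j \<le> k \<Longrightarrow> 1 / h n ^ j \<le> 1 / h n ^ k"
  using h_pos[of n] by (intro divide_left_mono power_decreasing) auto

text \<open>In particular the crude Lipschitz constant \<open>G / h ^ 5\<close> of the estimated second derivatives is of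
  order \<open>n\<close>, which fixes the mesh of the nets.\<close>

lemma eventually_h_inverse: "\<forall>\<^sub>F n in sequentially. \<forall>k\<le>8. 1 / h n ^ k \<le> real n"
  using eventually_nh8[of 1] eventually_ln_ge[of 1] eventually_h_le_1
proof eventually_elim
  case (elim n)
  have "1 / h n ^ 8 \<le> real n" using elim h_pos[of n] by (simp add: field_simps)
  then show ?case using h_power_le[of n _ 8] elim by (meson order_trans)
qed

lemma rate_nonneg: "n \<ge> 1 \<Longrightarrow> 0 \<le> rate n" and sup_rate_nonneg: "n \<ge> 1 \<Longrightarrow> 0 \<le> sup_rate n"
  using h_pos[of n] by (auto simp: rate_def sup_rate_def intro!: divide_nonneg_nonneg mult_nonneg_nonneg)

lemma rate_sq: "n \<ge> 1 \<Longrightarrow> (rate n)\<^sup>2 = ln (real n) / (real n * h n ^ 5)"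
  and sup_rate_sq: "n \<ge> 1 \<Longrightarrow> (sup_rate n)\<^sup>2 = ln (real n) / (real n * h n ^ 6)"
  using h_pos[of n] by (auto simp: rate_def sup_rate_def intro!: divide_nonneg_nonneg mult_nonneg_nonneg)

lemma eventually_rate_le: assumes "\<delta> > 0" shows "\<forall>\<^sub>F n in sequentially. rate n \<le> \<delta>"
  using eventually_nh8[of "1 / \<delta>\<^sup>2"] eventually_h_le_1 eventually_ge_at_top[of 1]
proof eventually_elim
  case (elim n)
  have "ln (real n) \<le> \<delta>\<^sup>2 * (real n * h n ^ 8)" using elim assms by (simp add: field_simps)
  also have "\<dots> \<le> \<delta>\<^sup>2 * (real n * h n ^ 5)"
    using elim h_pos[of n] by (intro mult_left_mono power_decreasing) auto
  finally have "ln (real n) \<le> \<delta>\<^sup>2 * (real n * h n ^ 5)" .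
  moreover have "0 < real n * h n ^ 5" using elim h_pos[of n] by simp
  ultimately have "ln (real n) / (real n * h n ^ 5) \<le> \<delta>\<^sup>2" by (simp only: pos_divide_le_eq)
  then have "(rate n)\<^sup>2 \<le> \<delta>\<^sup>2" unfolding rate_sq[OF elim(3)] .
  then show ?case using less_imp_le[OF assms] by (rule power2_le_imp_le)
qed

lemma eventually_inverse_le_rate: "\<forall>\<^sub>F n in sequentially. 1 / real n \<le> rate n"
  using eventually_ln_ge[of 1] eventually_h_le_1 eventually_ge_at_top[of 1]
proof eventually_elim
  case (elim n)
  have "h n ^ 5 \<le> 1" using elim h_pos[of n] by (intro power_le_one) auto
  then have "h n ^ 5 * 1 \<le> real n * ln (real n)" using elim by (intro mult_mono) auto
  then have "(1 / real n)\<^sup>2 \<le> ln (real n) / (real n * h n ^ 5)"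
    using elim h_pos[of n] by (simp add: field_simps power2_eq_square)
  then have "(1 / real n)\<^sup>2 \<le> (rate n)\<^sup>2" unfolding rate_sq[OF elim(3)] .
  then show ?case using rate_nonneg[OF elim(3)] by (rule power2_le_imp_le)
qed

lemma eventually_h_sq_le_rate: "\<exists>C>0. \<forall>\<^sub>F n in sequentially. (h n)\<^sup>2 \<le> C * rate n"
proof (intro exI conjI)
  show "sqrt (\<bar>\<beta>\<bar> + 1) > 0" by simp
  have "\<forall>\<^sub>F n in sequentially. real n * h n ^ 9 < \<bar>\<beta>\<bar> + 1" using nh9 by (rule order_tendstoD) simp
  then show "\<forall>\<^sub>F n in sequentially. (h n)\<^sup>2 \<le> sqrt (\<bar>\<beta>\<bar> + 1) * rate n"
    using eventually_ln_ge[of 1] eventually_ge_at_top[of 1]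
  proof eventually_elim
    case (elim n)
    have "real n * h n ^ 9 * 1 \<le> (\<bar>\<beta>\<bar> + 1) * ln (real n)" using elim h_pos[of n] by (intro mult_mono) auto
    moreover have "h n ^ 4 * h n ^ 5 = h n ^ 9" by (simp flip: power_add)
    ultimately have "h n ^ 4 * (real n * h n ^ 5) \<le> (\<bar>\<beta>\<bar> + 1) * ln (real n)"
      by (metis mult.assoc mult.commute mult.right_neutral)
    moreover have "0 < real n * h n ^ 5" using elim h_pos[of n] by simp
    ultimately have "h n ^ 4 \<le> (\<bar>\<beta>\<bar> + 1) * ln (real n) / (real n * h n ^ 5)"
      by (simp only: pos_le_divide_eq)
    moreover have "(sqrt (\<bar>\<beta>\<bar> + 1) * rate n)\<^sup>2 = (\<bar>\<beta>\<bar> + 1) * ln (real n) / (real n * h n ^ 5)"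
      unfolding power_mult_distrib rate_sq[OF elim(3)] by simp
    moreover have "((h n)\<^sup>2)\<^sup>2 = h n ^ 4" by (simp flip: power_mult)
    ultimately have "((h n)\<^sup>2)\<^sup>2 \<le> (sqrt (\<bar>\<beta>\<bar> + 1) * rate n)\<^sup>2" by simp
    moreover have "0 \<le> sqrt (\<bar>\<beta>\<bar> + 1) * rate n" using rate_nonneg[OF elim(3)] by simp
    ultimately show ?case by (rule power2_le_imp_le)
  qed
qed

text \<open>The claim amounts to \<open>ln n \<le> n * h ^ 7\<close>.\<close>

lemma eventually_sup_rate_sq: "\<forall>\<^sub>F n in sequentially. (sup_rate n)\<^sup>2 \<le> rate n"
  using eventually_nh8[of 1] eventually_h_le_1 eventually_ge_at_top[of 1]
proof eventually_elim
  case (elim n)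
  let ?a = "ln (real n)" and ?x = "h n"
  have x: "?x > 0" by (rule h_pos)
  have a: "0 \<le> ?a" using elim by simp
  have "?a \<le> real n * ?x ^ 8" using elim by simp
  also have "\<dots> \<le> real n * ?x ^ 7" using elim x by (intro mult_left_mono power_decreasing) auto
  finally have "?a * (?a * (real n * ?x ^ 5)) \<le> (real n * ?x ^ 7) * (?a * (real n * ?x ^ 5))"
    using a x by (intro mult_right_mono) auto
  moreover have "(real n * ?x ^ 7) * (real n * ?x ^ 5) = (real n * ?x ^ 6)\<^sup>2"
    by (simp add: power2_eq_square flip: power_add)
  ultimately have "?a\<^sup>2 * (real n * ?x ^ 5) \<le> ?a * (real n * ?x ^ 6)\<^sup>2"
    by (metis mult.assoc mult.commute power2_eq_square)
  moreover have "0 < real n * ?x ^ 5" "0 < (real n * ?x ^ 6)\<^sup>2" using elim x by auto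
  ultimately have "?a\<^sup>2 / (real n * ?x ^ 6)\<^sup>2 \<le> ?a / (real n * ?x ^ 5)"
    by (simp only: pos_le_divide_eq pos_divide_le_eq times_divide_eq_left)
  then have "((sup_rate n)\<^sup>2)\<^sup>2 \<le> (rate n)\<^sup>2"
    unfolding rate_sq[OF elim(3)] sup_rate_sq[OF elim(3)] power_divide .
  then show ?case using rate_nonneg[OF elim(3)] by (rule power2_le_imp_le)
qed

lemma dhat_lipschitz:
  assumes "n \<ge> 1" shows "norm (dhat n \<omega> x - dhat n \<omega> y) \<le> G / h n ^ 5 * norm (x - y)"
proof -
  have "norm (dhat n \<omega> x - dhat n \<omega> y)
      = norm (\<Sum>i=1..n. kern (h n) x (X i \<omega>) - kern (h n) y (X i \<omega>)) / real n"
    using assms by (simp add: d2_kde_eq sum_subtractf divide_inverse mult.commute flip: scaleR_diff_right)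
  also have "\<dots> \<le> (\<Sum>i=1..n. G / h n ^ 5 * norm (x - y)) / real n"
  proof (intro divide_right_mono sum_norm_le)
    show "norm (kern (h n) x (X i \<omega>) - kern (h n) y (X i \<omega>)) \<le> G / h n ^ 5 * norm (x - y)" for i
      using kern_lipschitz[OF h_pos, of n x "X i \<omega>" y "X i \<omega>"] by simp
  qed simp
  also have "\<dots> = G / h n ^ 5 * norm (x - y)" using assms by simp
  finally show ?thesis .
qed

lemma dhat_nth: "dhat n \<omega> x $ j = (\<Sum>i=1..n. kern (h n) x (X i \<omega>) $ j) / real n"
  by (simp add: d2_kde_eq divide_inverse mult.commute)

lemma kern_indicator: "s > 0 \<Longrightarrow> norm (kern s x y) \<le> G / s ^ 4 * indicator (cball x s) y"
  using kern_bound[of s x y] kern_outside[of s x y] by (cases "y \<in> cball x s") (auto simp: dist_norm)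

text \<open>Bernstein's inequality is applied to the difference quotients between all pairs of points of a net.
  They are bounded by a multiple of \<open>1 / h ^ 5\<close> with second moments of order \<open>1 / h ^ 8\<close>, so that
  they deviate from their means by at most 1, and their means are bounded by \<open>mean_lipschitz\<close>.
  Arbitrary points are moved to the net at the cost of the term \<open>L / n\<close>, for which
  the crude Lipschitz constant \<open>G / h ^ 5 \<le> G * n\<close> is good enough.\<close>

lemma whp_dhat_lipschitz:
  "\<exists>L>0. whp M (\<lambda>n \<omega>. \<forall>x\<in>cball 0 r. \<forall>y\<in>cball 0 r.
      norm (dhat n \<omega> x - dhat n \<omega> y) \<le> L * norm (x - y) + L / real n)"
proof -
  obtain C N where C: "C > 0" and net: "\<forall>n\<ge>1. N n \<subseteq> cball (0::real^2) r \<and> finite (N n) \<and>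
     real (card (N n)) \<le> C * real n ^ 4 \<and> (\<forall>x\<in>cball 0 r. \<exists>y\<in>N n. norm (x - y) \<le> 1 / (real n)\<^sup>2)"
    using net_sequence[OF bounded_cball[of "0::real^2" r]] by (simp del: mem_cball) blast
  have N: "N n \<subseteq> cball (0::real^2) r" "finite (N n)" "real (card (N n)) \<le> C * real n ^ 4"
    "\<And>x. x \<in> cball 0 r \<Longrightarrow> \<exists>y\<in>N n. norm (x - y) \<le> 1 / (real n)\<^sup>2" if "n \<ge> 1" for n
    using net that by blast+
  obtain F where F: "F > 0" "\<forall>s x b \<phi>. 0 < s \<longrightarrow> s \<le> 1 \<longrightarrow> x \<in> cball 0 r \<longrightarrow> \<phi> \<in> borel_measurable borel \<longrightarrow>
    (\<forall>y. 0 \<le> \<phi> y \<and> \<phi> y \<le> b * indicator (cball x s) y) \<longrightarrow> (\<integral>y. f y * \<phi> y \<partial>lborel) \<le> F * b * s\<^sup>2"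
    by (rule local_moment[of r, THEN exE]) blast
  obtain L where L: "L > 0" "\<forall>s x y. 0 < s \<longrightarrow> s \<le> 1 \<longrightarrow> x \<in> cball 0 r \<longrightarrow> y \<in> cball 0 r \<longrightarrow>
    norm (mean s x - mean s y) \<le> L * norm (x - y)"
    by (rule mean_lipschitz[of r, THEN exE]) blast
  \<comment> \<open>The summand \<open>G\<close> makes the bound on the quotients at most \<open>2 * V / h ^ 8\<close>, as \<open>whp_sample_means\<close> demands for a deviation of size 1.\<close>
  define V where "V = 2 * F * G\<^sup>2 + G"
  have V: "V > 0" "G \<le> V" using F G(1) by (auto simp: V_def intro!: add_pos_pos)
  define J where "J n = {p \<in> N n \<times> N n \<times> (UNIV :: 3 set). fst p \<noteq> fst (snd p)}" for n
  define \<phi> where "\<phi> n p u = (case p of (x, y, j) \<Rightarrow>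
     (kern (h n) x u $ j - kern (h n) y u $ j) / norm (x - y))" for n p u
  have bound: "\<bar>\<phi> n (x, y, j) u\<bar> \<le> G / h n ^ 5 * (indicator (cball x (h n)) u + indicator (cball y (h n)) u)"
    if "x \<noteq> y" for n x y j u
  proof (cases "u \<in> cball x (h n) \<or> u \<in> cball y (h n)")
    case True
    have "\<bar>kern (h n) x u $ j - kern (h n) y u $ j\<bar> \<le> G / h n ^ 5 * norm (x - y)"
      using component_le_norm_cart[of "kern (h n) x u - kern (h n) y u" j]
        kern_lipschitz[OF h_pos[of n], of x u y u] by simp
    moreover have "0 < norm (x - y)" using that by simp
    ultimately have "\<bar>kern (h n) x u $ j - kern (h n) y u $ j\<bar> / norm (x - y) \<le> G / h n ^ 5 * 1"
      by (simp only: pos_divide_le_eq mult_1_right)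
    then have "\<bar>\<phi> n (x, y, j) u\<bar> \<le> G / h n ^ 5 * 1" by (simp add: \<phi>_def)
    also have "\<dots> \<le> G / h n ^ 5 * (indicator (cball x (h n)) u + indicator (cball y (h n)) u)"
      using True h_pos[of n] G(1) by (intro mult_left_mono) (auto simp: indicator_def)
    finally show ?thesis .
  next
    case False
    then have "kern (h n) x u = 0" "kern (h n) y u = 0"
      using h_pos[of n] by (auto intro!: kern_outside simp: dist_norm)
    then show ?thesis using False by (simp add: \<phi>_def)
  qed
  have meas[measurable]: "\<phi> n p \<in> borel_measurable borel" for n p
    unfolding \<phi>_def by (cases p) simp
  have "whp M (\<lambda>n \<omega>. \<forall>p\<in>J n. \<bar>(\<Sum>i=1..n. \<phi> n p (X i \<omega>)) / real n - (\<integral>y. f y * \<phi> n p y \<partial>lborel)\<bar> \<le> 1)"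
  proof (rule whp_sample_means[where k = 8 and C = "3 * C\<^sup>2" and b = "\<lambda>n. 2 * G / h n ^ 5" and v = "\<lambda>n. 2 * V / h n ^ 8"])
    show "\<forall>\<^sub>F n in sequentially. finite (J n) \<and> real (card (J n)) \<le> 3 * C\<^sup>2 * real n ^ 8"
      using eventually_ge_at_top[of 1]
    proof eventually_elim
      case (elim n)
      have fin: "finite (N n \<times> N n \<times> (UNIV :: 3 set))" using N(2)[OF elim] by simp
      have "card (J n) \<le> card (N n \<times> N n \<times> (UNIV :: 3 set))"
        by (rule card_mono[OF fin]) (auto simp: J_def)
      then have "real (card (J n)) \<le> real (card (N n)) * real (card (N n)) * 3"
        by (simp add: card_cartesian_product flip: of_nat_mult) (simp only: of_nat_le_iff of_nat_mult[symmetric] mult.assoc)?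
      also have "\<dots> \<le> (C * real n ^ 4) * (C * real n ^ 4) * 3"
        using N(3)[OF elim] C by (intro mult_right_mono mult_mono) auto
      also have "\<dots> = 3 * C\<^sup>2 * real n ^ 8" by (simp add: power2_eq_square flip: power_add)
      finally show ?case using finite_subset[OF _ fin, of "J n"] by (auto simp: J_def)
    qed
    show "\<forall>\<^sub>F n in sequentially. \<forall>p\<in>J n. \<phi> n p \<in> borel_measurable borel" by simp
    show "\<forall>\<^sub>F n in sequentially. \<forall>p\<in>J n. \<forall>u. \<bar>\<phi> n p u\<bar> \<le> 2 * G / h n ^ 5"
    proof (intro always_eventually allI ballI)
      fix n p u assume "p \<in> J n"
      then obtain x y j where p: "p = (x, y, j)" "x \<noteq> y" by (auto simp: J_def)
      have "\<bar>\<phi> n p u\<bar> \<le> G / h n ^ 5 * 2"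
        unfolding p(1) using h_pos[of n] G(1)
        by (intro order_trans[OF bound[OF p(2)]] mult_left_mono) (auto simp: indicator_def)
      then show "\<bar>\<phi> n p u\<bar> \<le> 2 * G / h n ^ 5" by (simp add: mult.commute)
    qed
    show "\<forall>\<^sub>F n in sequentially. \<forall>p\<in>J n. (\<integral>u. f u * (\<phi> n p u)\<^sup>2 \<partial>lborel) \<le> 2 * V / h n ^ 8"
      using eventually_ge_at_top[of 1] eventually_h_le_1
    proof eventually_elim
      case (elim n)
      show ?case
      proof
        fix p assume "p \<in> J n"
        then obtain x y j where p: "p = (x, y, j)" "x \<noteq> y" and "x \<in> N n" "y \<in> N n"
          by (auto simp: J_def)
        then have xy: "x \<in> cball 0 r" "y \<in> cball 0 r" using N(1)[OF elim(1)] by blast+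
        let ?b = "2 * (G / h n ^ 5)\<^sup>2"
        let ?i = "\<lambda>z u. ?b * indicator (cball z (h n)) u"
        have i: "(\<integral>u. f u * ?i z u \<partial>lborel) \<le> F * ?b * (h n)\<^sup>2" if "z \<in> cball 0 r" for z
          by (rule F(2)[rule_format]) (use elim h_pos that in \<open>auto intro!: borel_measurable_times borel_measurable_indicator\<close>)
        have int: "integrable lborel (\<lambda>u. f u * ?i z u)" for z
          by (rule integrable_density_mult[of _ ?b])
            (auto intro!: borel_measurable_times borel_measurable_indicator simp: indicator_le_1 mult_left_le)
        have le: "(\<phi> n p u)\<^sup>2 \<le> ?i x u + ?i y u" for u
        proof -
          have "(\<phi> n p u)\<^sup>2 \<le> (G / h n ^ 5 * (indicator (cball x (h n)) u + indicator (cball y (h n)) u))\<^sup>2"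
            unfolding p(1) using power_mono[OF bound[OF p(2)] abs_ge_zero, of _ _ _ 2] by simp
          also have "\<dots> \<le> ?i x u + ?i y u"
          proof -
            have *: "(c * (i + j))\<^sup>2 \<le> 2 * c\<^sup>2 * i + 2 * c\<^sup>2 * j" if "i \<in> {0, 1}" "j \<in> {0, 1}" for c i j :: real
              using that by (auto simp: power_mult_distrib)
            show ?thesis by (rule *) (simp_all add: indicator_def)
          qed
          finally show ?thesis .
        qed
        have "(\<integral>u. f u * (\<phi> n p u)\<^sup>2 \<partial>lborel) \<le> (\<integral>u. f u * ?i x u + f u * ?i y u \<partial>lborel)"
        proof (rule integral_mono)
          have "(\<phi> n p u)\<^sup>2 \<le> 2 * ?b" for u
            by (rule order_trans[OF le]) (auto simp: indicator_def)
          then show "integrable lborel (\<lambda>u. f u * (\<phi> n p u)\<^sup>2)"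
            by (intro integrable_density_mult[of _ "2 * ?b"]) auto
          show "f u * (\<phi> n p u)\<^sup>2 \<le> f u * ?i x u + f u * ?i y u" for u
            using mult_left_mono[OF le[of u] f_nonneg[of u]] by (simp add: distrib_left)
        qed (use int in auto)
        also have "\<dots> \<le> 2 * (F * ?b * (h n)\<^sup>2)"
          using int i[OF xy(1)] i[OF xy(2)] by simp
        also have "\<dots> = 2 * (2 * F * G\<^sup>2) / h n ^ 8"
        proof -
          have "h n ^ 10 = h n ^ 8 * (h n)\<^sup>2" by (simp flip: power_add)
          then show ?thesis using h_pos[of n] by (simp add: power_divide field_simps flip: power_mult)
        qed
        also have "\<dots> \<le> 2 * V / h n ^ 8"
          using h_pos[of n] G(1) by (intro divide_right_mono) (auto simp: V_def)
        finally show "(\<integral>u. f u * (\<phi> n p u)\<^sup>2 \<partial>lborel) \<le> 2 * V / h n ^ 8" .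
      qed
    qed
    show "\<forall>\<^sub>F n in sequentially. 0 < 2 * V / h n ^ 8 \<and> 0 \<le> (1::real) \<and> 1 * (2 * G / h n ^ 5) \<le> 2 * V / h n ^ 8 \<and>
       real (8 + 1) * ln (real n) \<le> real n * 1\<^sup>2 / (4 * (2 * V / h n ^ 8))"
      using eventually_nh8[of "9 * (8 * V)"] eventually_h_le_1
    proof eventually_elim
      case (elim n)
      have "G * (1 / h n ^ 5) \<le> V * (1 / h n ^ 8)"
        using h_power_le[of n 5 8] elim V h_pos[of n] by (intro mult_mono) auto
      moreover have "9 * ln (real n) \<le> real n * h n ^ 8 / (8 * V)"
        using elim V by (simp add: pos_le_divide_eq mult_ac)
      ultimately show ?case using V h_pos[of n] by simp
    qed
  qed
  moreover have "\<forall>\<^sub>F n in sequentially. \<forall>\<omega>\<in>space M.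
      (\<forall>p\<in>J n. \<bar>(\<Sum>i=1..n. \<phi> n p (X i \<omega>)) / real n - (\<integral>y. f y * \<phi> n p y \<partial>lborel)\<bar> \<le> 1) \<longrightarrow>
      (\<forall>x\<in>cball 0 r. \<forall>y\<in>cball 0 r. norm (dhat n \<omega> x - dhat n \<omega> y)
         \<le> (2 * G + 2 * (3 + L)) * norm (x - y) + (2 * G + 2 * (3 + L)) / real n)"
    using eventually_ge_at_top[of 1] eventually_h_le_1 eventually_h_inverse
  proof eventually_elim
    case (elim n)
    note n = elim(1)
    show ?case
    proof (intro ballI impI)
      fix \<omega> x y assume ev: "\<forall>p\<in>J n. \<bar>(\<Sum>i=1..n. \<phi> n p (X i \<omega>)) / real n - (\<integral>y. f y * \<phi> n p y \<partial>lborel)\<bar> \<le> 1"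
        and xy: "x \<in> cball (0::real^2) r" "y \<in> cball (0::real^2) r"
      obtain x' y' where x': "x' \<in> N n" "norm (x - x') \<le> 1 / (real n)\<^sup>2" and y': "y' \<in> N n" "norm (y - y') \<le> 1 / (real n)\<^sup>2"
        using N(4)[OF n] xy by blast
      have near: "norm (dhat n \<omega> z - dhat n \<omega> z') \<le> G / real n" if "norm (z - z') \<le> 1 / (real n)\<^sup>2" for z z'
      proof -
        have "norm (dhat n \<omega> z - dhat n \<omega> z') \<le> G * (1 / h n ^ 5) * norm (z - z')"
          using dhat_lipschitz[OF n, of \<omega> z z'] by simp
        also have "\<dots> \<le> G * real n * (1 / (real n)\<^sup>2)"
          using elim(3) that G(1) h_pos[of n] by (intro mult_mono) auto
        also have "\<dots> = G / real n" using n by (simp add: power2_eq_square)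
        finally show ?thesis .
      qed
      have mid: "norm (dhat n \<omega> x' - dhat n \<omega> y') \<le> (3 + L) * norm (x' - y')"
      proof (cases "x' = y'")
        case False
        have m: "x' \<in> cball 0 r" "y' \<in> cball 0 r" using N(1)[OF n] x' y' by auto
        have "\<bar>((dhat n \<omega> x' - mean (h n) x') - (dhat n \<omega> y' - mean (h n) y')) $ j\<bar> \<le> norm (x' - y')" for j
        proof -
          have "(\<integral>u. f u * \<phi> n (x', y', j) u \<partial>lborel)
              = (\<integral>u. (f u * kern (h n) x' u $ j - f u * kern (h n) y' u $ j) / norm (x' - y') \<partial>lborel)"
            by (simp add: \<phi>_def right_diff_distrib)
          also have "\<dots> = (mean (h n) x' $ j - mean (h n) y' $ j) / norm (x' - y')"
          proof -
            have "integrable lborel (\<lambda>u. f u * kern (h n) z u $ j)" for z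
              using order_trans[OF component_le_norm_cart kern_bound[OF h_pos]]
              by (intro integrable_density_mult[of _ "G / h n ^ 4"]) auto
            then show ?thesis by (simp add: mean_def)
          qed
          finally have e: "(\<integral>u. f u * \<phi> n (x', y', j) u \<partial>lborel)
             = (mean (h n) x' $ j - mean (h n) y' $ j) / norm (x' - y')" .
          have e2: "(\<Sum>i=1..n. \<phi> n (x', y', j) (X i \<omega>)) / real n
             = (dhat n \<omega> x' $ j - dhat n \<omega> y' $ j) / norm (x' - y')"
          proof -
            have "(\<Sum>i=1..n. \<phi> n (x', y', j) (X i \<omega>))
              = ((\<Sum>i=1..n. kern (h n) x' (X i \<omega>) $ j) - (\<Sum>i=1..n. kern (h n) y' (X i \<omega>) $ j)) / norm (x' - y')"
              unfolding \<phi>_def prod.case sum_subtractf[symmetric] by (rule sum_divide_distrib[symmetric])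
            then show ?thesis by (simp only: dhat_nth diff_divide_distrib[symmetric] divide_divide_eq_left mult.commute)
          qed
          have "(x', y', j) \<in> J n" using False x' y' by (simp add: J_def)
          from bspec[OF ev this] have "\<bar>(dhat n \<omega> x' $ j - dhat n \<omega> y' $ j) / norm (x' - y')
              - (mean (h n) x' $ j - mean (h n) y' $ j) / norm (x' - y')\<bar> \<le> 1"
            unfolding e e2 .
          then have "\<bar>((dhat n \<omega> x' $ j - dhat n \<omega> y' $ j) - (mean (h n) x' $ j - mean (h n) y' $ j)) / norm (x' - y')\<bar> \<le> 1"
            by (simp only: diff_divide_distrib)
          then have "\<bar>(dhat n \<omega> x' $ j - dhat n \<omega> y' $ j) - (mean (h n) x' $ j - mean (h n) y' $ j)\<bar> / norm (x' - y') \<le> 1"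
            by (simp only: abs_divide abs_norm_cancel)
          moreover have "0 < norm (x' - y')" using False by simp
          ultimately have "\<bar>(dhat n \<omega> x' $ j - dhat n \<omega> y' $ j) - (mean (h n) x' $ j - mean (h n) y' $ j)\<bar> \<le> norm (x' - y')"
            by (simp only: pos_divide_le_eq mult_1_left)
          moreover have "((dhat n \<omega> x' - mean (h n) x') - (dhat n \<omega> y' - mean (h n) y')) $ j
             = (dhat n \<omega> x' $ j - dhat n \<omega> y' $ j) - (mean (h n) x' $ j - mean (h n) y' $ j)" by simp
          ultimately show ?thesis by simp
        qed
        from norm_le_componentwise[OF this]
        have "norm ((dhat n \<omega> x' - mean (h n) x') - (dhat n \<omega> y' - mean (h n) y')) \<le> 3 * norm (x' - y')" by simp
        moreover have "dhat n \<omega> x' - dhat n \<omega> y' = ((dhat n \<omega> x' - mean (h n) x') - (dhat n \<omega> y' - mean (h n) y'))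
            + (mean (h n) x' - mean (h n) y')" by simp
        moreover have "norm (mean (h n) x' - mean (h n) y') \<le> L * norm (x' - y')"
          by (rule L(2)[rule_format]) (use h_pos elim m in auto)
        ultimately show ?thesis using norm_triangle_ineq[of "(dhat n \<omega> x' - mean (h n) x') - (dhat n \<omega> y' - mean (h n) y')"
             "mean (h n) x' - mean (h n) y'"] by (simp add: distrib_right)
      qed simp
      have sq: "1 / (real n)\<^sup>2 \<le> 1 / real n" using n by (simp add: field_simps power2_eq_square)
      have "norm (x' - y') \<le> norm (x - y) + 2 / real n"
      proof -
        have "norm (x' - y') = norm ((x - y) - (x - x') + (y - y'))" by (simp add: algebra_simps)
        also have "\<dots> \<le> norm (x - y) + norm (x - x') + norm (y - y')"
          using norm_triangle_ineq[of "(x - y) - (x - x')" "y - y'"] norm_triangle_ineq4[of "x - y" "x - x'"] by linarith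
        finally show ?thesis using x' y' sq by linarith
      qed
      then have "(3 + L) * norm (x' - y') \<le> (3 + L) * (norm (x - y) + 2 / real n)" using L by (intro mult_left_mono) auto
      moreover have "norm (dhat n \<omega> x - dhat n \<omega> y) \<le> norm (dhat n \<omega> x - dhat n \<omega> x')
          + norm (dhat n \<omega> x' - dhat n \<omega> y') + norm (dhat n \<omega> y - dhat n \<omega> y')"
        by (rule norm_diff_chain)
      ultimately have "norm (dhat n \<omega> x - dhat n \<omega> y) \<le> 2 * (G / real n) + (3 + L) * (norm (x - y) + 2 / real n)"
        using near[OF x'(2)] near[OF y'(2)] mid by linarith
      also have "\<dots> = (3 + L) * norm (x - y) + (2 * G + 2 * (3 + L)) / real n"
        using n by (simp add: field_simps)
      also have "(3 + L) * norm (x - y) \<le> (2 * G + 2 * (3 + L)) * norm (x - y)"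
        using G(1) L by (intro mult_right_mono) auto
      finally show "norm (dhat n \<omega> x - dhat n \<omega> y)
         \<le> (2 * G + 2 * (3 + L)) * norm (x - y) + (2 * G + 2 * (3 + L)) / real n" by simp
    qed
  qed
  ultimately have "whp M (\<lambda>n \<omega>. \<forall>x\<in>cball 0 r. \<forall>y\<in>cball 0 r. norm (dhat n \<omega> x - dhat n \<omega> y)
         \<le> (2 * G + 2 * (3 + L)) * norm (x - y) + (2 * G + 2 * (3 + L)) / real n)"
    by (rule whp_mono)
  moreover have "2 * G + 2 * (3 + L) > 0" using G(1) L by simp
  ultimately show ?thesis by blast
qed

end

context kde_rate
begin

text \<open>The stochastic error is controlled on a net by Bernstein's inequality with second moments of order
  \<open>1 / h ^ 6\<close>; the bias is added by \<open>mean_bias\<close>. The square is bounded because the remainder in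
  \<open>G_fun_expansion\<close> is quadratic.\<close>

lemma whp_dhat_deviation:
  "\<exists>C>0. whp M (\<lambda>n \<omega>. \<forall>x\<in>cball 0 r. (norm (dhat n \<omega> x - d2 f x))\<^sup>2 \<le> C * rate n)"
proof -
  obtain C N where C: "C > 0" and net: "\<forall>n\<ge>1. N n \<subseteq> cball (0::real^2) r \<and> finite (N n) \<and>
     real (card (N n)) \<le> C * real n ^ 4 \<and> (\<forall>x\<in>cball 0 r. \<exists>y\<in>N n. norm (x - y) \<le> 1 / (real n)\<^sup>2)"
    using net_sequence[OF bounded_cball[of "0::real^2" r]] by (simp del: mem_cball) blast
  have N: "N n \<subseteq> cball (0::real^2) r" "finite (N n)" "real (card (N n)) \<le> C * real n ^ 4"
    "\<And>x. x \<in> cball 0 r \<Longrightarrow> \<exists>y\<in>N n. norm (x - y) \<le> 1 / (real n)\<^sup>2" if "n \<ge> 1" for n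
    using net that by blast+
  obtain F where F: "F > 0" "\<forall>s x b \<phi>. 0 < s \<longrightarrow> s \<le> 1 \<longrightarrow> x \<in> cball 0 r \<longrightarrow> \<phi> \<in> borel_measurable borel \<longrightarrow>
    (\<forall>y. 0 \<le> \<phi> y \<and> \<phi> y \<le> b * indicator (cball x s) y) \<longrightarrow> (\<integral>y. f y * \<phi> y \<partial>lborel) \<le> F * b * s\<^sup>2"
    by (rule local_moment[of r, THEN exE]) blast
  obtain L where L: "L > 0" "\<forall>s x y. 0 < s \<longrightarrow> s \<le> 1 \<longrightarrow> x \<in> cball 0 r \<longrightarrow> y \<in> cball 0 r \<longrightarrow>
    norm (mean s x - mean s y) \<le> L * norm (x - y)"
    by (rule mean_lipschitz[of r, THEN exE]) blast
  obtain B where B: "B > 0" "\<forall>s x. 0 < s \<longrightarrow> s \<le> 1 \<longrightarrow> x \<in> cball 0 r \<longrightarrow> norm (mean s x - d2 f x) \<le> B * s\<^sup>2"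
    by (rule mean_bias[of r, THEN exE]) blast
  obtain H where H: "H > 0" "\<forall>\<^sub>F n in sequentially. (h n)\<^sup>2 \<le> H * rate n"
    using eventually_h_sq_le_rate by blast
  \<comment> \<open>Second moments are at most \<open>V / h ^ 6\<close>, and \<open>G \<le> V\<close> covers the range condition of \<open>whp_sample_means\<close>.\<close>
  define V where "V = F * G\<^sup>2 + G"
  have V: "V > 0" "G \<le> V" using F G(1) by (auto simp: V_def intro!: add_pos_pos)
  \<comment> \<open>Chosen such that \<open>n * (m * sup_rate n)\<^sup>2 / (4 * (V / h ^ 6)) = 5 * ln n\<close>, the exponent needed for a net of order \<open>n ^ 4\<close> points.\<close>
  define m where "m = sqrt (20 * V)"
  have m: "m > 0" "m\<^sup>2 = 20 * V" using V by (auto simp: m_def)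
  have whp1: "whp M (\<lambda>n \<omega>. \<forall>p\<in>N n \<times> (UNIV :: 3 set).
     \<bar>(\<Sum>i=1..n. kern (h n) (fst p) (X i \<omega>) $ snd p) / real n
        - (\<integral>y. f y * kern (h n) (fst p) y $ snd p \<partial>lborel)\<bar> \<le> m * sup_rate n)"
  proof (rule whp_sample_means[where k = 4 and C = "3 * C" and b = "\<lambda>n. G / h n ^ 4" and v = "\<lambda>n. V / h n ^ 6"])
    show "\<forall>\<^sub>F n in sequentially. finite (N n \<times> (UNIV :: 3 set)) \<and> real (card (N n \<times> (UNIV :: 3 set))) \<le> 3 * C * real n ^ 4"
      using eventually_ge_at_top[of 1]
      by eventually_elim (use N in \<open>simp add: card_cartesian_product mult.commute\<close>)
    show "\<forall>\<^sub>F n in sequentially. \<forall>p\<in>N n \<times> (UNIV :: 3 set). (\<lambda>y. kern (h n) (fst p) y $ snd p) \<in> borel_measurable borel"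
      by simp
    show "\<forall>\<^sub>F n in sequentially. \<forall>p\<in>N n \<times> (UNIV :: 3 set). \<forall>y. \<bar>kern (h n) (fst p) y $ snd p\<bar> \<le> G / h n ^ 4"
      using order_trans[OF component_le_norm_cart kern_bound[OF h_pos]] by simp
    show "\<forall>\<^sub>F n in sequentially. \<forall>p\<in>N n \<times> (UNIV :: 3 set). (\<integral>y. f y * (kern (h n) (fst p) y $ snd p)\<^sup>2 \<partial>lborel) \<le> V / h n ^ 6"
      using eventually_ge_at_top[of 1] eventually_h_le_1
    proof eventually_elim
      case (elim n)
      show ?case
      proof
        fix p assume "p \<in> N n \<times> (UNIV :: 3 set)"
        then obtain x j where p: "p = (x, j)" and "x \<in> N n" by auto
        then have x: "x \<in> cball 0 r" using N(1)[OF elim(1)] by blast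
        have "(\<integral>y. f y * (kern (h n) x y $ j)\<^sup>2 \<partial>lborel) \<le> F * (G / h n ^ 4)\<^sup>2 * (h n)\<^sup>2"
        proof (rule F(2)[rule_format])
          fix y
          have "\<bar>kern (h n) x y $ j\<bar> \<le> G / h n ^ 4 * indicator (cball x (h n)) y"
            using component_le_norm_cart[of "kern (h n) x y" j] kern_indicator[OF h_pos, of n x y] by linarith
          from power_mono[OF this abs_ge_zero, of 2]
          show "0 \<le> (kern (h n) x y $ j)\<^sup>2 \<and> (kern (h n) x y $ j)\<^sup>2 \<le> (G / h n ^ 4)\<^sup>2 * indicator (cball x (h n)) y"
            by (cases "y \<in> cball x (h n)") (auto simp: power_mult_distrib)
        qed (use elim h_pos x in auto)
        also have "\<dots> = F * G\<^sup>2 / h n ^ 6"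
        proof -
          have "(h n ^ 4)\<^sup>2 = h n ^ 6 * (h n)\<^sup>2" by (simp flip: power_add power_mult)
          moreover have "F * (a / (c * d)) * d = F * a / c" if "c \<noteq> 0" "d \<noteq> 0" for a c d :: real
            using that by simp
          ultimately show ?thesis using h_pos[of n] by (metis power_divide power_not_zero less_irrefl)
        qed
        also have "\<dots> \<le> V / h n ^ 6" using h_pos[of n] G(1) by (intro divide_right_mono) (auto simp: V_def)
        finally show "(\<integral>y. f y * (kern (h n) (fst p) y $ snd p)\<^sup>2 \<partial>lborel) \<le> V / h n ^ 6" by (simp add: p)
      qed
    qed
    have "\<forall>\<^sub>F n in sequentially. rate n \<le> 1 / m\<^sup>2" by (rule eventually_rate_le) (use m V in simp)
    then show "\<forall>\<^sub>F n in sequentially. 0 < V / h n ^ 6 \<and> 0 \<le> m * sup_rate n \<and> m * sup_rate n * (G / h n ^ 4) \<le> V / h n ^ 6 \<and>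
       real (4 + 1) * ln (real n) \<le> real n * (m * sup_rate n)\<^sup>2 / (4 * (V / h n ^ 6))"
      using eventually_sup_rate_sq eventually_h_le_1 eventually_ge_at_top[of 1]
    proof eventually_elim
      case (elim n)
      have "(m * sup_rate n)\<^sup>2 \<le> m\<^sup>2 * (1 / m\<^sup>2)"
        unfolding power_mult_distrib using elim by (intro mult_left_mono) auto
      then have "(m * sup_rate n)\<^sup>2 \<le> 1\<^sup>2" using m V by simp
      then have e: "m * sup_rate n \<le> 1" by (rule power2_le_imp_le) simp
      have e0: "0 \<le> m * sup_rate n" using m sup_rate_nonneg[OF elim(4)] by simp
      have "G * (1 / h n ^ 4) \<le> V * (1 / h n ^ 6)"
        using h_power_le[of n 4 6] elim V h_pos[of n] by (intro mult_mono) auto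
      then have "m * sup_rate n * (G / h n ^ 4) \<le> 1 * (V / h n ^ 6)"
        using e e0 h_pos[of n] G(1) by (intro mult_mono) auto
      moreover have "real n * (m * sup_rate n)\<^sup>2 / (4 * (V / h n ^ 6)) = 5 * ln (real n)"
        unfolding power_mult_distrib m(2) sup_rate_sq[OF elim(4)] using V h_pos[of n] elim(4) by simp
      ultimately show ?case using e0 V h_pos[of n] by simp
    qed
  qed
  define C' where "C' = 27 * m\<^sup>2 + 3 * (G + L)\<^sup>2 + 3 * B\<^sup>2 * H"
  have "\<forall>\<^sub>F n in sequentially. \<forall>\<omega>\<in>space M. (\<forall>p\<in>N n \<times> (UNIV :: 3 set).
     \<bar>(\<Sum>i=1..n. kern (h n) (fst p) (X i \<omega>) $ snd p) / real n
        - (\<integral>y. f y * kern (h n) (fst p) y $ snd p \<partial>lborel)\<bar> \<le> m * sup_rate n) \<longrightarrow>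
     (\<forall>x\<in>cball 0 r. (norm (dhat n \<omega> x - d2 f x))\<^sup>2 \<le> C' * rate n)"
    using eventually_ge_at_top[of 1] eventually_h_le_1 eventually_h_inverse eventually_sup_rate_sq
      eventually_inverse_le_rate H(2)
  proof eventually_elim
    case (elim n)
    note n = elim(1)
    show ?case
    proof (intro ballI impI)
      fix \<omega> x assume ev: "\<forall>p\<in>N n \<times> (UNIV :: 3 set).
        \<bar>(\<Sum>i=1..n. kern (h n) (fst p) (X i \<omega>) $ snd p) / real n
        - (\<integral>y. f y * kern (h n) (fst p) y $ snd p \<partial>lborel)\<bar> \<le> m * sup_rate n"
        and x: "x \<in> cball (0::real^2) r"
      obtain x' where x': "x' \<in> N n" "norm (x - x') \<le> 1 / (real n)\<^sup>2"
        using N(4)[OF n] x by blast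
      have x'r: "x' \<in> cball 0 r" using N(1)[OF n] x' by blast
      have "\<bar>(dhat n \<omega> x' - mean (h n) x') $ j\<bar> \<le> m * sup_rate n" for j
        using bspec[OF ev, of "(x', j)"] x' by (simp add: dhat_nth mean_def)
      from norm_le_componentwise[OF this]
      have a: "norm (dhat n \<omega> x' - mean (h n) x') \<le> 3 * (m * sup_rate n)" by simp
      have "norm (dhat n \<omega> x - dhat n \<omega> x') \<le> G * (1 / h n ^ 5) * norm (x - x')"
        using dhat_lipschitz[OF n, of \<omega> x x'] by simp
      also have "\<dots> \<le> G * real n * (1 / (real n)\<^sup>2)"
        using elim(3) x' G(1) h_pos[of n] by (intro mult_mono) auto
      also have "\<dots> = G / real n" using n by (simp add: power2_eq_square)
      finally have b: "norm (dhat n \<omega> x - dhat n \<omega> x') \<le> G / real n" .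
      have sq: "1 / (real n)\<^sup>2 \<le> 1 / real n" using n by (simp add: field_simps power2_eq_square)
      have "norm (mean (h n) x - mean (h n) x') \<le> L * norm (x - x')"
        by (rule L(2)[rule_format]) (use h_pos elim x x'r in auto)
      also have "\<dots> \<le> L * (1 / real n)" using L x' sq by (intro mult_left_mono) auto
      finally have c: "norm (mean (h n) x - mean (h n) x') \<le> L / real n" by simp
      have d: "norm (mean (h n) x - d2 f x) \<le> B * (h n)\<^sup>2"
        by (rule B(2)[rule_format]) (use h_pos elim x in auto)
      have "norm (dhat n \<omega> x - mean (h n) x) \<le> norm (dhat n \<omega> x - dhat n \<omega> x')
         + norm (dhat n \<omega> x' - mean (h n) x') + norm (mean (h n) x - mean (h n) x')"
        by (rule norm_diff_chain)
      moreover have "norm (dhat n \<omega> x - d2 f x) \<le> norm (dhat n \<omega> x - mean (h n) x) + norm (mean (h n) x - d2 f x)"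
        using norm_triangle_ineq[of "dhat n \<omega> x - mean (h n) x" "mean (h n) x - d2 f x"] by simp
      moreover have "G / real n + L / real n = (G + L) * (1 / real n)" by (simp add: add_divide_distrib)
      ultimately have tot: "norm (dhat n \<omega> x - d2 f x) \<le> 3 * (m * sup_rate n) + (G + L) * (1 / real n) + B * (h n)\<^sup>2"
        using a b c d by linarith
      have sq3: "(p + q + s)\<^sup>2 \<le> 3 * p\<^sup>2 + 3 * q\<^sup>2 + 3 * s\<^sup>2" for p q s :: real
        using sum_squares_ge_zero[of "p - q" "q - s"] zero_le_square[of "p - s"]
        by (simp add: power2_eq_square algebra_simps)
      have "(norm (dhat n \<omega> x - d2 f x))\<^sup>2 \<le> (3 * (m * sup_rate n) + (G + L) * (1 / real n) + B * (h n)\<^sup>2)\<^sup>2"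
        using tot by (rule power_mono) simp
      also have "\<dots> \<le> 3 * (3 * (m * sup_rate n))\<^sup>2 + 3 * ((G + L) * (1 / real n))\<^sup>2 + 3 * (B * (h n)\<^sup>2)\<^sup>2"
        by (rule sq3)
      also have "\<dots> = 27 * m\<^sup>2 * (sup_rate n)\<^sup>2 + 3 * (G + L)\<^sup>2 * (1 / (real n)\<^sup>2) + 3 * B\<^sup>2 * ((h n)\<^sup>2 * (h n)\<^sup>2)"
        by (simp add: power_mult_distrib power_divide power2_eq_square)
      also have "\<dots> \<le> 27 * m\<^sup>2 * rate n + 3 * (G + L)\<^sup>2 * rate n + 3 * B\<^sup>2 * (1 * (H * rate n))"
        using elim sq h_pos[of n]
        by (intro add_mono mult_left_mono mult_mono) (auto intro: power_le_one mult_nonneg_nonneg)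
      also have "\<dots> = C' * rate n" by (simp add: C'_def algebra_simps)
      finally show "(norm (dhat n \<omega> x - d2 f x))\<^sup>2 \<le> C' * rate n" .
    qed
  qed
  from whp_mono[OF whp1 this] have "whp M (\<lambda>n \<omega>. \<forall>x\<in>cball 0 r. (norm (dhat n \<omega> x - d2 f x))\<^sup>2 \<le> C' * rate n)" .
  moreover have "C' > 0" unfolding C'_def using m(1) H(1)
    by (intro add_pos_nonneg mult_pos_pos mult_nonneg_nonneg) auto
  ultimately show ?thesis by blast
qed

end

section \<open>Sample means integrated along curves\<close>

text \<open>Extended by 0 outside the time interval, \<open>k\<close> is jointly measurable and, after multiplication by
  \<open>f\<close>, integrable on the product space.\<close>

lemma (in iid_sample) curve_fubini:
  fixes k :: "real \<Rightarrow> real^2 \<Rightarrow> real"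
  assumes cont: "continuous_on ({0..t} \<times> UNIV) (\<lambda>p. k (fst p) (snd p))"
    and bd: "\<And>s y. s \<in> {0..t} \<Longrightarrow> \<bar>k s y\<bar> \<le> b"
  shows "(\<lambda>y. integral {0..t} (\<lambda>s. k s y)) \<in> borel_measurable borel"
    and "(\<integral>y. f y * integral {0..t} (\<lambda>s. k s y) \<partial>lborel) = integral {0..t} (\<lambda>s. \<integral>y. f y * k s y \<partial>lborel)"
    and "(\<lambda>s. \<integral>y. f y * k s y \<partial>lborel) integrable_on {0..t}"
proof -
  define k' where "k' s y = indicator {0..t} s * k s y" for s y
  have "(\<lambda>p. indicator ({0..t} \<times> UNIV) p *\<^sub>R k (fst p) (snd p)) \<in> borel_measurable borel"
    by (intro borel_measurable_continuous_on_indicator cont) (auto intro!: borel_closed closed_Times)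
  also have "(\<lambda>p. indicator ({0..t} \<times> UNIV) p *\<^sub>R k (fst p) (snd p)) = (\<lambda>(s, y). k' s y)"
    by (auto simp: k'_def indicator_def fun_eq_iff)
  finally have [measurable]: "(\<lambda>(s, y). k' s y) \<in> borel_measurable (borel \<Otimes>\<^sub>M borel)"
    by (simp add: borel_prod)
  then have k'1: "(\<lambda>p. k' (fst p) (snd p)) \<in> borel_measurable (lborel \<Otimes>\<^sub>M lborel)"
    by (simp add: split_beta' cong: measurable_cong_sets)
  have b: "\<bar>k' s y\<bar> \<le> \<bar>b\<bar> * indicator {0..t} s" for s y
    using bd[of s y] by (auto simp: k'_def indicator_def)
  have eq1: "integral {0..t} (\<lambda>s. k s y) = (\<integral>s. k' s y \<partial>lborel)" for y
  proof -
    have "continuous_on {0..t} (\<lambda>s. k (fst (s, y)) (snd (s, y)))"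
      by (rule continuous_on_compose2[OF cont]) (auto intro!: continuous_intros)
    then have "set_integrable lborel {0..t} (\<lambda>s. k s y)"
      unfolding set_integrable_def by (intro borel_integrable_compact) auto
    from set_borel_integral_eq_integral(2)[OF this] show ?thesis
      by (simp add: set_lebesgue_integral_def k'_def)
  qed
  have int_y: "integrable lborel (\<lambda>y. f y * k' s y)" for s
  proof (rule integrable_density_mult)
    show "k' s \<in> borel_measurable borel" by measurable
    show "\<bar>k' s y\<bar> \<le> \<bar>b\<bar>" for y using b[of s y] by (cases "s \<in> {0..t}") auto
  qed
  have F: "integrable (lborel \<Otimes>\<^sub>M lborel) (\<lambda>(s, y). f y * k' s y)"
  proof (rule lborel_pair.Fubini_integrable)
    show "(\<lambda>(s, y). f y * k' s y) \<in> borel_measurable (lborel \<Otimes>\<^sub>M lborel)"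
      by measurable
    show "AE s in lborel. integrable lborel (\<lambda>y. case (s, y) of (s, y) \<Rightarrow> f y * k' s y)"
      using int_y by simp
    show "integrable lborel (\<lambda>s. \<integral>y. norm (case (s, y) of (s, y) \<Rightarrow> f y * k' s y) \<partial>lborel)"
    proof (rule Bochner_Integration.integrable_bound)
      show "integrable lborel (\<lambda>s::real. \<bar>b\<bar> * indicator {0..t} s)"
        by (intro integrable_mult_right integrable_real_indicator) (auto simp: emeasure_lborel_Icc_eq)
      show "(\<lambda>s. \<integral>y. norm (case (s, y) of (s, y) \<Rightarrow> f y * k' s y) \<partial>lborel) \<in> borel_measurable lborel"
        by measurable
      show "AE s in lborel. norm (\<integral>y. norm (case (s, y) of (s, y) \<Rightarrow> f y * k' s y) \<partial>lborel)
          \<le> norm (\<bar>b\<bar> * indicator {0..t} s)"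
      proof (intro AE_I2)
        fix s :: real
        have "(\<integral>y. f y * \<bar>k' s y\<bar> \<partial>lborel) \<le> \<bar>b\<bar> * indicator {0..t} s"
        proof (rule order_trans[OF abs_ge_self integral_density_mult_le])
          show "(\<lambda>y. \<bar>k' s y\<bar>) \<in> borel_measurable borel" by measurable
        qed (use b in simp)
        moreover have "0 \<le> (\<integral>y. f y * \<bar>k' s y\<bar> \<partial>lborel)" using f_nonneg by (intro integral_nonneg_AE) auto
        ultimately show "norm (\<integral>y. norm (case (s, y) of (s, y) \<Rightarrow> f y * k' s y) \<partial>lborel)
          \<le> norm (\<bar>b\<bar> * indicator {0..t} s)"
          using f_nonneg by (simp add: abs_mult)
      qed
    qed
  qed
  show "(\<lambda>y. integral {0..t} (\<lambda>s. k s y)) \<in> borel_measurable borel"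
    unfolding eq1 by measurable
  have eq2: "indicator {0..t} s *\<^sub>R (\<integral>y. f y * k s y \<partial>lborel) = (\<integral>y. f y * k' s y \<partial>lborel)" for s
    by (cases "s \<in> {0..t}") (auto simp: k'_def)
  have si: "set_integrable lborel {0..t} (\<lambda>s. \<integral>y. f y * k s y \<partial>lborel)"
    unfolding set_integrable_def eq2 using lborel_pair.integrable_fst[OF F] by simp
  then show "(\<lambda>s. \<integral>y. f y * k s y \<partial>lborel) integrable_on {0..t}"
    by (rule set_borel_integral_eq_integral(1))
  have "(\<integral>y. f y * integral {0..t} (\<lambda>s. k s y) \<partial>lborel) = (\<integral>y. (\<integral>s. f y * k' s y \<partial>lborel) \<partial>lborel)"
    by (simp add: eq1)
  also have "\<dots> = (\<integral>s. (\<integral>y. f y * k' s y \<partial>lborel) \<partial>lborel)"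
    by (rule lborel_pair.Fubini_integral[OF F])
  also have "\<dots> = integral {0..t} (\<lambda>s. \<integral>y. f y * k s y \<partial>lborel)"
    using set_borel_integral_eq_integral(2)[OF si] by (simp add: set_lebesgue_integral_def eq2 del: real_scaleR_def)
  finally show "(\<integral>y. f y * integral {0..t} (\<lambda>s. k s y) \<partial>lborel) = integral {0..t} (\<lambda>s. \<integral>y. f y * k s y \<partial>lborel)" .
qed

text \<open>Any two times at which the curve is within \<open>\<rho>\<close> of \<open>y\<close> differ by at most \<open>2 * \<rho> / \<gamma>\<close>, because the
  corresponding points are within \<open>2 * \<rho>\<close> of each other. So \<open>g\<close> is supported in an interval of
  length \<open>4 * \<rho> / \<gamma>\<close>.\<close>

lemma chord_arc_integral_bound:
  fixes c :: "real \<Rightarrow> 'b::real_normed_vector" and g :: "real \<Rightarrow> real"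
  assumes g: "continuous_on {0..t} g" and "0 < \<gamma>" "0 < \<rho>" "0 \<le> B"
    and ca: "\<And>s u. 0 \<le> s \<Longrightarrow> s < u \<Longrightarrow> u \<le> t \<Longrightarrow> \<gamma> * (u - s) \<le> norm (c u - c s)"
    and bd: "\<And>s. s \<in> {0..t} \<Longrightarrow> \<bar>g s\<bar> \<le> B"
    and out: "\<And>s. s \<in> {0..t} \<Longrightarrow> norm (c s - y) > \<rho> \<Longrightarrow> g s = 0"
  shows "\<bar>integral {0..t} g\<bar> \<le> B * (4 * \<rho> / \<gamma>)"
proof (cases "\<exists>s\<in>{0..t}. norm (c s - y) \<le> \<rho>")
  case False
  then have "integral {0..t} g = integral {0..t} (\<lambda>_. 0)"
    using out by (intro Henstock_Kurzweil_Integration.integral_cong) force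
  then show ?thesis using assms by simp
next
  case True
  then obtain s0 where s0: "s0 \<in> {0..t}" "norm (c s0 - y) \<le> \<rho>" by blast
  let ?d = "2 * \<rho> / \<gamma>"
  let ?l = "max 0 (s0 - ?d)" and ?u = "min t (s0 + ?d)"
  have d: "?d > 0" using assms by simp
  have near: "s \<in> {s0 - ?d..s0 + ?d}" if s: "s \<in> {0..t}" "norm (c s - y) \<le> \<rho>" for s
  proof -
    have n: "norm (c s - c s0) \<le> 2 * \<rho>" "norm (c s0 - c s) \<le> 2 * \<rho>"
      using norm_triangle_ineq4[of "c s - y" "c s0 - y"] norm_triangle_ineq4[of "c s0 - y" "c s - y"] s s0 by auto
    have "\<gamma> * \<bar>s - s0\<bar> \<le> 2 * \<rho>"
    proof (cases s s0 rule: linorder_cases)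
      case less then show ?thesis using ca[of s s0] s s0 n by auto
    next
      case equal then show ?thesis using assms by simp
    next
      case greater then show ?thesis using ca[of s0 s] s s0 n by auto
    qed
    then have "\<bar>s - s0\<bar> \<le> ?d" using \<open>0 < \<gamma>\<close> by (simp add: pos_le_divide_eq mult.commute)
    then show ?thesis by auto
  qed
  have "integral {0..t} g = integral {0..t} (\<lambda>s. if s \<in> {s0 - ?d..s0 + ?d} then g s else 0)"
  proof (rule Henstock_Kurzweil_Integration.integral_cong)
    fix s assume s: "s \<in> {0..t}"
    show "g s = (if s \<in> {s0 - ?d..s0 + ?d} then g s else 0)"
      using near[OF s] out[OF s] by (cases "norm (c s - y) \<le> \<rho>") auto
  qed
  also have "\<dots> = integral ({0..t} \<inter> {s0 - ?d..s0 + ?d}) g"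
    by (subst Int_commute) (rule integral_restrict_Int)
  also have "{0..t} \<inter> {s0 - ?d..s0 + ?d} = {?l..?u}" by auto
  finally have eq: "integral {0..t} g = integral {?l..?u} g" .
  have "norm (integral {?l..?u} g) \<le> B * (?u - ?l)"
    using s0 d bd by (intro integral_bound continuous_on_subset[OF g]) auto
  also have "\<dots> \<le> B * (4 * \<rho> / \<gamma>)" using \<open>0 \<le> B\<close> by (intro mult_left_mono) auto
  finally show ?thesis using eq by simp
qed

text \<open>Integration along a curve turns the contribution of one observation, of order \<open>1 / h ^ 4\<close>, into
  \<open>\<phi>\<close> of order \<open>1 / h ^ 3\<close>, because the curve meets the ball of radius \<open>h\<close> around the observation
  only for a time of order \<open>h\<close>. By Fubini the expectation of \<open>\<bar>\<phi>\<bar>\<close> is of order \<open>1 / h\<^sup>2\<close>, so the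
  second moment of \<open>\<phi>\<close> is of order \<open>1 / h ^ 5\<close>.\<close>

lemma (in kde_rate) whp_curve_integrals:
  fixes \<xi> :: "real^2 \<Rightarrow> real \<Rightarrow> real^2" and a :: "real^2 \<Rightarrow> real^3" and N :: "nat \<Rightarrow> ((real^2) \<times> real) set"
  assumes cont: "\<And>x t. (x, t) \<in> S \<Longrightarrow> continuous_on {0..t} (\<xi> x)"
    and H: "\<And>x t s. (x, t) \<in> S \<Longrightarrow> s \<in> {0..t} \<Longrightarrow> \<xi> x s \<in> H" "H \<subseteq> cball 0 r"
    and ca: "\<And>x t s u. (x, t) \<in> S \<Longrightarrow> 0 \<le> s \<Longrightarrow> s < u \<Longrightarrow> u \<le> t \<Longrightarrow> \<gamma> * (u - s) \<le> norm (\<xi> x u - \<xi> x s)"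
    and \<gamma>: "\<gamma> > 0" and T: "\<And>x t. (x, t) \<in> S \<Longrightarrow> 0 \<le> t \<and> t \<le> T" "T > 0"
    and a: "continuous_on H a" "\<And>x. x \<in> H \<Longrightarrow> norm (a x) \<le> A" "A > 0"
    and N: "\<And>n. n \<ge> 1 \<Longrightarrow> N n \<subseteq> S \<and> finite (N n) \<and> real (card (N n)) \<le> C * real n ^ k"
  shows "\<exists>m>0. whp M (\<lambda>n \<omega>. \<forall>p\<in>N n. \<bar>integral {0..snd p}
     (\<lambda>s. a (\<xi> (fst p) s) \<bullet> (dhat n \<omega> (\<xi> (fst p) s) - mean (h n) (\<xi> (fst p) s)))\<bar> \<le> m * rate n)"
proof -
  obtain F where F: "F > 0" "\<forall>s x b \<phi>. 0 < s \<longrightarrow> s \<le> 1 \<longrightarrow> x \<in> cball 0 r \<longrightarrow> \<phi> \<in> borel_measurable borel \<longrightarrow>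
    (\<forall>y. 0 \<le> \<phi> y \<and> \<phi> y \<le> b * indicator (cball x s) y) \<longrightarrow> (\<integral>y. f y * \<phi> y \<partial>lborel) \<le> F * b * s\<^sup>2"
    by (rule local_moment[of r, THEN exE]) blast
  define B where "B = A * G * (4 / \<gamma>)"
  define V where "V = B * (A * T * F * G) + B"
  have B: "B > 0" using a(3) G(1) \<gamma> by (simp add: B_def)
  have V: "V > 0" "B \<le> V" using B a(3) T(2) F(1) G(1) by (auto simp: V_def intro!: add_pos_pos)
  \<comment> \<open>Chosen such that \<open>n * (m * rate n)\<^sup>2 / (4 * (V / h ^ 5)) = (k + 1) * ln n\<close>.\<close>
  define m where "m = sqrt (4 * V * real (k + 1))"
  have m: "m > 0" "m\<^sup>2 = 4 * V * real (k + 1)" using V by (auto simp: m_def)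
  define \<phi> where "\<phi> n p y = integral {0..snd p} (\<lambda>s. a (\<xi> (fst p) s) \<bullet> kern (h n) (\<xi> (fst p) s) y)" for n p y
  \<comment> \<open>A majorant of \<open>\<bar>\<phi>\<bar>\<close> whose expectation is accessible to Fubini's theorem.\<close>
  define \<psi> where "\<psi> n p y = integral {0..snd p} (\<lambda>s. A * norm (kern (h n) (\<xi> (fst p) s) y))" for n p y
  have ca\<xi>: "continuous_on {0..t} (\<lambda>s. a (\<xi> x s))" if "(x, t) \<in> S" for x t
    using H(1)[OF that] by (intro continuous_on_compose2[OF a(1) cont[OF that]]) auto
  have cprod: "continuous_on ({0..t} \<times> UNIV) (\<lambda>p. kern s (\<xi> x (fst p)) (snd p))" if "(x, t) \<in> S" for x t s
    by (intro continuous_intros continuous_on_compose2[OF cont[OF that]]) auto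
  have cprod1: "continuous_on ({0..t} \<times> UNIV) (\<lambda>p. a (\<xi> x (fst p)) \<bullet> kern s (\<xi> x (fst p)) (snd p))"
    if "(x, t) \<in> S" for x t s
    by (intro continuous_on_inner cprod that continuous_on_compose2[OF ca\<xi>[OF that]] continuous_intros) auto
  have bd: "\<bar>a z \<bullet> kern s z y\<bar> \<le> A * norm (kern s z y)" if "z \<in> H" for s z y
    using Cauchy_Schwarz_ineq2[of "a z" "kern s z y"] mult_right_mono[OF a(2)[OF that] norm_ge_zero[of "kern s z y"]]
    by linarith
  have bd': "A * norm (kern (h n) z y) \<le> A * (G / h n ^ 4)" for n z y
    using a(3) kern_bound[OF h_pos] by (intro mult_left_mono) auto
  have fub1: "\<phi> n (x, t) \<in> borel_measurable borel"
      "(\<integral>y. f y * \<phi> n (x, t) y \<partial>lborel) = integral {0..t} (\<lambda>s. a (\<xi> x s) \<bullet> mean (h n) (\<xi> x s))"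
      "(\<lambda>s. a (\<xi> x s) \<bullet> mean (h n) (\<xi> x s)) integrable_on {0..t}"
    if "(x, t) \<in> S" for n x t
  proof -
    have "\<bar>a (\<xi> x s) \<bullet> kern (h n) (\<xi> x s) y\<bar> \<le> A * (G / h n ^ 4)" if "s \<in> {0..t}" for s y
      using bd[OF H(1)[OF \<open>(x, t) \<in> S\<close> that]] bd' by (rule order_trans)
    from curve_fubini[OF cprod1[OF that] this]
    show "\<phi> n (x, t) \<in> borel_measurable borel"
      "(\<integral>y. f y * \<phi> n (x, t) y \<partial>lborel) = integral {0..t} (\<lambda>s. a (\<xi> x s) \<bullet> mean (h n) (\<xi> x s))"
      "(\<lambda>s. a (\<xi> x s) \<bullet> mean (h n) (\<xi> x s)) integrable_on {0..t}"
      using mean_inner[OF h_pos] by (simp_all add: \<phi>_def[abs_def] inner_commute[of "a _"])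
  qed
  have ciy: "continuous_on {0..t} (\<lambda>s. a (\<xi> x s) \<bullet> kern u (\<xi> x s) y)"
     "continuous_on {0..t} (\<lambda>s. A * norm (kern u (\<xi> x s) y))" if "(x, t) \<in> S" for x t u y
    by (intro continuous_intros ca\<xi> cont that)+
  have \<phi>\<psi>: "\<bar>\<phi> n (x, t) y\<bar> \<le> \<psi> n (x, t) y" if "(x, t) \<in> S" for n x t y
  proof -
    have "norm (integral {0..t} (\<lambda>s. a (\<xi> x s) \<bullet> kern (h n) (\<xi> x s) y)) \<le> integral {0..t} (\<lambda>s. A * norm (kern (h n) (\<xi> x s) y))"
      using bd[OF H(1)[OF that]]
      by (intro integral_norm_bound_integral integrable_continuous_interval ciy that) auto
    then show ?thesis by (simp add: \<phi>_def \<psi>_def)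
  qed
  have \<phi>b: "\<bar>\<phi> n (x, t) y\<bar> \<le> B / h n ^ 3" if S: "(x, t) \<in> S" for n x t y
  proof -
    have "\<bar>integral {0..t} (\<lambda>s. a (\<xi> x s) \<bullet> kern (h n) (\<xi> x s) y)\<bar> \<le> (A * (G / h n ^ 4)) * (4 * h n / \<gamma>)"
    proof (rule chord_arc_integral_bound[where c = "\<xi> x" and y = y])
      show "\<bar>a (\<xi> x s) \<bullet> kern (h n) (\<xi> x s) y\<bar> \<le> A * (G / h n ^ 4)" if "s \<in> {0..t}" for s
        using bd[OF H(1)[OF S that]] bd' by (rule order_trans)
      show "a (\<xi> x s) \<bullet> kern (h n) (\<xi> x s) y = 0" if "h n < norm (\<xi> x s - y)" for s
        using kern_outside[OF h_pos that] by simp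
    qed (use ciy[OF S] \<gamma> h_pos[of n] a(3) G(1) ca[OF S] in auto)
    also have "\<dots> = B / h n ^ 3"
      using h_pos[of n] by (simp add: B_def power4_eq_xxxx power3_eq_cube mult_ac)
    finally show ?thesis by (simp add: \<phi>_def)
  qed
  have \<psi>i: "(\<integral>y. f y * \<psi> n (x, t) y \<partial>lborel) \<le> A * T * F * G / (h n)\<^sup>2" and \<psi>m: "\<psi> n (x, t) \<in> borel_measurable borel"
    if S: "(x, t) \<in> S" and h1: "h n \<le> 1" for n x t
  proof -
    have "continuous_on ({0..t} \<times> UNIV) (\<lambda>p. A * norm (kern (h n) (\<xi> x (fst p)) (snd p)))"
      by (intro continuous_intros cprod S)
    moreover have "\<bar>A * norm (kern (h n) (\<xi> x s) y)\<bar> \<le> A * (G / h n ^ 4)" for s y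
      using bd'[of n "\<xi> x s" y] a(3) by simp
    ultimately have fub: "\<psi> n (x, t) \<in> borel_measurable borel"
      "(\<integral>y. f y * \<psi> n (x, t) y \<partial>lborel) = integral {0..t} (\<lambda>s. \<integral>y. f y * (A * norm (kern (h n) (\<xi> x s) y)) \<partial>lborel)"
      "(\<lambda>s. \<integral>y. f y * (A * norm (kern (h n) (\<xi> x s) y)) \<partial>lborel) integrable_on {0..t}"
      using curve_fubini[of t "\<lambda>s y. A * norm (kern (h n) (\<xi> x s) y)" "A * (G / h n ^ 4)"]
      by (simp_all add: \<psi>_def[abs_def])
    show "\<psi> n (x, t) \<in> borel_measurable borel" by (rule fub)
    have "(\<integral>y. f y * \<psi> n (x, t) y \<partial>lborel) \<le> integral {0..t} (\<lambda>s. F * (A * (G / h n ^ 4)) * (h n)\<^sup>2)"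
      unfolding fub(2)
    proof (rule integral_le[OF fub(3)])
      fix s assume s: "s \<in> {0..t}"
      show "(\<integral>y. f y * (A * norm (kern (h n) (\<xi> x s) y)) \<partial>lborel) \<le> F * (A * (G / h n ^ 4)) * (h n)\<^sup>2"
      proof (rule F(2)[rule_format])
        show "\<xi> x s \<in> cball 0 r" using H(1)[OF S s] H(2) by blast
        show "(\<lambda>y. A * norm (kern (h n) (\<xi> x s) y)) \<in> borel_measurable borel" by measurable
        show "0 \<le> A * norm (kern (h n) (\<xi> x s) y) \<and>
           A * norm (kern (h n) (\<xi> x s) y) \<le> A * (G / h n ^ 4) * indicator (cball (\<xi> x s) (h n)) y" for y
          using a(3) mult_left_mono[OF kern_indicator[OF h_pos, of n "\<xi> x s" y], of A] by (simp add: mult.assoc)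
      qed (use h_pos h1 in auto)
    qed auto
    also have "\<dots> = t * (F * (A * (G / h n ^ 4)) * (h n)\<^sup>2)" using T(1)[OF S] by simp
    also have "\<dots> \<le> T * (F * (A * (G / h n ^ 4)) * (h n)\<^sup>2)"
      using T(1)[OF S] F(1) a(3) G(1) h_pos[of n] by (intro mult_right_mono) auto
    also have "\<dots> = A * T * F * G / (h n)\<^sup>2"
      using h_pos[of n] by (simp add: power4_eq_xxxx power2_eq_square)
    finally show "(\<integral>y. f y * \<psi> n (x, t) y \<partial>lborel) \<le> A * T * F * G / (h n)\<^sup>2" .
  qed
  have whp1: "whp M (\<lambda>n \<omega>. \<forall>p\<in>N n. \<bar>(\<Sum>i=1..n. \<phi> n p (X i \<omega>)) / real n - (\<integral>y. f y * \<phi> n p y \<partial>lborel)\<bar> \<le> m * rate n)"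
  proof (rule whp_sample_means[where k = k and C = C and b = "\<lambda>n. B / h n ^ 3" and v = "\<lambda>n. V / h n ^ 5"])
    show "\<forall>\<^sub>F n in sequentially. finite (N n) \<and> real (card (N n)) \<le> C * real n ^ k"
      using eventually_ge_at_top[of 1] by eventually_elim (use N in blast)
    show "\<forall>\<^sub>F n in sequentially. \<forall>p\<in>N n. \<phi> n p \<in> borel_measurable borel"
      using eventually_ge_at_top[of 1] by eventually_elim (use N fub1(1) in fastforce)
    show "\<forall>\<^sub>F n in sequentially. \<forall>p\<in>N n. \<forall>y. \<bar>\<phi> n p y\<bar> \<le> B / h n ^ 3"
      using eventually_ge_at_top[of 1] by eventually_elim (use N \<phi>b in fastforce)
    show "\<forall>\<^sub>F n in sequentially. \<forall>p\<in>N n. (\<integral>y. f y * (\<phi> n p y)\<^sup>2 \<partial>lborel) \<le> V / h n ^ 5"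
      using eventually_ge_at_top[of 1] eventually_h_le_1
    proof eventually_elim
      case (elim n)
      show ?case
      proof
        fix p assume "p \<in> N n"
        then obtain x t where p: "p = (x, t)" and S: "(x, t) \<in> S" using N[OF elim(1)] by (cases p) auto
        have [measurable]: "\<phi> n p \<in> borel_measurable borel" "\<psi> n p \<in> borel_measurable borel"
          using fub1(1)[OF S] \<psi>m[OF S elim(2)] by (simp_all add: p)
        have le: "(\<phi> n p y)\<^sup>2 \<le> B / h n ^ 3 * \<psi> n p y" for y
        proof -
          have "(\<phi> n p y)\<^sup>2 = \<bar>\<phi> n p y\<bar> * \<bar>\<phi> n p y\<bar>" by (simp add: power2_eq_square)
          also have "\<dots> \<le> B / h n ^ 3 * \<psi> n p y"
            unfolding p using \<phi>b[OF S] \<phi>\<psi>[OF S] B h_pos[of n] by (intro mult_mono) auto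
          finally show ?thesis .
        qed
        have \<psi>b: "\<bar>\<psi> n p y\<bar> \<le> T * (A * (G / h n ^ 4))" for y
        proof -
          have "norm (integral {0..t} (\<lambda>s. A * norm (kern (h n) (\<xi> x s) y))) \<le> (A * (G / h n ^ 4)) * (t - 0)"
            using T(1)[OF S] bd'[of n] a(3) by (intro integral_bound ciy S) auto
          also have "\<dots> \<le> (A * (G / h n ^ 4)) * T"
            using T(1)[OF S] a(3) G(1) h_pos[of n] by (intro mult_left_mono) auto
          finally show ?thesis by (simp add: \<psi>_def p mult.commute)
        qed
        have "(\<integral>y. f y * (\<phi> n p y)\<^sup>2 \<partial>lborel) \<le> (\<integral>y. B / h n ^ 3 * (f y * \<psi> n p y) \<partial>lborel)"
        proof (rule integral_mono)
          have "\<bar>(\<phi> n p y)\<^sup>2\<bar> \<le> (B / h n ^ 3)\<^sup>2" for y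
            using power_mono[OF \<phi>b[OF S] abs_ge_zero, of n y 2] by (simp add: p)
          then show "integrable lborel (\<lambda>y. f y * (\<phi> n p y)\<^sup>2)" by (intro integrable_density_mult) auto
          show "integrable lborel (\<lambda>y. B / h n ^ 3 * (f y * \<psi> n p y))"
            by (intro integrable_mult_right integrable_density_mult[OF _ \<psi>b]) auto
          show "f y * (\<phi> n p y)\<^sup>2 \<le> B / h n ^ 3 * (f y * \<psi> n p y)" for y
            using mult_left_mono[OF le[of y] f_nonneg[of y]] by (simp add: mult_ac)
        qed
        also have "\<dots> = B / h n ^ 3 * (\<integral>y. f y * \<psi> n p y \<partial>lborel)" by simp
        also have "\<dots> \<le> B / h n ^ 3 * (A * T * F * G / (h n)\<^sup>2)"
          using \<psi>i[OF S elim(2)] B h_pos[of n] by (intro mult_left_mono) (auto simp: p)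
        also have "\<dots> = B * (A * T * F * G) / h n ^ 5" by (simp flip: power_add)
        also have "\<dots> \<le> V / h n ^ 5"
          using h_pos[of n] B by (intro divide_right_mono) (auto simp: V_def)
        finally show "(\<integral>y. f y * (\<phi> n p y)\<^sup>2 \<partial>lborel) \<le> V / h n ^ 5" .
      qed
    qed
    have "\<forall>\<^sub>F n in sequentially. rate n \<le> 1 / m" by (rule eventually_rate_le) (use m(1) in simp)
    then show "\<forall>\<^sub>F n in sequentially. 0 < V / h n ^ 5 \<and> 0 \<le> m * rate n \<and> m * rate n * (B / h n ^ 3) \<le> V / h n ^ 5 \<and>
       real (k + 1) * ln (real n) \<le> real n * (m * rate n)\<^sup>2 / (4 * (V / h n ^ 5))"
      using eventually_h_le_1 eventually_ge_at_top[of 1]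
    proof eventually_elim
      case (elim n)
      have e: "m * rate n \<le> 1" using elim m(1) by (simp add: pos_le_divide_eq mult.commute)
      have e0: "0 \<le> m * rate n" using m(1) rate_nonneg[OF elim(3)] by simp
      have "B * (1 / h n ^ 3) \<le> V * (1 / h n ^ 5)"
        using h_power_le[of n 3 5] elim V h_pos[of n] by (intro mult_mono) auto
      then have "m * rate n * (B / h n ^ 3) \<le> 1 * (V / h n ^ 5)"
        using e e0 h_pos[of n] B by (intro mult_mono) auto
      moreover have "real n * (m * rate n)\<^sup>2 / (4 * (V / h n ^ 5)) = real (k + 1) * ln (real n)"
        unfolding power_mult_distrib m(2) rate_sq[OF elim(3)] using V h_pos[of n] elim(3) by (simp del: of_nat_add)
      ultimately show ?case using e0 V h_pos[of n] by simp
    qed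
  qed
  have "\<forall>\<^sub>F n in sequentially. \<forall>\<omega>\<in>space M. (\<forall>p\<in>N n.
     \<bar>(\<Sum>i=1..n. \<phi> n p (X i \<omega>)) / real n - (\<integral>y. f y * \<phi> n p y \<partial>lborel)\<bar> \<le> m * rate n) \<longrightarrow>
     (\<forall>p\<in>N n. \<bar>integral {0..snd p}
     (\<lambda>s. a (\<xi> (fst p) s) \<bullet> (dhat n \<omega> (\<xi> (fst p) s) - mean (h n) (\<xi> (fst p) s)))\<bar> \<le> m * rate n)"
    using eventually_ge_at_top[of 1]
  proof eventually_elim
    case (elim n)
    have eq: "integral {0..snd p} (\<lambda>s. a (\<xi> (fst p) s) \<bullet> (dhat n \<omega> (\<xi> (fst p) s) - mean (h n) (\<xi> (fst p) s)))
        = (\<Sum>i=1..n. \<phi> n p (X i \<omega>)) / real n - (\<integral>y. f y * \<phi> n p y \<partial>lborel)" if "p \<in> N n" for p \<omega>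
    proof -
      obtain x t where p: "p = (x, t)" and S: "(x, t) \<in> S" using N[OF elim(1)] \<open>p \<in> N n\<close> by (cases p) auto
      have i: "(\<lambda>s. a (\<xi> x s) \<bullet> kern (h n) (\<xi> x s) y) integrable_on {0..t}" for y
        by (intro integrable_continuous_interval ciy S)
      have "a (\<xi> x s) \<bullet> dhat n \<omega> (\<xi> x s) = (\<Sum>i=1..n. a (\<xi> x s) \<bullet> kern (h n) (\<xi> x s) (X i \<omega>)) / real n" for s
        by (simp add: d2_kde_eq inner_sum_right divide_inverse mult.commute)
      moreover have "((\<lambda>s. (\<Sum>i=1..n. a (\<xi> x s) \<bullet> kern (h n) (\<xi> x s) (X i \<omega>)) / real n) has_integral
          (\<Sum>i=1..n. \<phi> n p (X i \<omega>)) / real n) {0..t}"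
        unfolding \<phi>_def p fst_conv snd_conv
        by (intro has_integral_divide has_integral_sum integrable_integral i) auto
      ultimately have "((\<lambda>s. a (\<xi> x s) \<bullet> dhat n \<omega> (\<xi> x s)) has_integral (\<Sum>i=1..n. \<phi> n p (X i \<omega>)) / real n) {0..t}"
        by simp
      moreover have "((\<lambda>s. a (\<xi> x s) \<bullet> mean (h n) (\<xi> x s)) has_integral (\<integral>y. f y * \<phi> n p y \<partial>lborel)) {0..t}"
        unfolding p fub1(2)[OF S] by (rule integrable_integral[OF fub1(3)[OF S]])
      ultimately have "((\<lambda>s. a (\<xi> x s) \<bullet> dhat n \<omega> (\<xi> x s) - a (\<xi> x s) \<bullet> mean (h n) (\<xi> x s)) has_integral
          ((\<Sum>i=1..n. \<phi> n p (X i \<omega>)) / real n - (\<integral>y. f y * \<phi> n p y \<partial>lborel))) {0..t}"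
        by (rule has_integral_diff)
      then show ?thesis by (simp add: p inner_diff_right integral_unique)
    qed
    show ?case using eq by simp
  qed
  from whp_mono[OF whp1 this] show ?thesis using m(1) by blast
qed

section \<open>Error of the estimated integral curves\<close>

text \<open>Transfers a bound on an integral along one curve to a neighbouring curve and a neighbouring final
  time, which is how estimates at the points of a net are extended to all curves.\<close>

lemma integral_perturbation:
  fixes \<phi> \<psi> :: "real \<Rightarrow> 'b::euclidean_space"
  assumes c: "continuous_on {0..t} \<phi>" "continuous_on {0..t'} \<psi>" and t: "0 \<le> t" "t \<le> T" "0 \<le> t'" "t' \<le> T"
    and b: "\<And>s. s \<in> {0..t} \<Longrightarrow> norm (\<phi> s) \<le> B" "\<And>s. s \<in> {0..t'} \<Longrightarrow> norm (\<psi> s) \<le> B"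
    and e: "\<And>s. s \<in> {0..min t t'} \<Longrightarrow> norm (\<phi> s - \<psi> s) \<le> e" and d: "\<bar>t - t'\<bar> \<le> \<delta>"
  shows "norm (integral {0..t} \<phi>) \<le> norm (integral {0..t'} \<psi>) + e * T + 2 * B * \<delta>"
proof -
  let ?u = "min t t'"
  have B: "0 \<le> B" using order_trans[OF norm_ge_zero b(1)[of 0]] t by simp
  have e0: "0 \<le> e" using order_trans[OF norm_ge_zero e[of 0]] t by simp
  have i: "\<phi> integrable_on {0..t}" "\<psi> integrable_on {0..t'}"
    using c by (auto intro: integrable_continuous_interval)
  have 1: "integral {0..?u} \<phi> + integral {?u..t} \<phi> = integral {0..t} \<phi>"
    using t i by (intro Henstock_Kurzweil_Integration.integral_combine) auto
  have 2: "integral {0..?u} \<psi> + integral {?u..t'} \<psi> = integral {0..t'} \<psi>"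
    using t i by (intro Henstock_Kurzweil_Integration.integral_combine) auto
  have 3: "integral {0..?u} (\<lambda>s. \<phi> s - \<psi> s) = integral {0..?u} \<phi> - integral {0..?u} \<psi>"
    by (intro Henstock_Kurzweil_Integration.integral_diff integrable_continuous_interval
        continuous_on_subset[OF c(1)] continuous_on_subset[OF c(2)]) auto
  have "integral {0..t} \<phi> = integral {0..t'} \<psi> + integral {0..?u} (\<lambda>s. \<phi> s - \<psi> s)
      + integral {?u..t} \<phi> - integral {?u..t'} \<psi>"
    unfolding 1[symmetric] 2[symmetric] 3 by simp
  then have "norm (integral {0..t} \<phi>) \<le> norm (integral {0..t'} \<psi>) + norm (integral {0..?u} (\<lambda>s. \<phi> s - \<psi> s))
      + norm (integral {?u..t} \<phi>) + norm (integral {?u..t'} \<psi>)"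
    by (simp only:) (intro norm_triangle_le_diff norm_triangle_le add_right_mono norm_triangle_ineq order_refl)
  moreover have "norm (integral {0..?u} (\<lambda>s. \<phi> s - \<psi> s)) \<le> e * (?u - 0)"
    using t e by (intro integral_bound continuous_on_diff continuous_on_subset[OF c(1)] continuous_on_subset[OF c(2)]) auto
  moreover have "e * (?u - 0) \<le> e * T" using t e0 by (intro mult_left_mono) auto
  moreover have "norm (integral {?u..t} \<phi>) \<le> B * (t - ?u)"
    using t b by (intro integral_bound continuous_on_subset[OF c(1)]) auto
  moreover have "B * (t - ?u) \<le> B * \<delta>" using d B by (intro mult_left_mono) auto
  moreover have "norm (integral {?u..t'} \<psi>) \<le> B * (t' - ?u)"
    using t b by (intro integral_bound continuous_on_subset[OF c(2)]) auto
  moreover have "B * (t' - ?u) \<le> B * \<delta>" using d B by (intro mult_left_mono) auto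
  ultimately show ?thesis by linarith
qed

context kde_rate
begin

abbreviation Vhat :: "nat \<Rightarrow> 'a \<Rightarrow> real^2 \<Rightarrow> real^2" where
  "Vhat n \<omega> \<equiv> eigvec_field (kde K h X n \<omega>)"

lemma dhat_continuous: "continuous_on S (dhat n \<omega>)"
  unfolding d2_kde_eq[abs_def] by (intro continuous_intros)

lemma G_fun_continuous: "continuous_on S G_fun"
  by (rule lipschitz_on_continuous_on[of 30], rule lipschitz_onI)
    (use G_fun_lipschitz in \<open>auto simp: dist_norm\<close>)

lemma fields_continuous: "continuous_on S (Vhat n \<omega>)" "continuous_on S (eigvec_field f)"
  unfolding eigvec_field_def[abs_def]
  by (intro continuous_on_compose2[OF G_fun_continuous[of UNIV]] dhat_continuous
      continuous_on_subset[OF d2f_continuous]; simp)+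

lemma mean_continuous:
  assumes "0 < s" "s \<le> 1" shows "continuous_on (cball 0 r) (mean s)"
proof -
  obtain L where L: "L > 0" "\<forall>s x y. 0 < s \<longrightarrow> s \<le> 1 \<longrightarrow> x \<in> cball 0 r \<longrightarrow> y \<in> cball 0 r \<longrightarrow>
    norm (mean s x - mean s y) \<le> L * norm (x - y)"
    by (rule mean_lipschitz[of r, THEN exE]) blast
  then show ?thesis using assms
    by (intro lipschitz_on_continuous_on[of L] lipschitz_onI) (auto simp: dist_norm)
qed

text \<open>Two errors are separated from the centred linear term: the quadratic remainder of \<open>G_fun\<close>,
  controlled by \<open>p\<close>, and the bias of the second derivatives, controlled by \<open>q\<close>.\<close>

lemma field_difference_linearized:
  assumes g: "0 < \<kappa>" "\<kappa> \<le> norm (gap (d2 f x))"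
    and d: "(norm (dhat n \<omega> x - d2 f x))\<^sup>2 \<le> p" and m: "norm (mean (h n) x - d2 f x) \<le> q"
  shows "\<bar>(Vhat n \<omega> x - eigvec_field f x) $ c - G_slope c (d2 f x) \<bullet> (dhat n \<omega> x - mean (h n) x)\<bar>
     \<le> 16 * p / \<kappa> + 14 * q"
proof -
  let ?a = "G_slope c (d2 f x)"
  have "gap (d2 f x) \<noteq> 0" using g by auto
  from G_fun_expansion[OF this, of "dhat n \<omega> x" c]
  have "\<bar>(Vhat n \<omega> x - eigvec_field f x) $ c - ?a \<bullet> (dhat n \<omega> x - d2 f x)\<bar>
      \<le> 16 * (norm (dhat n \<omega> x - d2 f x))\<^sup>2 / norm (gap (d2 f x))"
    by (simp add: eigvec_field_def)
  also have "\<dots> \<le> 16 * p / \<kappa>" using g d order_trans[OF zero_le_power2 d] by (intro frac_le) auto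
  finally have 1: "\<bar>(Vhat n \<omega> x - eigvec_field f x) $ c - ?a \<bullet> (dhat n \<omega> x - d2 f x)\<bar> \<le> 16 * p / \<kappa>" .
  have "\<bar>?a \<bullet> (mean (h n) x - d2 f x)\<bar> \<le> norm ?a * norm (mean (h n) x - d2 f x)" by (rule Cauchy_Schwarz_ineq2)
  also have "\<dots> \<le> 14 * q" using m by (intro mult_mono G_slope_bound) auto
  finally have 2: "\<bar>?a \<bullet> (mean (h n) x - d2 f x)\<bar> \<le> 14 * q" .
  have "?a \<bullet> (dhat n \<omega> x - d2 f x) = ?a \<bullet> (dhat n \<omega> x - mean (h n) x) + ?a \<bullet> (mean (h n) x - d2 f x)"
    by (simp add: inner_diff_right)
  with 1 2 show ?thesis by linarith
qed

text \<open>Componentwise the drift is the integral of the centred linear term, bounded by \<open>w\<close> by hypothesis, plus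
  an integral of the errors in \<open>field_difference_linearized\<close>.\<close>

lemma drift_bound:
  assumes cont: "continuous_on {0..t} c" and H: "\<And>s. s \<in> {0..t} \<Longrightarrow> c s \<in> H" "H \<subseteq> cball 0 r" and t: "0 \<le> t" "t \<le> T"
    and \<kappa>: "0 < \<kappa>" "\<And>x. x \<in> H \<Longrightarrow> \<kappa> \<le> norm (gap (d2 f x))"
    and d: "\<And>x. x \<in> H \<Longrightarrow> (norm (dhat n \<omega> x - d2 f x))\<^sup>2 \<le> p"
    and m: "\<And>x. x \<in> H \<Longrightarrow> norm (mean (h n) x - d2 f x) \<le> q"
    and l: "\<And>j. \<bar>integral {0..t} (\<lambda>s. G_slope j (d2 f (c s)) \<bullet> (dhat n \<omega> (c s) - mean (h n) (c s)))\<bar> \<le> w"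
    and h1: "h n \<le> 1"
  shows "norm (integral {0..t} (\<lambda>s. Vhat n \<omega> (c s) - eigvec_field f (c s))) \<le> 2 * (w + (16 * p / \<kappa> + 14 * q) * T)"
proof -
  let ?D = "\<lambda>s. Vhat n \<omega> (c s) - eigvec_field f (c s)"
  let ?l = "\<lambda>j s. G_slope j (d2 f (c s)) \<bullet> (dhat n \<omega> (c s) - mean (h n) (c s))"
  let ?Q = "16 * p / \<kappa> + 14 * q"
  have cD: "continuous_on {0..t} ?D"
    by (intro continuous_on_diff continuous_on_compose2[OF fields_continuous(1)[of UNIV] cont]
        continuous_on_compose2[OF fields_continuous(2)[of UNIV] cont]) auto
  have cl: "continuous_on {0..t} (?l j)" for j
  proof (intro continuous_on_inner continuous_on_diff)
    have "continuous_on H (\<lambda>x. G_slope j (d2 f x))"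
      using \<kappa> by (intro continuous_on_compose2[OF continuous_on_G_slope[of "d2 f ` H"]]
          continuous_on_subset[OF d2f_continuous]) force+
    then show "continuous_on {0..t} (\<lambda>s. G_slope j (d2 f (c s)))"
      by (rule continuous_on_compose2[OF _ cont]) (use H in auto)
    show "continuous_on {0..t} (\<lambda>s. dhat n \<omega> (c s))"
      by (rule continuous_on_compose2[OF dhat_continuous[of UNIV] cont]) auto
    show "continuous_on {0..t} (\<lambda>s. mean (h n) (c s))"
      by (rule continuous_on_compose2[OF mean_continuous[OF h_pos h1, of r] cont]) (use H in blast)
  qed
  have "\<bar>integral {0..t} ?D $ j\<bar> \<le> w + ?Q * T" for j
  proof -
    have "?D integrable_on {0..t}" using cD by (rule integrable_continuous_interval)
    then have "integral {0..t} ?D $ j = integral {0..t} (\<lambda>s. ?D s $ j)"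
      by (rule integral_component_eq_cart[symmetric])
    also have "\<dots> = integral {0..t} (\<lambda>s. ?l j s + (?D s $ j - ?l j s))" by simp
    also have "\<dots> = integral {0..t} (?l j) + integral {0..t} (\<lambda>s. ?D s $ j - ?l j s)"
      by (intro Henstock_Kurzweil_Integration.integral_add integrable_continuous_interval
          continuous_on_diff cl continuous_on_component cD)
    finally have "\<bar>integral {0..t} ?D $ j\<bar> \<le> w + norm (integral {0..t} (\<lambda>s. ?D s $ j - ?l j s))"
      using l[of j] by simp
    moreover have "norm (integral {0..t} (\<lambda>s. ?D s $ j - ?l j s)) \<le> ?Q * (t - 0)"
    proof (rule integral_bound)
      show "continuous_on {0..t} (\<lambda>s. ?D s $ j - ?l j s)"
        by (rule continuous_on_diff[OF continuous_on_component[OF cD] cl])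
      show "norm (?D s $ j - ?l j s) \<le> ?Q" if "s \<in> {0..t}" for s
        using field_difference_linearized[OF \<kappa>(1) \<kappa>(2) d m, of "c s" j] H(1)[OF that] by simp
    qed (use t in auto)
    moreover have "?Q * (t - 0) \<le> ?Q * T"
    proof (rule mult_left_mono)
      have "c 0 \<in> H" using H(1) t by auto
      then show "0 \<le> ?Q" using order_trans[OF zero_le_power2 d] order_trans[OF norm_ge_zero m] \<kappa>(1) by auto
    qed (use t in auto)
    ultimately show ?thesis by linarith
  qed
  from norm_le_componentwise[OF this] show ?thesis by simp
qed

text \<open>Curves are followed for positive times only; the sign \<open>\<sigma>\<close> allows the reversed flow as well. The
  drift is bounded first for a net of pairs of starting points and times. Since nearby
  solutions of the true equation stay close, \<open>integral_perturbation\<close> extends the bound to all pairs,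
  and \<open>ode_comparison\<close> concludes.\<close>

lemma whp_curves:
  fixes \<xi> :: "real^2 \<Rightarrow> real \<Rightarrow> real^2" and \<xi>h :: "nat \<Rightarrow> 'a \<Rightarrow> real^2 \<Rightarrow> real \<Rightarrow> real^2"
    and \<tau> :: "real^2 \<Rightarrow> real" and \<sigma> \<gamma> :: real
  assumes \<sigma>: "\<bar>\<sigma>\<bar> = 1"
    and \<xi>: "\<And>x t. x \<in> P \<Longrightarrow> t \<in> {0..\<tau> x} \<Longrightarrow> (\<xi> x has_vector_derivative \<sigma> *\<^sub>R eigvec_field f (\<xi> x t)) (at t)"
      "\<And>x. x \<in> P \<Longrightarrow> \<xi> x 0 = x"
    and \<xi>h: "\<And>n \<omega> x t. n \<ge> 1 \<Longrightarrow> \<omega> \<in> space M \<Longrightarrow> x \<in> P \<Longrightarrow> t \<in> {0..\<tau> x} \<Longrightarrow>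
        (\<xi>h n \<omega> x has_vector_derivative \<sigma> *\<^sub>R Vhat n \<omega> (\<xi>h n \<omega> x t)) (at t)"
      "\<And>n \<omega> x. n \<ge> 1 \<Longrightarrow> \<omega> \<in> space M \<Longrightarrow> x \<in> P \<Longrightarrow> \<xi>h n \<omega> x 0 = x"
    and H: "compact H" "\<And>x. x \<in> H \<Longrightarrow> gap (d2 f x) \<noteq> 0"
    and \<tau>: "\<And>x. x \<in> P \<Longrightarrow> 0 \<le> \<tau> x" and inH: "\<And>x s. x \<in> P \<Longrightarrow> s \<in> {0..\<tau> x} \<Longrightarrow> \<xi> x s \<in> H"
    and \<gamma>: "\<gamma> > 0" and ca: "\<And>x s u. x \<in> P \<Longrightarrow> 0 \<le> s \<Longrightarrow> s < u \<Longrightarrow> u \<le> \<tau> x \<Longrightarrow>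
       \<gamma> * (u - s) \<le> norm (\<xi> x u - \<xi> x s)"
  shows "\<exists>C>0. whp M (\<lambda>n \<omega>. \<forall>x\<in>P. \<forall>t\<in>{0..\<tau> x}. norm (\<xi>h n \<omega> x t - \<xi> x t) \<le> C * rate n)"
proof -
  obtain r0 where r0: "r0 > 0" "\<And>x. x \<in> H \<Longrightarrow> norm x \<le> r0"
    using compact_imp_bounded[OF H(1)] unfolding bounded_pos by blast
  \<comment> \<open>The ball of radius \<open>r\<close> contains the neighbourhood of radius 1 of \<open>H\<close>, to which \<open>ode_comparison\<close> confines the estimated curves.\<close>
  define r where "r = r0 + 1"
  have Hr: "H \<subseteq> cball 0 r" and Hn: "\<And>z. z \<in> H \<Longrightarrow> norm z \<le> r" using r0 by (force simp: r_def)+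
  \<comment> \<open>The end points of a curve are at most \<open>2 * r0\<close> apart, so the chord-arc inequality bounds the length of the time interval.\<close>
  define T where "T = 2 * r0 / \<gamma>"
  have T: "T > 0" using r0 \<gamma> by (simp add: T_def)
  have \<tau>T: "\<tau> x \<le> T" if x: "x \<in> P" for x
  proof (cases "\<tau> x = 0")
    case False
    then have "\<gamma> * (\<tau> x - 0) \<le> norm (\<xi> x (\<tau> x) - \<xi> x 0)" using \<tau>[OF x] by (intro ca x) auto
    also have "\<dots> \<le> r0 + r0"
      using r0(2)[OF inH[OF x, of "\<tau> x"]] r0(2)[OF inH[OF x, of 0]] \<tau>[OF x]
        norm_triangle_ineq4[of "\<xi> x (\<tau> x)" "\<xi> x 0"] by auto
    finally show ?thesis using \<gamma> by (simp add: T_def pos_le_divide_eq mult.commute)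
  qed (use T in simp)
  have cont: "continuous_on {0..t} (\<xi> x)" if "x \<in> P" "t \<le> \<tau> x" for x t
    using has_vector_derivative_continuous[OF \<xi>(1)[OF that(1)]] that
    by (auto intro!: continuous_at_imp_continuous_on)
  define S where "S = {(x, t). x \<in> P \<and> 0 \<le> t \<and> t \<le> \<tau> x}"
  have "S \<subseteq> H \<times> {0..T}" using inH \<xi>(2) \<tau> \<tau>T by (fastforce simp: S_def)
  then have "bounded S" by (rule bounded_subset[rotated]) (intro bounded_Times compact_imp_bounded H bounded_closed_interval)
  from net_sequence[OF this] obtain CN N where CN: "CN > 0"
    and net: "\<forall>n\<ge>1. N n \<subseteq> S \<and> finite (N n) \<and> real (card (N n)) \<le> CN * real n ^ (2 * DIM((real^2) \<times> real)) \<and>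
     (\<forall>x\<in>S. \<exists>y\<in>N n. norm (x - y) \<le> 1 / (real n)\<^sup>2)" by blast
  obtain \<kappa> where \<kappa>: "\<kappa> > 0" "\<And>x. x \<in> H \<Longrightarrow> \<kappa> \<le> norm (gap (d2 f x))"
  proof (cases "H = {}")
    case False
    have "continuous_on H (\<lambda>x. norm (gap (d2 f x)))"
      by (intro continuous_on_norm continuous_on_compose2[OF continuous_on_gap[of UNIV]]
          continuous_on_subset[OF d2f_continuous]) auto
    from continuous_attains_inf[OF H(1) False this] obtain x0 where "x0 \<in> H"
      "\<forall>x\<in>H. norm (gap (d2 f x0)) \<le> norm (gap (d2 f x))" by blast
    then show ?thesis using that[of "norm (gap (d2 f x0))"] H(2) by auto
  qed (use that[of 1] in auto)
  obtain L1 where L1: "L1 > 0" "whp M (\<lambda>n \<omega>. \<forall>x\<in>cball 0 r. \<forall>y\<in>cball 0 r.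
      norm (dhat n \<omega> x - dhat n \<omega> y) \<le> L1 * norm (x - y) + L1 / real n)"
    using whp_dhat_lipschitz by blast
  obtain C2 where C2: "C2 > 0" "whp M (\<lambda>n \<omega>. \<forall>x\<in>cball 0 r. (norm (dhat n \<omega> x - d2 f x))\<^sup>2 \<le> C2 * rate n)"
    using whp_dhat_deviation by blast
  define I where "I j n \<omega> p = integral {0..snd p} (\<lambda>s. G_slope j (d2 f (\<xi> (fst p) s))
       \<bullet> (dhat n \<omega> (\<xi> (fst p) s) - mean (h n) (\<xi> (fst p) s)))"
    for j n \<omega> p
  have E3: "\<exists>m>0. whp M (\<lambda>n \<omega>. \<forall>p\<in>N n. \<bar>I j n \<omega> p\<bar> \<le> m * rate n)" for j
    unfolding I_def
  proof (rule whp_curve_integrals[where S = S and H = H and r = r and \<gamma> = \<gamma> and T = T and A = 14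
        and C = CN and k = "2 * DIM((real^2) \<times> real)"])
    show "continuous_on H (\<lambda>x. G_slope j (d2 f x))"
      using H(2) by (intro continuous_on_compose2[OF continuous_on_G_slope[of "d2 f ` H"]]
          continuous_on_subset[OF d2f_continuous]) auto
  qed (use cont inH Hr ca \<gamma> \<tau>T T G_slope_bound net in \<open>auto simp: S_def intro: order_trans\<close>)
  obtain m1 where m1: "m1 > 0" "whp M (\<lambda>n \<omega>. \<forall>p\<in>N n. \<bar>I 1 n \<omega> p\<bar> \<le> m1 * rate n)" using E3[of 1] by blast
  obtain m2 where m2: "m2 > 0" "whp M (\<lambda>n \<omega>. \<forall>p\<in>N n. \<bar>I 2 n \<omega> p\<bar> \<le> m2 * rate n)" using E3[of 2] by blast
  obtain Bb where Bb: "Bb > 0" "\<forall>s x. 0 < s \<longrightarrow> s \<le> 1 \<longrightarrow> x \<in> cball 0 r \<longrightarrow> norm (mean s x - d2 f x) \<le> Bb * s\<^sup>2"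
    by (rule mean_bias[of r, THEN exE]) blast
  obtain Hh where Hh: "Hh > 0" "\<forall>\<^sub>F n in sequentially. (h n)\<^sup>2 \<le> Hh * rate n"
    using eventually_h_sq_le_rate by blast
  obtain Lf where Lf: "Lf > 0" "\<And>x y. x \<in> cball 0 r \<Longrightarrow> y \<in> cball 0 r \<Longrightarrow> norm (d2 f x - d2 f y) \<le> Lf * norm (x - y)"
    using d2f_lipschitz[of r] by blast
  define m where "m = m1 + m2"
  define C3 where "C3 = 2 * (m + (16 * C2 / \<kappa> + 14 * (Bb * Hh)) * T)"
  define E where "E = exp (30 * Lf * T)"
  define Q where "Q = (30 * L1 + 30 * Lf) * E + 30 * L1"
  define C4 where "C4 = C3 + Q * T + 60"
  define C5 where "C5 = (C4 + 30 * L1 * T) * exp (30 * L1 * T)"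
  have C3: "C3 > 0" using m1 m2 C2 \<kappa>(1) Bb(1) Hh(1) T by (simp add: C3_def m_def add_pos_pos)
  have Q: "Q > 0" using L1 Lf by (simp add: Q_def E_def add_pos_pos)
  have C4: "C4 > 0" using C3 Q T by (simp add: C4_def add_pos_pos)
  have C5: "C5 > 0" using C4 L1 T by (simp add: C5_def add_pos_pos)
  have Vlip: "norm (\<sigma> *\<^sub>R eigvec_field f x - \<sigma> *\<^sub>R eigvec_field f y) \<le> 30 * Lf * norm (x - y)"
    if "x \<in> cball 0 r" "y \<in> cball 0 r" for x y
    using G_fun_lipschitz[of "d2 f x" "d2 f y"] Lf(2)[OF that] \<sigma>
    by (simp add: eigvec_field_def flip: scaleR_diff_right)
  \<comment> \<open>The true curves remain in \<open>H\<close>, where the true field is Lipschitz, so \<open>ode_comparison\<close> applies with both fields equal and without drift.\<close>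
  have flow: "norm (\<xi> y s - \<xi> x s) \<le> norm (y - x) * E"
    if xy: "x \<in> P" "y \<in> P" and s: "0 \<le> s" "s \<le> \<tau> x" "s \<le> \<tau> y" and small: "norm (y - x) * E < 1" for x y s
  proof -
    have le: "exp (30 * Lf * s) \<le> E" using s \<tau>T[OF xy(1)] Lf(1) by (simp add: E_def)
    have "norm (\<xi> y s - \<xi> x s) \<le> (norm (\<xi> y 0 - \<xi> x 0) + 0 + 0 * s) * exp (30 * Lf * s)"
    proof (rule ode_comparison[where V = "\<lambda>z. \<sigma> *\<^sub>R eigvec_field f z" and W = "\<lambda>z. \<sigma> *\<^sub>R eigvec_field f z"])
      show "(norm (\<xi> y 0 - \<xi> x 0) + 0 + 0 * s) * exp (30 * Lf * s) < 1"
        using small mult_left_mono[OF le norm_ge_zero[of "y - x"]] by (simp add: \<xi>(2) xy)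
      show "norm (\<sigma> *\<^sub>R eigvec_field f (\<xi> y t) - \<sigma> *\<^sub>R eigvec_field f (\<xi> x t)) \<le> 30 * Lf * norm (\<xi> y t - \<xi> x t) + 0"
        if "t \<in> {0..s}" for t
        using Vlip[of "\<xi> y t" "\<xi> x t"] inH[OF xy(1), of t] Hn inH[OF xy(2), of t] that s by auto
    qed (use \<xi>(1) xy s Lf(1) cont in \<open>auto intro!: continuous_intros continuous_on_compose2[OF fields_continuous(2)[of UNIV]]\<close>)
    also have "\<dots> \<le> norm (y - x) * E" using le by (simp add: \<xi>(2) xy mult_left_mono)
    finally show ?thesis .
  qed
  have "\<forall>\<^sub>F n in sequentially. rate n < 1 / (C5 + C2)"
  proof (rule eventually_mono[OF eventually_rate_le[of "1 / (C5 + C2) / 2"]])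
    show "rate n < 1 / (C5 + C2)" if "rate n \<le> 1 / (C5 + C2) / 2" for n
      using that C5 C2(1) by (smt (verit) divide_pos_pos field_sum_of_halves)
  qed (use C5 C2(1) in simp)
  moreover have "\<forall>\<^sub>F n in sequentially. inverse (real n) < 1 / E"
    using order_tendstoD(2)[OF lim_inverse_n, of "1 / E"] by (simp add: E_def)
  ultimately have main: "\<forall>\<^sub>F n in sequentially. \<forall>\<omega>\<in>space M.
     (\<forall>x\<in>cball 0 r. \<forall>y\<in>cball 0 r. norm (dhat n \<omega> x - dhat n \<omega> y) \<le> L1 * norm (x - y) + L1 / real n) \<and>
     (\<forall>x\<in>cball 0 r. (norm (dhat n \<omega> x - d2 f x))\<^sup>2 \<le> C2 * rate n) \<and>
     (\<forall>p\<in>N n. \<bar>I 1 n \<omega> p\<bar> \<le> m1 * rate n) \<and>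
     (\<forall>p\<in>N n. \<bar>I 2 n \<omega> p\<bar> \<le> m2 * rate n) \<longrightarrow>
     (\<forall>x\<in>P. \<forall>t\<in>{0..\<tau> x}. norm (\<xi>h n \<omega> x t - \<xi> x t) \<le> C5 * rate n)"
    using Hh(2) eventually_h_le_1 eventually_inverse_le_rate eventually_ge_at_top[of 1]
  proof eventually_elim
    case (elim n)
    note n = elim(6)
    have rn: "0 \<le> rate n" by (rule rate_nonneg[OF n])
    have n0: "0 < real n" using n by simp
    have r1: "C5 * rate n < 1" "C2 * rate n \<le> 1"
    proof -
      have "(C5 + C2) * rate n < 1" using elim(1) C5 C2(1) by (simp add: pos_less_divide_eq mult.commute)
      moreover have "0 \<le> C5 * rate n" "0 \<le> C2 * rate n" using rn C5 C2(1) by auto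
      ultimately show "C5 * rate n < 1" "C2 * rate n \<le> 1" by (simp_all add: distrib_right)
    qed
    show ?case
    proof (intro ballI impI, elim conjE)
      fix \<omega> x t
      assume \<omega>: "\<omega> \<in> space M" and xP: "x \<in> P" and tx: "t \<in> {0..\<tau> x}"
        and e1: "\<forall>x\<in>cball 0 r. \<forall>y\<in>cball 0 r. norm (dhat n \<omega> x - dhat n \<omega> y) \<le> L1 * norm (x - y) + L1 / real n"
        and e2: "\<forall>x\<in>cball 0 r. (norm (dhat n \<omega> x - d2 f x))\<^sup>2 \<le> C2 * rate n"
        and e3: "\<forall>p\<in>N n. \<bar>I 1 n \<omega> p\<bar> \<le> m1 * rate n"
        and e4: "\<forall>p\<in>N n. \<bar>I 2 n \<omega> p\<bar> \<le> m2 * rate n"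
      let ?D = "\<lambda>z. Vhat n \<omega> z - eigvec_field f z"
      have Vhlip: "norm (Vhat n \<omega> y - Vhat n \<omega> z) \<le> 30 * L1 * norm (y - z) + 30 * L1 / real n"
        if "y \<in> cball 0 r" "z \<in> cball 0 r" for y z
        using G_fun_lipschitz[of "dhat n \<omega> y" "dhat n \<omega> z"] bspec[OF bspec[OF e1 that(1)] that(2)]
        by (simp add: eigvec_field_def)
      have Dlip: "norm (?D y - ?D z) \<le> (30 * L1 + 30 * Lf) * norm (y - z) + 30 * L1 / real n"
        if yz: "y \<in> cball 0 r" "z \<in> cball 0 r" for y z
      proof -
        have "norm (eigvec_field f y - eigvec_field f z) \<le> 30 * Lf * norm (y - z)"
          using Vlip[OF yz] \<sigma> by (simp flip: scaleR_diff_right)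
        moreover have "norm (?D y - ?D z) \<le> norm (Vhat n \<omega> y - Vhat n \<omega> z) + norm (eigvec_field f y - eigvec_field f z)"
          using norm_triangle_ineq4[of "Vhat n \<omega> y - Vhat n \<omega> z" "eigvec_field f y - eigvec_field f z"]
          by (simp add: algebra_simps)
        ultimately show ?thesis using Vhlip[OF yz] by (simp add: distrib_right)
      qed
      have Dbd: "norm (?D z) \<le> 30" if "z \<in> cball 0 r" for z
      proof -
        have "(norm (dhat n \<omega> z - d2 f z))\<^sup>2 \<le> 1\<^sup>2" using bspec[OF e2 that] r1 by simp
        then have "norm (dhat n \<omega> z - d2 f z) \<le> 1" by (rule power2_le_imp_le) simp
        then show ?thesis using G_fun_lipschitz[of "dhat n \<omega> z" "d2 f z"] by (simp add: eigvec_field_def)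
      qed
      have cD: "continuous_on {0..t} (\<lambda>s. ?D (\<xi> x s))" if "x \<in> P" "t \<le> \<tau> x" for x t
        by (intro continuous_on_diff continuous_on_compose2[OF fields_continuous(1)[of UNIV] cont[OF that]]
            continuous_on_compose2[OF fields_continuous(2)[of UNIV] cont[OF that]]) auto
      have netb: "norm (integral {0..t} (\<lambda>s. ?D (\<xi> x s))) \<le> C3 * rate n" if p: "(x, t) \<in> N n" for x t
      proof -
        have S: "x \<in> P" "0 \<le> t" "t \<le> \<tau> x" using net n p by (auto simp: S_def)
        have "norm (integral {0..t} (\<lambda>s. ?D (\<xi> x s)))
            \<le> 2 * (m * rate n + (16 * (C2 * rate n) / \<kappa> + 14 * (Bb * Hh * rate n)) * T)"
        proof (rule drift_bound[where H = H and r = r])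
          show "norm (mean (h n) z - d2 f z) \<le> Bb * Hh * rate n" if "z \<in> H" for z
          proof -
            have "norm (mean (h n) z - d2 f z) \<le> Bb * (h n)\<^sup>2"
              by (rule Bb(2)[rule_format]) (use h_pos elim(4) that Hn in auto)
            also have "\<dots> \<le> Bb * (Hh * rate n)" using elim(3) Bb(1) by (intro mult_left_mono) auto
            finally show ?thesis by simp
          qed
          show "\<bar>integral {0..t} (\<lambda>s. G_slope j (d2 f (\<xi> x s)) \<bullet> (dhat n \<omega> (\<xi> x s) - mean (h n) (\<xi> x s)))\<bar> \<le> m * rate n" for j
          proof -
            have "m1 * rate n \<le> m * rate n" "m2 * rate n \<le> m * rate n"
              using m1(1) m2(1) rn by (auto simp: m_def intro!: mult_right_mono)
            moreover have "j = 1 \<or> j = 2" by (rule exhaust_2)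
            ultimately show ?thesis using bspec[OF e3 p] bspec[OF e4 p] by (auto simp: I_def)
          qed
          show "(norm (dhat n \<omega> z - d2 f z))\<^sup>2 \<le> C2 * rate n" if "z \<in> H" for z using e2 that Hr by blast
        qed (use S cont inH Hr \<kappa> elim(4) \<tau>T[OF S(1)] in auto)
        also have "\<dots> = C3 * rate n" by (simp add: C3_def algebra_simps)
        finally show ?thesis .
      qed
      have drift: "norm (integral {0..t} (\<lambda>s. ?D (\<xi> x s))) \<le> C4 * rate n" if t: "t \<in> {0..\<tau> x}" for t
      proof -
        have "(x, t) \<in> S" using t xP by (simp add: S_def)
        then obtain y u where p: "(y, u) \<in> N n" and "norm ((x, t) - (y, u)) \<le> 1 / (real n)\<^sup>2"
          using net n by (metis surj_pair)
        moreover have "1 / (real n)\<^sup>2 \<le> 1 / real n" using n by (simp add: field_simps power2_eq_square)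
        ultimately have near: "norm (x - y) \<le> 1 / real n" "\<bar>t - u\<bar> \<le> 1 / real n"
          using norm_fst_le[of "x - y" "t - u"] norm_snd_le[of "t - u" "x - y"] by auto
        have yS: "y \<in> P" "0 \<le> u" "u \<le> \<tau> y" using net n p by (auto simp: S_def)
        have E0: "E > 0" by (simp add: E_def)
        have close: "norm (x - y) * E \<le> E / real n" using mult_right_mono[OF near(1), of E] E0 by simp
        moreover have "E / real n < 1" using elim(2) E0 n0 by (simp add: field_simps)
        ultimately have small: "norm (x - y) * E < 1" by linarith
        have "norm (integral {0..t} (\<lambda>s. ?D (\<xi> x s))) \<le> norm (integral {0..u} (\<lambda>s. ?D (\<xi> y s)))
           + (Q / real n) * T + 2 * 30 * (1 / real n)"
        proof (rule integral_perturbation[OF cD cD])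
          show "norm (?D (\<xi> x s) - ?D (\<xi> y s)) \<le> Q / real n" if s: "s \<in> {0..min t u}" for s
          proof -
            have in_r: "\<xi> x s \<in> cball 0 r" "\<xi> y s \<in> cball 0 r" using inH[OF xP, of s] inH[OF yS(1), of s] s t yS Hn by auto
            have "norm (\<xi> x s - \<xi> y s) \<le> norm (x - y) * E"
              using s t yS by (intro flow xP small) auto
            then have "norm (\<xi> x s - \<xi> y s) \<le> E / real n" using close by linarith
            then have "(30 * L1 + 30 * Lf) * norm (\<xi> x s - \<xi> y s) \<le> (30 * L1 + 30 * Lf) * (E / real n)"
              using L1(1) Lf(1) by (intro mult_left_mono) auto
            then have "norm (?D (\<xi> x s) - ?D (\<xi> y s)) \<le> (30 * L1 + 30 * Lf) * (E / real n) + 30 * L1 / real n"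
              using Dlip[OF in_r] by linarith
            also have "\<dots> = Q / real n" by (simp add: Q_def add_divide_distrib)
            finally show ?thesis .
          qed
          show "norm (?D (\<xi> x s)) \<le> 30" if "s \<in> {0..t}" for s
            using Dbd[of "\<xi> x s"] inH[OF xP, of s] that t Hn by auto
          show "norm (?D (\<xi> y s)) \<le> 30" if "s \<in> {0..u}" for s
            using Dbd[of "\<xi> y s"] inH[OF yS(1), of s] that yS Hn by auto
        qed (use t yS xP \<tau>T[OF xP] \<tau>T[OF yS(1)] near in auto)
        also have "\<dots> \<le> C3 * rate n + (Q * T + 60) * (1 / real n)"
          using netb[OF p] by (simp add: algebra_simps add_divide_distrib)
        also have "\<dots> \<le> C3 * rate n + (Q * T + 60) * rate n"
          using elim(5) Q T by (intro add_left_mono mult_left_mono) auto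
        finally show ?thesis by (simp add: C4_def algebra_simps)
      qed
      let ?b = "(norm (\<xi>h n \<omega> x 0 - \<xi> x 0) + C4 * rate n + (30 * L1 / real n) * \<tau> x) * exp (30 * L1 * \<tau> x)"
      have bC5: "?b \<le> C5 * rate n"
      proof -
        have "(30 * L1 / real n) * \<tau> x \<le> (30 * L1 * rate n) * T"
          using elim(5) L1(1) \<tau>[OF xP] \<tau>T[OF xP] rn mult_left_mono[OF elim(5), of "30 * L1"] by (intro mult_mono) auto
        then have "?b \<le> (C4 * rate n + (30 * L1 * rate n) * T) * exp (30 * L1 * T)"
          using \<xi>(2)[OF xP] \<xi>h(2)[OF n \<omega> xP] L1(1) \<tau>[OF xP] \<tau>T[OF xP] C4 rn T
          by (intro mult_mono) auto
        also have "\<dots> = C5 * rate n" by (simp add: C5_def algebra_simps)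
        finally show ?thesis .
      qed
      have "norm (\<xi>h n \<omega> x t - \<xi> x t) \<le> ?b"
      proof (rule ode_comparison[where V = "\<lambda>z. \<sigma> *\<^sub>R eigvec_field f z" and W = "\<lambda>z. \<sigma> *\<^sub>R Vhat n \<omega> z"])
        show "?b < 1" using bC5 r1 by linarith
        show "norm (integral {0..s} (\<lambda>s. \<sigma> *\<^sub>R Vhat n \<omega> (\<xi> x s) - \<sigma> *\<^sub>R eigvec_field f (\<xi> x s))) \<le> C4 * rate n"
          if "s \<in> {0..\<tau> x}" for s
          using drift[OF that] \<sigma> by (simp flip: scaleR_diff_right)
        show "norm (\<sigma> *\<^sub>R Vhat n \<omega> (\<xi>h n \<omega> x s) - \<sigma> *\<^sub>R Vhat n \<omega> (\<xi> x s))
            \<le> 30 * L1 * norm (\<xi>h n \<omega> x s - \<xi> x s) + 30 * L1 / real n"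
          if s: "s \<in> {0..\<tau> x}" and le: "norm (\<xi>h n \<omega> x s - \<xi> x s) \<le> 1" for s
        proof -
          have "norm (\<xi> x s) \<le> r0" using r0(2) inH[OF xP s] by blast
          then have "\<xi> x s \<in> cball 0 r" "\<xi>h n \<omega> x s \<in> cball 0 r"
            using le norm_triangle_sub[of "\<xi>h n \<omega> x s" "\<xi> x s"] by (auto simp: r_def)
          from Vhlip[OF this(2,1)] show ?thesis using \<sigma> by (simp flip: scaleR_diff_right)
        qed
        have ch: "continuous_on {0..\<tau> x} (\<xi>h n \<omega> x)"
          using has_vector_derivative_continuous[OF \<xi>h(1)[OF n \<omega> xP]] by (auto intro!: continuous_at_imp_continuous_on)
        show "continuous_on {0..\<tau> x} (\<lambda>s. \<sigma> *\<^sub>R Vhat n \<omega> (\<xi>h n \<omega> x s))"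
          by (intro continuous_intros continuous_on_compose2[OF fields_continuous(1)[of UNIV] ch]) auto
        show "continuous_on {0..\<tau> x} (\<lambda>s. \<sigma> *\<^sub>R Vhat n \<omega> (\<xi> x s))"
          by (intro continuous_intros continuous_on_compose2[OF fields_continuous(1)[of UNIV] cont[OF xP order_refl]]) auto
        show "continuous_on {0..\<tau> x} (\<lambda>s. \<sigma> *\<^sub>R eigvec_field f (\<xi> x s))"
          by (intro continuous_intros continuous_on_compose2[OF fields_continuous(2)[of UNIV] cont[OF xP order_refl]]) auto
      qed (use L1(1) n0 tx \<xi>(1)[OF xP] \<xi>h(1)[OF n \<omega> xP] in auto)
      then show "norm (\<xi>h n \<omega> x t - \<xi> x t) \<le> C5 * rate n" using bC5 by linarith
    qed
  qed
  have "whp M (\<lambda>n \<omega>. \<forall>x\<in>P. \<forall>t\<in>{0..\<tau> x}. norm (\<xi>h n \<omega> x t - \<xi> x t) \<le> C5 * rate n)"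
    by (rule whp_mono[OF whp_conj[OF L1(2) whp_conj[OF C2(2) whp_conj[OF m1(2) m2(2)]]] main])
  with C5 show ?thesis by blast
qed

end

section \<open>The uniform rate\<close>

theorem theorem3p3:
  fixes M :: "'a measure"
    and f K :: "real^2 \<Rightarrow> real"
    and X :: "nat \<Rightarrow> 'a \<Rightarrow> real^2"
    and h :: "nat \<Rightarrow> real"
    and \<H> \<L> \<G> :: "(real^2) set"
    and \<XX> :: "real^2 \<Rightarrow> real \<Rightarrow> real^2"
    and \<XX>hat :: "nat \<Rightarrow> 'a \<Rightarrow> real^2 \<Rightarrow> real \<Rightarrow> real^2"
    and Tmin Tmax :: "real^2 \<Rightarrow> real"
    and a_star \<gamma> \<epsilon>\<^sub>0 \<mu>\<^sub>2 \<beta> :: real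
  \<comment> \<open>density, sample and bandwidths\<close>
  assumes "prob_space M"
    and "prob_density f"
    and "prob_space.indep_vars M (\<lambda>_. borel) X {1..}"
    and "\<And>i. i \<ge> 1 \<Longrightarrow> distributed M lborel (X i) (\<lambda>x. ennreal (f x))"
    and "\<And>n. h n > 0"
  \<comment> \<open>integral curves of the true and of the estimated eigenvector field\<close>
    and "\<And>x0. integral_curve (eigvec_field f) x0 (\<XX> x0)"
    and "\<And>n \<omega> x0. n \<ge> 1 \<Longrightarrow> \<omega> \<in> space M \<Longrightarrow>
           integral_curve (eigvec_field (kde K h X n \<omega>)) x0 (\<XX>hat n \<omega> x0)"
  \<comment> \<open>filament and starting set\<close>
    and "is_curve \<L>" and "\<L> \<subseteq> \<H>" and "\<And>x. x \<in> \<L> \<Longrightarrow> filament_point f x"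
    and "a_star > 0" and "\<G> = starting_set \<XX> \<L> a_star" and "\<G> \<subseteq> \<H>"
  \<comment> \<open>time intervals\<close>
    and "\<And>x0. x0 \<in> \<G> \<Longrightarrow> Tmin x0 \<ge> 0 \<and> Tmax x0 \<ge> 0 \<and> Tmin x0 + Tmax x0 > 0"
    and "continuous_on \<G> Tmin" and "continuous_on \<G> Tmax"
    and "\<And>x0. x0 \<in> \<G> \<Longrightarrow> \<XX> x0 ` {- Tmin x0..Tmax x0} \<subseteq> \<H>"
    and "\<gamma> > 0"
    and "(INF x0\<in>\<G>. INF (s, u)\<in>{(s, u). - Tmin x0 \<le> s \<and> s < u \<and> u \<le> Tmax x0}.
            ennreal (norm ((1 / (u - s)) *\<^sub>R
              integral {s..u} (\<lambda>l. eigvec_field f (\<XX> x0 l))))) \<ge> ennreal \<gamma>"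
  \<comment> \<open>(a)\<close>
    and "times_continuously_differentiable 4 f" and "bounded_pderivs 1 4 f"
  \<comment> \<open>(b)\<close>
    and "compact \<H>"
    and "\<epsilon>\<^sub>0 > 0" and "\<And>x. x \<in> enlargement \<H> \<epsilon>\<^sub>0 \<Longrightarrow> f x > 0"
    and "\<And>x. x \<in> \<H> \<Longrightarrow>
           \<exists>l1 l2. l1 \<noteq> l2 \<and> eigenvalue (Hessian f x) l1 \<and> eigenvalue (Hessian f x) l2"
  \<comment> \<open>(c)\<close>
    and "prob_density K" and "times_differentiable 4 K" and "\<And>x. K (- x) = K x"
    and "support K = cball 0 1" and "bounded_pderivs 1 4 K"
    and "has_bochner_integral lborel (\<lambda>x. K x *\<^sub>R outer_prod x x) (mat \<mu>\<^sub>2)"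
    and "integrable lborel (\<lambda>x. outer_prod (d2 K x) (d2 K x))"
  \<comment> \<open>(d)\<close>
    and "decseq h" and "h \<longlonglongrightarrow> 0"
    and "filterlim (\<lambda>n. real n * h n ^ 8 / (ln (real n)) ^ 3) at_top sequentially"
    and "\<beta> \<ge> 0" and "(\<lambda>n. real n * h n ^ 9) \<longlonglongrightarrow> \<beta>"
  shows "bigO_in_prob M
           (\<lambda>n \<omega>. SUP x0\<in>\<G>. SUP t\<in>{- Tmin x0..Tmax x0}.
              ennreal (norm (\<XX>hat n \<omega> x0 t - \<XX> x0 t)))
           (\<lambda>n. sqrt (ln (real n) / (real n * h n ^ 5)))"
proof -
  note A = assms
  interpret kde_rate M X f K h \<beta>
  proof -
    interpret prob_space M by (rule A(1))
    show "kde_rate M X f K h \<beta>"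
      by unfold_locales (use A in auto)
  qed
  have FTC: "integral {s..u} (\<lambda>l. eigvec_field f (\<XX> x0 l)) = \<XX> x0 u - \<XX> x0 s" if "s \<le> u" for x0 s u
    using that A(6)[of x0]
    by (intro integral_unique fundamental_theorem_of_calculus)
      (auto simp: integral_curve_def intro: has_vector_derivative_at_within)
  \<comment> \<open>The averages of the field in the hypothesis are difference quotients of the curve.\<close>
  have chord: "\<gamma> * (u - s) \<le> norm (\<XX> x0 u - \<XX> x0 s)"
    if x0: "x0 \<in> \<G>" and su: "- Tmin x0 \<le> s" "s < u" "u \<le> Tmax x0" for x0 s u
  proof -
    let ?a = "norm ((1 / (u - s)) *\<^sub>R integral {s..u} (\<lambda>l. eigvec_field f (\<XX> x0 l)))"
    have "ennreal \<gamma> \<le> (INF x0\<in>\<G>. INF (s, u)\<in>{(s, u). - Tmin x0 \<le> s \<and> s < u \<and> u \<le> Tmax x0}.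
            ennreal (norm ((1 / (u - s)) *\<^sub>R integral {s..u} (\<lambda>l. eigvec_field f (\<XX> x0 l)))))"
      by (rule A(19))
    also have "\<dots> \<le> (INF (s, u)\<in>{(s, u). - Tmin x0 \<le> s \<and> s < u \<and> u \<le> Tmax x0}.
            ennreal (norm ((1 / (u - s)) *\<^sub>R integral {s..u} (\<lambda>l. eigvec_field f (\<XX> x0 l)))))"
      by (rule INF_lower[OF x0])
    also have "\<dots> \<le> ennreal ?a"
      by (rule order_trans[OF INF_lower[of "(s, u)"]]) (use su in auto)
    finally have "\<gamma> \<le> ?a" by (subst (asm) ennreal_le_iff) auto
    also have "?a = norm (\<XX> x0 u - \<XX> x0 s) / (u - s)" using su by (simp add: FTC)
    finally show ?thesis using su by (simp add: pos_le_divide_eq)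
  qed
  have gap: "gap (d2 f x) \<noteq> 0" if x: "x \<in> \<H>" for x
  proof -
    obtain l1 l2 where "l1 \<noteq> l2" "eigenvalue (Hessian f x) l1" "eigenvalue (Hessian f x) l2"
      using A(25)[OF x] by blast
    moreover have "partial_deriv 2 (partial_deriv 1 f) x = partial_deriv 1 (partial_deriv 2 f) x"
      by (intro partial_deriv_commute f_diff f_cont)
    ultimately show ?thesis
      by (intro gap_nonzero[of "Hessian f x" l1 l2]) (simp_all add: Hessian_def d2_nth idx1_def idx2_def)
  qed
  \<comment> \<open>Positive and negative times are treated by \<open>\<sigma> = 1\<close> and \<open>\<sigma> = - 1\<close>.\<close>
  have onesided: "\<exists>C>0. whp M (\<lambda>n \<omega>. \<forall>x\<in>\<G>. \<forall>t\<in>{0..\<tau> x}. norm (\<XX>hat n \<omega> x (\<sigma> * t) - \<XX> x (\<sigma> * t)) \<le> C * rate n)"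
    if \<sigma>: "\<bar>\<sigma>\<bar> = 1" and \<tau>: "\<And>x. x \<in> \<G> \<Longrightarrow> 0 \<le> \<tau> x"
      and range: "\<And>x t. x \<in> \<G> \<Longrightarrow> t \<in> {0..\<tau> x} \<Longrightarrow> \<sigma> * t \<in> {- Tmin x..Tmax x}" for \<sigma> :: real and \<tau>
  proof (rule whp_curves[where H = \<H> and \<gamma> = \<gamma> and \<sigma> = \<sigma>])
    have reparam: "((\<lambda>t. c (\<sigma> * t)) has_vector_derivative \<sigma> *\<^sub>R W (c (\<sigma> * t))) (at t)"
      if "integral_curve W x c" for W x c t
    proof -
      have "(c has_vector_derivative W (c (\<sigma> * t))) (at (\<sigma> * t))" using that by (simp add: integral_curve_def)
      moreover have "((\<lambda>t. \<sigma> * t) has_vector_derivative \<sigma>) (at t)"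
        by (auto intro!: derivative_eq_intros simp: has_real_derivative_iff_has_vector_derivative[symmetric])
      ultimately show ?thesis
        using vector_diff_chain_at[of "\<lambda>t. \<sigma> * t" \<sigma> t c] by (simp add: o_def)
    qed
    show "((\<lambda>t. \<XX> x (\<sigma> * t)) has_vector_derivative \<sigma> *\<^sub>R eigvec_field f (\<XX> x (\<sigma> * t))) (at t)" for x t
      by (rule reparam[OF A(6)])
    show "((\<lambda>t. \<XX>hat n \<omega> x (\<sigma> * t)) has_vector_derivative \<sigma> *\<^sub>R Vhat n \<omega> (\<XX>hat n \<omega> x (\<sigma> * t))) (at t)"
      if "n \<ge> 1" "\<omega> \<in> space M" for n \<omega> x t
      by (rule reparam[OF A(7)[OF that]])
    show "\<XX> x (\<sigma> * 0) = x" for x using A(6)[of x] by (simp add: integral_curve_def)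
    show "\<XX>hat n \<omega> x (\<sigma> * 0) = x" if "n \<ge> 1" "\<omega> \<in> space M" for n \<omega> x
      using A(7)[OF that, of x] by (simp add: integral_curve_def)
    show "\<XX> x (\<sigma> * s) \<in> \<H>" if "x \<in> \<G>" "s \<in> {0..\<tau> x}" for x s
      using A(17)[OF that(1)] range[OF that] by blast
    show "\<gamma> * (u - s) \<le> norm (\<XX> x (\<sigma> * u) - \<XX> x (\<sigma> * s))"
      if "x \<in> \<G>" "0 \<le> s" "s < u" "u \<le> \<tau> x" for x s u
    proof -
      have r: "\<sigma> * s \<in> {- Tmin x..Tmax x}" "\<sigma> * u \<in> {- Tmin x..Tmax x}"
        using range[of x s] range[of x u] that by auto
      from \<sigma> have "\<sigma> = 1 \<or> \<sigma> = - 1" by linarith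
      then show ?thesis
      proof
        assume "\<sigma> = 1"
        then show ?thesis using chord[OF that(1), of s u] r that by simp
      next
        assume "\<sigma> = - 1"
        then show ?thesis using chord[OF that(1), of "- u" "- s"] r that by (simp add: norm_minus_commute)
      qed
    qed
  qed (use \<sigma> \<tau> gap A in auto)
  obtain C1 where C1: "C1 > 0" "whp M (\<lambda>n \<omega>. \<forall>x\<in>\<G>. \<forall>t\<in>{0..Tmax x}. norm (\<XX>hat n \<omega> x (1 * t) - \<XX> x (1 * t)) \<le> C1 * rate n)"
    using onesided[of 1 Tmax] A(14) by force
  obtain C2 where C2: "C2 > 0" "whp M (\<lambda>n \<omega>. \<forall>x\<in>\<G>. \<forall>t\<in>{0..Tmin x}. norm (\<XX>hat n \<omega> x (- 1 * t) - \<XX> x (- 1 * t)) \<le> C2 * rate n)"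
    using onesided[of "- 1" Tmin] A(14) by force
  let ?Z = "\<lambda>n \<omega>. SUP x0\<in>\<G>. SUP t\<in>{- Tmin x0..Tmax x0}. ennreal (norm (\<XX>hat n \<omega> x0 t - \<XX> x0 t))"
  have "whp M (\<lambda>n \<omega>. ?Z n \<omega> \<le> ennreal ((C1 + C2) * rate n))"
  proof (rule whp_mono[OF whp_conj[OF C1(2) C2(2)]])
    show "\<forall>\<^sub>F n in sequentially. \<forall>\<omega>\<in>space M.
       (\<forall>x\<in>\<G>. \<forall>t\<in>{0..Tmax x}. norm (\<XX>hat n \<omega> x (1 * t) - \<XX> x (1 * t)) \<le> C1 * rate n) \<and>
       (\<forall>x\<in>\<G>. \<forall>t\<in>{0..Tmin x}. norm (\<XX>hat n \<omega> x (- 1 * t) - \<XX> x (- 1 * t)) \<le> C2 * rate n) \<longrightarrow>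
       ?Z n \<omega> \<le> ennreal ((C1 + C2) * rate n)"
      using eventually_ge_at_top[of 1]
    proof (eventually_elim, intro ballI impI SUP_least ennreal_leI, elim conjE)
      fix n \<omega> x t
      assume n: "1 \<le> n" and x: "x \<in> \<G>" and t: "t \<in> {- Tmin x..Tmax x}"
        and e1: "\<forall>x\<in>\<G>. \<forall>t\<in>{0..Tmax x}. norm (\<XX>hat n \<omega> x (1 * t) - \<XX> x (1 * t)) \<le> C1 * rate n"
        and e2: "\<forall>x\<in>\<G>. \<forall>t\<in>{0..Tmin x}. norm (\<XX>hat n \<omega> x (- 1 * t) - \<XX> x (- 1 * t)) \<le> C2 * rate n"
      have c: "0 \<le> C1 * rate n" "0 \<le> C2 * rate n" using C1(1) C2(1) rate_nonneg[OF n] by auto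
      show "norm (\<XX>hat n \<omega> x t - \<XX> x t) \<le> (C1 + C2) * rate n"
      proof (cases "0 \<le> t")
        case True
        then have "norm (\<XX>hat n \<omega> x t - \<XX> x t) \<le> C1 * rate n"
          using bspec[OF bspec[OF e1 x], of t] t by simp
        then show ?thesis using c by (simp add: distrib_right)
      next
        case False
        then have "norm (\<XX>hat n \<omega> x t - \<XX> x t) \<le> C2 * rate n"
          using bspec[OF bspec[OF e2 x], of "- t"] t by simp
        then show ?thesis using c by (simp add: distrib_right)
      qed
    qed
  qed
  then show ?thesis
    unfolding bigO_in_prob_def whp_def
  proof (intro allI impI exI[of _ "C1 + C2"] conjI)
    fix \<epsilon> :: real assume "\<epsilon> > 0"
    assume "\<forall>\<epsilon>>0. \<forall>\<^sub>F n in sequentially. \<exists>A\<in>events. prob A < \<epsilon> \<and>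
      (\<forall>\<omega>\<in>space M - A. ?Z n \<omega> \<le> ennreal ((C1 + C2) * rate n))"
    with \<open>\<epsilon> > 0\<close> have "\<forall>\<^sub>F n in sequentially. \<exists>A\<in>events. prob A < \<epsilon> \<and>
      (\<forall>\<omega>\<in>space M - A. ?Z n \<omega> \<le> ennreal ((C1 + C2) * rate n))" by blast
    then show "\<forall>\<^sub>F n in sequentially. \<exists>A\<in>events. {\<omega> \<in> space M. ?Z n \<omega> >
        ennreal ((C1 + C2) * sqrt (ln (real n) / (real n * h n ^ 5)))} \<subseteq> A \<and> prob A < \<epsilon>"
      unfolding rate_def
    proof eventually_elim
      case (elim n)
      then obtain B where "B \<in> events" "prob B < \<epsilon>"
        "\<forall>\<omega>\<in>space M - B. ?Z n \<omega> \<le> ennreal ((C1 + C2) * sqrt (ln (real n) / (real n * h n ^ 5)))" by blast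
      then show ?case by (intro bexI[of _ B]) (auto simp: not_less[symmetric])
    qed
  qed (use C1(1) C2(1) in simp)
qed

end
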